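(* Let $d\ge 1$, $n\ge 2$, and let $\mathbb{Z}_n^d$ be the discrete torus (vertices $(\mathbb{Z}/n\mathbb{Z})^d$, two vertices adjacent iff they differ by $\pm1$ mod $n$ in exactly one coordinate). Let $(\sigma(\mathbf x))_{\mathbf x\in\mathbb{Z}_n^d}$ be i.i.d. $N(0,1)$ and define the divisible sandpile $$s_{d,n}(\mathbf x)=1+\sigma(\mathbf x)-\frac{1}{n^d}\sum_{\mathbf y\in\mathbb{Z}_n^d}\sigma(\mathbf y).$$ Then $s_{d,n}$ stabilizes to the all $1$ configuration (i.e. its odometer $u_{d,n}$ is finite and $s_{d,n}+\Delta u_{d,n}\equiv 1$), and there is a constant $C_d$ depending only on $d$ such that $$C_d^{-1}\phi_d(n)\le \mathbb{E}\,u_{d,n}(\mathbf x)\le C_d\,\phi_d(n)$$ for all $n\ge 2$ and all $\mathbf x\in\mathbb{Z}_n^d$, where $\phi_d(n)=n^{3/2}$ if $d=1$, $n$ if $d=2$, $n^{1/2}$ if $d=3$, $\log n$ if $d=4$, and $(\log n)^{1/2}$ if $d\ge 5$.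
   Context: The graph Laplacian is $\Delta u(x)=\sum_{y\sim x}(u(y)-u(x))$. For a divisible sandpile $s:V\to\mathbb{R}$ on a graph, let $\mathcal{F}_s=\{f:V\to\mathbb{R}: f\ge0,\ s+\Delta f\le 1\}$. The odometer of $s$ is $u(x)=\inf\{f(x): f\in\mathcal{F}_s\}$ (with $\inf\emptyset=\infty$); equivalently it is the total mass emitted from $x$ to each neighbour in any legal stabilizing toppling procedure. $s$ stabilizes if $\mathcal{F}_s\ne\emptyset$. *)

theory Defs
  imports "HOL-Probability.Probability"
begin

text \<open>General graphs: vertex set V, adjacency relation E (symmetric, irreflexive).\<close>

definition graph_laplacian :: "'a set \<Rightarrow> ('a \<Rightarrow> 'a \<Rightarrow> bool) \<Rightarrow> ('a \<Rightarrow> real) \<Rightarrow> 'a \<Rightarrow> real" where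
  "graph_laplacian V E u x = (\<Sum>y\<in>{y\<in>V. E x y}. u y - u x)"

definition admissible :: "'a set \<Rightarrow> ('a \<Rightarrow> 'a \<Rightarrow> bool) \<Rightarrow> ('a \<Rightarrow> real) \<Rightarrow> ('a \<Rightarrow> real) set" where
  "admissible V E s = {f. (\<forall>x\<in>V. 0 \<le> f x) \<and> (\<forall>x\<in>V. s x + graph_laplacian V E f x \<le> 1)}"

text \<open>Odometer: pointwise infimum over F_s, valued in extended reals (inf of empty set = infinity).\<close>
definition odometer :: "'a set \<Rightarrow> ('a \<Rightarrow> 'a \<Rightarrow> bool) \<Rightarrow> ('a \<Rightarrow> real) \<Rightarrow> 'a \<Rightarrow> ereal" where
  "odometer V E s x = (INF f \<in> admissible V E s. ereal (f x))"

definition torus :: "nat \<Rightarrow> nat \<Rightarrow> nat list set" where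
  "torus d n = {xs. length xs = d \<and> set xs \<subseteq> {..<n}}"

definition torus_adj :: "nat \<Rightarrow> nat list \<Rightarrow> nat list \<Rightarrow> bool" where
  "torus_adj n xs ys \<longleftrightarrow> length ys = length xs \<and>
     (\<exists>i<length xs. (\<forall>j<length xs. j \<noteq> i \<longrightarrow> xs ! j = ys ! j) \<and>
        (ys ! i = (xs ! i + 1) mod n \<or> xs ! i = (ys ! i + 1) mod n))"

definition sandpile :: "nat \<Rightarrow> nat \<Rightarrow> (nat list \<Rightarrow> real) \<Rightarrow> nat list \<Rightarrow> real" where
  "sandpile d n \<sigma> x = 1 + \<sigma> x - (\<Sum>y\<in>torus d n. \<sigma> y) / real n ^ d"

definition gauss_field :: "nat \<Rightarrow> nat \<Rightarrow> (nat list \<Rightarrow> real) measure" where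
  "gauss_field d n = PiM (torus d n) (\<lambda>_. density lborel (\<lambda>t. ennreal (std_normal_density t)))"

definition phi :: "nat \<Rightarrow> nat \<Rightarrow> real" where
  "phi d n = (if d = 1 then real n powr (3/2)
              else if d = 2 then real n
              else if d = 3 then sqrt (real n)
              else if d = 4 then ln (real n)
              else sqrt (ln (real n)))"

end

theory Submission
  imports Defs "HOL-Real_Asymp.Real_Asymp"
begin

text \<open>The odometer is \<open>g - min g\<close>, where \<open>g\<close> is the image of the noise under the Green operator of the torus,
  so its mean is the expected maximum of the centred Gaussian field \<open>g\<close>.

  Upper bounds: the Fourier expansion of the Green function bounds the variance of \<open>g\<close> and of its increments.
  For \<open>d \<ge> 4\<close> a union bound suffices; for \<open>d \<le> 3\<close> the increments are Hoelder and chaining over dyadic nets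
  removes the logarithm.

  Lower bounds: for every test function \<open>f\<close> the pairing of \<open>- \<Delta> f\<close> with \<open>g\<close> is, up to the mean of the noise,
  the pairing of \<open>f\<close> with the noise. Hence the oscillation of \<open>g\<close> dominates
  \<open>2 \<langle>f, noise\<rangle> / |\<Delta> f|\<^sub>1\<close>, and disjointly supported test functions give independent Gaussians,
  which replaces Slepian-type comparison. One uses the lowest Fourier mode for \<open>d \<le> 3\<close>, point masses for
  \<open>d \<ge> 5\<close>, and truncated Green functions at a polynomial number of centres for \<open>d = 4\<close>.\<close>

section \<open>The torus and its Laplacian\<close>

text \<open>The rates come from one radial sum: up to a constant, the variance of \<open>g\<close>
  is at most \<open>n^(4-d)\<close> times the sum of \<open>k^(d-5)\<close> over
  \<open>1 <= k <= n\<close>. For \<open>d <= 3\<close> the low frequencies carry it, so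
  \<open>g\<close> behaves like a smooth random profile of height \<open>n^(2-d/2)\<close>, and its
  maximum is of the size of its standard deviation. For \<open>d >= 5\<close> the variance is
  bounded and the rate is that of a maximum of \<open>n^d\<close> Gaussians. For
  \<open>d = 4\<close> the standard deviation and the maximum contribute one factor
  \<open>sqrt (ln n)\<close> each.

  The obstacle in the lower bounds is the strong correlation of the values of \<open>g\<close>.
  Pairing with \<open>- \<Delta> f\<close> returns to the independent noise at the price of the L1
  norm of \<open>\<Delta> f\<close>, so a good test function has a large L2 norm compared with the
  L1 norm of its Laplacian. In \<open>d = 4\<close> a fundamental solution does this with a
  logarithmically diverging squared L2 norm, and disjoint translates of it supply the second factor.

  Estimates that hold for large \<open>n\<close> only are extended to all \<open>n >= 2\<close> by
  the positivity of the mean, which the lowest Fourier mode gives.\<close>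

lemma torus_iff: "x \<in> torus d n \<longleftrightarrow> length x = d \<and> (\<forall>i<d. x ! i < n)"
  by (auto simp: torus_def subset_iff in_set_conv_nth)

lemma torus_0: "torus 0 n = {[]}"
  by (auto simp: torus_def)

lemma torus_Suc: "torus (Suc d) n = (\<lambda>(k, x). k # x) ` ({..<n} \<times> torus d n)"
proof -
  have "y \<in> (\<lambda>(k, x). k # x) ` ({..<n} \<times> torus d n)" if "y \<in> torus (Suc d) n" for y
    using that by (cases y) (auto simp: torus_def)
  then show ?thesis by (auto simp: torus_def)
qed

lemma finite_torus [simp]: "finite (torus d n)"
  by (induction d) (auto simp: torus_0 torus_Suc)

lemma sum_torus_Suc:
  "(\<Sum>x\<in>torus (Suc d) n. F x) = (\<Sum>k<n. \<Sum>x\<in>torus d n. F (k # x))"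
  unfolding torus_Suc sum.cartesian_product
  by (subst sum.reindex) (auto simp: inj_on_def case_prod_unfold)

text \<open>Distributivity, one coordinate at a time. The cardinality of the torus, the
  orthogonality of characters and the counting of boxes are instances.\<close>

lemma sum_torus_prod:
  fixes F :: "nat \<Rightarrow> nat \<Rightarrow> 'a::comm_semiring_1"
  shows "(\<Sum>x\<in>torus d n. \<Prod>i<d. F i (x ! i)) = (\<Prod>i<d. \<Sum>k<n. F i k)"
proof (induction d arbitrary: F)
  case 0
  show ?case by (simp add: torus_0)
next
  case (Suc d)
  have "(\<Sum>x\<in>torus (Suc d) n. \<Prod>i<Suc d. F i (x ! i))
      = (\<Sum>k<n. \<Sum>x\<in>torus d n. F 0 k * (\<Prod>i<d. F (Suc i) (x ! i)))"
    unfolding sum_torus_Suc by (simp add: prod.lessThan_Suc_shift del: prod.lessThan_Suc)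
  also have "\<dots> = (\<Sum>k<n. F 0 k) * (\<Prod>i<d. \<Sum>k<n. F (Suc i) k)"
    by (simp add: sum_distrib_left[symmetric] Suc.IH[of "\<lambda>i. F (Suc i)"] sum_distrib_right)
  also have "\<dots> = (\<Prod>i<Suc d. \<Sum>k<n. F i k)"
    by (simp add: prod.lessThan_Suc_shift del: prod.lessThan_Suc)
  finally show ?case .
qed

lemma card_torus: "card (torus d n) = n ^ d"
  using sum_torus_prod[where d = d and n = n and F = "\<lambda>_ _. 1::nat"] by simp

lemma torus_nonempty: "n \<ge> 1 \<Longrightarrow> torus d n \<noteq> {}"
  using card_torus[of d n] by (metis card.empty not_one_le_zero power_eq_0_iff)

lemma torus_update: "x \<in> torus d n \<Longrightarrow> k < n \<Longrightarrow> x[i := k] \<in> torus d n"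
  by (cases "i < d") (auto simp: torus_iff nth_list_update)

lemma torus_adj_sym: "torus_adj n x y \<Longrightarrow> torus_adj n y x"
  unfolding torus_adj_def by metis

text \<open>Both sides are double sums over adjacent pairs: the mixed terms agree after swapping the
  summation variables, as adjacency is symmetric, and the diagonal terms agree outright.\<close>

lemma laplacian_selfadjoint:
  assumes "finite V" and sym: "\<And>x y. E x y \<Longrightarrow> E y x"
  shows "(\<Sum>x\<in>V. f x * graph_laplacian V E g x) = (\<Sum>x\<in>V. g x * graph_laplacian V E f x)"
proof -
  have *: "(\<Sum>x\<in>V. f x * graph_laplacian V E g x)
      = (\<Sum>x\<in>V. \<Sum>y\<in>V. if E x y then f x * g y - f x * g x else 0)" for f g
    unfolding graph_laplacian_def using assms(1)
    by (intro sum.cong refl) (simp add: sum_distrib_left right_diff_distrib flip: sum.inter_filter)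
  have E_sym: "E x y = E y x" for x y using sym by blast
  have "(\<Sum>x\<in>V. \<Sum>y\<in>V. if E x y then f x * g y else 0) = (\<Sum>x\<in>V. \<Sum>y\<in>V. if E x y then g x * f y else 0)"
    by (subst sum.swap) (intro sum.cong refl, subst E_sym, simp add: mult.commute)
  moreover have "(\<Sum>x\<in>V. \<Sum>y\<in>V. if E x y then f x * g y - f x * g x else 0)
      = (\<Sum>x\<in>V. \<Sum>y\<in>V. if E x y then f x * g y else 0) - (\<Sum>x\<in>V. \<Sum>y\<in>V. if E x y then f x * g x else 0)" for f g :: "'a \<Rightarrow> real"
    by (simp add: sum_subtractf[symmetric]) (intro sum.cong refl, simp)
  moreover have "(\<Sum>x\<in>V. \<Sum>y\<in>V. if E x y then f x * g x else 0) = (\<Sum>x\<in>V. \<Sum>y\<in>V. if E x y then g x * f x else 0)"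
    by (intro sum.cong refl) (simp add: mult.commute)
  ultimately show ?thesis unfolding * by simp
qed

lemma sum_laplacian:
  assumes "finite V" and "\<And>x y. E x y \<Longrightarrow> E y x"
  shows "(\<Sum>x\<in>V. graph_laplacian V E f x) = 0"
  using laplacian_selfadjoint[OF assms, where f = "\<lambda>_. 1" and g = f] by (simp add: graph_laplacian_def)

lemma laplacian_diff:
  "graph_laplacian V E (\<lambda>y. f y - g y) x = graph_laplacian V E f x - graph_laplacian V E g x"
  by (simp add: graph_laplacian_def sum_subtractf[symmetric]) (intro sum.cong refl, simp)

lemma laplacian_cmult:
  "graph_laplacian V E (\<lambda>y. c * f y) x = c * graph_laplacian V E f x"
  by (simp add: graph_laplacian_def sum_distrib_left right_diff_distrib)

lemma laplacian_sum:
  "graph_laplacian V E (\<lambda>y. \<Sum>z\<in>A. f z y) x = (\<Sum>z\<in>A. graph_laplacian V E (f z) x)"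
  unfolding graph_laplacian_def sum_subtractf[symmetric] by (rule sum.swap)

definition fwd :: "nat \<Rightarrow> nat \<Rightarrow> nat" where "fwd n k = (k + 1) mod n"
definition bwd :: "nat \<Rightarrow> nat \<Rightarrow> nat" where "bwd n k = (k + n - 1) mod n"

text \<open>For \<open>n = 2\<close> the two neighbours in a coordinate direction coincide, so every edge is
  counted twice by the formula below.\<close>

definition edge_weight :: "nat \<Rightarrow> real" where "edge_weight n = (if n = 2 then 1/2 else 1)"

lemma fwd_eq: "k < n \<Longrightarrow> fwd n k = (if k = n - 1 then 0 else k + 1)"
  by (auto simp: fwd_def)

lemma bwd_eq: "k < n \<Longrightarrow> bwd n k = (if k = 0 then n - 1 else k - 1)"
  by (auto simp: bwd_def mod_if)

lemma laplacian_torus: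
  assumes n: "n \<ge> 2" and x: "x \<in> torus d n"
  shows "graph_laplacian (torus d n) (torus_adj n) u x
       = edge_weight n * (\<Sum>i<d. u (x[i := fwd n (x ! i)]) + u (x[i := bwd n (x ! i)]) - 2 * u x)"
proof -
  have len: "length x = d" and lt: "\<And>i. i < d \<Longrightarrow> x ! i < n" using x by (auto simp: torus_iff)
  define N where "N i = {x[i := fwd n (x ! i)], x[i := bwd n (x ! i)]}" for i
  have fwd_lt: "fwd n k < n" and bwd_lt: "bwd n k < n" for k
    using n by (auto simp: fwd_def bwd_def)
  have step: "(b = (a + 1) mod n \<or> a = (b + 1) mod n) \<longleftrightarrow> b = fwd n a \<or> b = bwd n a"
    if "a < n" "b < n" for a b
    using that n by (auto simp: fwd_eq bwd_eq mod_if split: if_splits)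
  have nbr: "{y \<in> torus d n. torus_adj n x y} = (\<Union>i<d. N i)"
  proof (intro equalityI subsetI)
    fix y assume "y \<in> {y \<in> torus d n. torus_adj n x y}"
    then obtain i where y: "y \<in> torus d n" "i < d" "\<forall>j<d. j \<noteq> i \<longrightarrow> x ! j = y ! j"
      "y ! i = (x ! i + 1) mod n \<or> x ! i = (y ! i + 1) mod n"
      by (auto simp: torus_adj_def len)
    have "y = x[i := y ! i]"
      using y len by (intro nth_equalityI) (auto simp: torus_iff nth_list_update)
    moreover have "y ! i = fwd n (x ! i) \<or> y ! i = bwd n (x ! i)"
      using y step lt by (auto simp: torus_iff)
    ultimately show "y \<in> (\<Union>i<d. N i)" using y(2) by (auto simp: N_def)
  next
    fix y assume "y \<in> (\<Union>i<d. N i)"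
    then obtain i where i: "i < d" "y \<in> N i" by auto
    then have y: "y = x[i := y ! i]" "y ! i = fwd n (x ! i) \<or> y ! i = bwd n (x ! i)"
      using len by (auto simp: N_def)
    then have "y ! i < n" using fwd_lt bwd_lt by auto
    then have "y \<in> torus d n" using y(1) torus_update[OF x] by metis
    moreover have "\<forall>j<d. j \<noteq> i \<longrightarrow> x ! j = y ! j" using y(1) by (metis nth_list_update_neq)
    moreover have "y ! i = (x ! i + 1) mod n \<or> x ! i = (y ! i + 1) mod n"
      using step y(2) lt[OF i(1)] \<open>y ! i < n\<close> by blast
    ultimately show "y \<in> {y \<in> torus d n. torus_adj n x y}"
      using i(1) len by (auto simp: torus_adj_def torus_iff)
  qed
  have ne: "fwd n (x ! i) \<noteq> x ! i" "bwd n (x ! i) \<noteq> x ! i" if "i < d" for i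
    using lt[OF that] n by (auto simp: fwd_eq bwd_eq)
  \<comment> \<open>Neighbours in direction \<open>i\<close> differ from \<open>x\<close> in
    coordinate \<open>i\<close> and nowhere else, since \<open>n >= 2\<close> makes both shifts
    proper.\<close>
  have disj: "N i \<inter> N j = {}" if "i < d" "j < d" "i \<noteq> j" for i j
  proof -
    have "y ! i \<noteq> x ! i" if "y \<in> N i" for y
      using that ne[OF \<open>i < d\<close>] \<open>i < d\<close> len by (auto simp: N_def)
    moreover have "y ! i = x ! i" if "y \<in> N j" for y
      using that \<open>i \<noteq> j\<close> by (auto simp: N_def)
    ultimately show ?thesis by blast
  qed
  have N_sum: "(\<Sum>y\<in>N i. u y - u x)
      = edge_weight n * (u (x[i := fwd n (x ! i)]) + u (x[i := bwd n (x ! i)]) - 2 * u x)" if "i < d" for i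
  proof (cases "n = 2")
    case True
    have "fwd n (x ! i) = bwd n (x ! i)" using lt[OF that] True by (auto simp: fwd_eq bwd_eq)
    then show ?thesis using True by (simp add: N_def edge_weight_def)
  next
    case False
    have "fwd n (x ! i) \<noteq> bwd n (x ! i)" using lt[OF that] n False by (auto simp: fwd_eq bwd_eq)
    then have "x[i := fwd n (x ! i)] \<noteq> x[i := bwd n (x ! i)]"
      using len that by (metis nth_list_update_eq)
    then show ?thesis using False by (simp add: N_def edge_weight_def)
  qed
  have "graph_laplacian (torus d n) (torus_adj n) u x = (\<Sum>y\<in>(\<Union>i<d. N i). u y - u x)"
    by (simp add: graph_laplacian_def nbr)
  also have "\<dots> = (\<Sum>i<d. \<Sum>y\<in>N i. u y - u x)"
    using disj by (intro sum.UNION_disjoint) (auto simp: N_def)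
  also have "\<dots> = edge_weight n * (\<Sum>i<d. u (x[i := fwd n (x ! i)]) + u (x[i := bwd n (x ! i)]) - 2 * u x)"
    by (simp add: N_sum sum_distrib_left)
  finally show ?thesis .
qed

section \<open>Characters and the Green function\<close>

definition uroot :: "nat \<Rightarrow> nat \<Rightarrow> complex" where
  "uroot n k = cis (2 * pi * real k / real n)"

text \<open>The character exp(2 pi i <k, x> / n). Frequencies are indexed by torus points as well,
  so \<open>k\<close> and \<open>x\<close> play symmetric roles (\<open>chr_swap\<close>), and
  orthogonality in one variable gives it in the other.\<close>

definition chr :: "nat \<Rightarrow> nat list \<Rightarrow> nat list \<Rightarrow> complex" where
  "chr n k x = (\<Prod>i<length x. uroot n (k ! i) ^ (x ! i))"

lemma norm_uroot [simp]: "norm (uroot n k) = 1"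
  by (simp add: uroot_def)

lemma uroot_power_period: "n > 0 \<Longrightarrow> uroot n k ^ n = 1"
  by (simp add: uroot_def Complex.DeMoivre cis_multiple_2pi)

lemma uroot_power_swap: "uroot n k ^ j = uroot n j ^ k"
  by (simp add: uroot_def Complex.DeMoivre mult_ac)

lemma uroot_inj: "n > 0 \<Longrightarrow> j < n \<Longrightarrow> k < n \<Longrightarrow> uroot n j = uroot n k \<longleftrightarrow> j = k"
  using Complex.bij_betw_roots_unity[of n] unfolding bij_betw_def inj_on_def uroot_def by auto

lemma norm_chr [simp]: "norm (chr n k x) = 1"
  by (simp add: chr_def prod_norm[symmetric] norm_power)

lemma chr_swap: "length k = length x \<Longrightarrow> chr n k x = chr n x k"
  unfolding chr_def by (subst uroot_power_swap) simp

text \<open>A geometric series whose ratio is an \<open>n\<close>-th root of unity, different from 1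
  unless \<open>j = k\<close>.\<close>

lemma sum_uroot_orthogonal:
  assumes "j < n" "k < n"
  shows "(\<Sum>a<n. uroot n j ^ a * cnj (uroot n k ^ a)) = (if j = k then of_nat n else 0)"
proof -
  define z where "z = uroot n j * cnj (uroot n k)"
  have unit: "uroot n k * cnj (uroot n k) = 1" for k
    using complex_norm_square[of "uroot n k"] by simp
  have sum: "(\<Sum>a<n. uroot n j ^ a * cnj (uroot n k ^ a)) = (\<Sum>a<n. z ^ a)"
    by (simp add: z_def power_mult_distrib)
  show ?thesis
  proof (cases "j = k")
    case True
    then show ?thesis unfolding sum by (simp add: z_def unit)
  next
    case False
    have "z \<noteq> 1"
    proof
      assume "z = 1"
      then have "uroot n k = uroot n j * (uroot n k * cnj (uroot n k))"
        by (metis mult.commute mult.left_commute mult.right_neutral z_def)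
      then show False using uroot_inj[of n j k] assms False unit by auto
    qed
    moreover have "z ^ n = 1"
      using uroot_power_period[of n] assms
      by (simp add: z_def power_mult_distrib flip: complex_cnj_power)
    ultimately show ?thesis unfolding sum using False by (simp add: geometric_sum)
  qed
qed

lemma sum_chr_orthogonal:
  assumes "j \<in> torus d n" "k \<in> torus d n"
  shows "(\<Sum>x\<in>torus d n. chr n j x * cnj (chr n k x)) = (if j = k then of_nat n ^ d else 0)"
proof -
  have "(\<Sum>x\<in>torus d n. chr n j x * cnj (chr n k x))
      = (\<Sum>x\<in>torus d n. \<Prod>i<d. uroot n (j ! i) ^ (x ! i) * cnj (uroot n (k ! i) ^ (x ! i)))"
    by (intro sum.cong) (auto simp: chr_def torus_iff prod.distrib)
  also have "\<dots> = (\<Prod>i<d. \<Sum>a<n. uroot n (j ! i) ^ a * cnj (uroot n (k ! i) ^ a))"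
    by (rule sum_torus_prod)
  also have "\<dots> = (\<Prod>i<d. if j ! i = k ! i then of_nat n else 0)"
    using assms by (intro prod.cong refl sum_uroot_orthogonal) (auto simp: torus_iff)
  also have "\<dots> = (if j = k then of_nat n ^ d else 0)"
  proof (cases "j = k")
    case False
    then obtain i where "i < d" "j ! i \<noteq> k ! i"
      using assms by (metis nth_equalityI torus_iff)
    then have "(\<Prod>i<d. if j ! i = k ! i then of_nat n else (0::complex)) = 0"
      by (intro prod_zero) auto
    then show ?thesis using False by simp
  qed simp
  finally show ?thesis .
qed

lemma sum_chr_dual:
  assumes "x \<in> torus d n" "y \<in> torus d n"
  shows "(\<Sum>k\<in>torus d n. chr n k x * cnj (chr n k y)) = (if x = y then of_nat n ^ d else 0)"
proof -
  have "(\<Sum>k\<in>torus d n. chr n k x * cnj (chr n k y)) = (\<Sum>k\<in>torus d n. chr n x k * cnj (chr n y k))"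
    using assms by (intro sum.cong refl) (metis chr_swap torus_iff)
  then show ?thesis using sum_chr_orthogonal[OF assms] by simp
qed

text \<open>Expand the square and sum over \<open>y\<close> first: orthogonality leaves only the
  diagonal.\<close>

lemma parseval_chr:
  assumes "A \<subseteq> torus d n"
  shows "(\<Sum>y\<in>torus d n. (norm (\<Sum>k\<in>A. c k * cnj (chr n k y)))\<^sup>2) = real n ^ d * (\<Sum>k\<in>A. (norm (c k))\<^sup>2)"
proof -
  have fin: "finite A" using assms finite_subset finite_torus by blast
  have "complex_of_real (\<Sum>y\<in>torus d n. (norm (\<Sum>k\<in>A. c k * cnj (chr n k y)))\<^sup>2)
      = (\<Sum>y\<in>torus d n. \<Sum>k\<in>A. \<Sum>j\<in>A. c k * cnj (c j) * (chr n j y * cnj (chr n k y)))"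
    by (simp add: complex_norm_square sum_product mult_ac del: of_real_power)
  also have "\<dots> = (\<Sum>k\<in>A. \<Sum>j\<in>A. \<Sum>y\<in>torus d n. c k * cnj (c j) * (chr n j y * cnj (chr n k y)))"
    by (subst sum.swap, rule sum.cong[OF refl], subst sum.swap) simp
  also have "\<dots> = (\<Sum>k\<in>A. \<Sum>j\<in>A. c k * cnj (c j) * (if j = k then of_nat n ^ d else 0))"
    using assms by (intro sum.cong refl) (simp add: sum_distrib_left[symmetric] sum_chr_orthogonal subset_iff)
  also have "\<dots> = (\<Sum>k\<in>A. c k * cnj (c k) * of_nat n ^ d)"
    using fin by (simp add: if_distrib[of "\<lambda>z. _ * z"] sum.delta cong: if_cong)
  also have "\<dots> = complex_of_real (real n ^ d * (\<Sum>k\<in>A. (norm (c k))\<^sup>2))"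
    by (simp add: sum_distrib_left complex_norm_square mult_ac del: of_real_power flip: of_nat_power)
  finally show ?thesis using of_real_eq_iff by blast
qed

text \<open>The eigenvalue of minus the Laplacian at the character \<open>chr n k\<close>.\<close>

definition eigenval :: "nat \<Rightarrow> nat list \<Rightarrow> real" where
  "eigenval n k = edge_weight n * (\<Sum>i<length k. 2 - 2 * cos (2 * pi * real (k ! i) / real n))"

lemma chr_update:
  assumes "x \<in> torus d n" "i < d"
  shows "chr n k (x[i := a]) = chr n k x * (uroot n (k ! i) ^ a * cnj (uroot n (k ! i)) ^ (x ! i))"
proof -
  have unit: "uroot n k * cnj (uroot n k) = 1" for k
    using complex_norm_square[of "uroot n k"] by simp
  have len: "length x = d" using assms by (simp add: torus_iff)
  have "chr n k (x[i := a]) = uroot n (k ! i) ^ a * (\<Prod>j\<in>{..<d} - {i}. uroot n (k ! j) ^ (x ! j))"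
    using assms(2) len unfolding chr_def by (simp add: prod.remove[of _ i])
  moreover have "chr n k x = uroot n (k ! i) ^ (x ! i) * (\<Prod>j\<in>{..<d} - {i}. uroot n (k ! j) ^ (x ! j))"
    using assms(2) len unfolding chr_def by (simp add: prod.remove[of _ i])
  moreover have "uroot n (k ! i) ^ (x ! i) * cnj (uroot n (k ! i)) ^ (x ! i) = 1"
    by (simp add: power_mult_distrib[symmetric] unit)
  ultimately show ?thesis by (simp add: algebra_simps)
qed

lemma uroot_fwd_bwd:
  assumes "n \<ge> 2" "a < n"
  shows "uroot n k ^ fwd n a * cnj (uroot n k) ^ a = uroot n k"
    and "uroot n k ^ bwd n a * cnj (uroot n k) ^ a = cnj (uroot n k)"
proof -
  have unit: "uroot n k * cnj (uroot n k) = 1"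
    using complex_norm_square[of "uroot n k"] by simp
  have per: "uroot n k ^ (b mod n) = uroot n k ^ b" for b
  proof -
    have "uroot n k ^ b = uroot n k ^ (b mod n + n * (b div n))" by simp
    also have "\<dots> = uroot n k ^ (b mod n)"
      using assms unfolding power_add power_mult by (simp add: uroot_power_period)
    finally show ?thesis ..
  qed
  have ua: "uroot n k ^ a * cnj (uroot n k) ^ a = 1"
    by (simp add: power_mult_distrib[symmetric] unit)
  then show "uroot n k ^ fwd n a * cnj (uroot n k) ^ a = uroot n k"
    by (simp add: fwd_def per mult.assoc)
  have "uroot n k ^ (n - 1) = uroot n k ^ (n - 1) * (uroot n k * cnj (uroot n k))" by (simp add: unit)
  also have "\<dots> = uroot n k ^ n * cnj (uroot n k)"
    using assms by (cases n) (auto simp: mult_ac)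
  finally have "uroot n k ^ (n - 1) = cnj (uroot n k)"
    using assms by (simp add: uroot_power_period)
  moreover have "uroot n k ^ (a + n - 1) = uroot n k ^ a * uroot n k ^ (n - 1)"
    using assms by (simp add: power_add[symmetric])
  ultimately show "uroot n k ^ bwd n a * cnj (uroot n k) ^ a = cnj (uroot n k)"
    using ua by (simp add: bwd_def per mult_ac)
qed

text \<open>Direction \<open>i\<close> multiplies a character by w + cnj w - 2 with w =
  \<open>uroot n (k ! i)\<close>, a real number. The real part is taken because
  \<open>graph_laplacian\<close> acts on real functions; the free factor \<open>c\<close> still
  covers arbitrary complex combinations.\<close>

lemma laplacian_Re_chr:
  assumes "n \<ge> 2" "x \<in> torus d n" "k \<in> torus d n"
  shows "graph_laplacian (torus d n) (torus_adj n) (\<lambda>y. Re (c * chr n k y)) x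
       = - eigenval n k * Re (c * chr n k x)"
proof -
  have lt: "x ! i < n" if "i < d" for i using assms(2) that by (simp add: torus_iff)
  have len: "length k = d" using assms(3) by (simp add: torus_iff)
  have "Re (c * chr n k (x[i := fwd n (x ! i)])) + Re (c * chr n k (x[i := bwd n (x ! i)]))
      - 2 * Re (c * chr n k x) = - (2 - 2 * cos (2 * pi * real (k ! i) / real n)) * Re (c * chr n k x)"
    if "i < d" for i
    unfolding chr_update[OF assms(2) that] uroot_fwd_bwd[OF assms(1) lt[OF that]]
    by (simp add: uroot_def algebra_simps)
  then have "(\<Sum>i<d. Re (c * chr n k (x[i := fwd n (x ! i)])) + Re (c * chr n k (x[i := bwd n (x ! i)]))
      - 2 * Re (c * chr n k x))
      = (\<Sum>i<d. - (2 - 2 * cos (2 * pi * real (k ! i) / real n)) * Re (c * chr n k x))"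
    by (intro sum.cong refl) simp
  also have "\<dots> = - (\<Sum>i<d. 2 - 2 * cos (2 * pi * real (k ! i) / real n)) * Re (c * chr n k x)"
    by (simp only: sum_distrib_right sum_negf mult_minus_left)
  finally show ?thesis
    unfolding laplacian_torus[OF assms(1,2)] eigenval_def len by simp
qed

lemma edge_weight_bounds: "1/2 \<le> edge_weight n" "edge_weight n \<le> 1"
  by (auto simp: edge_weight_def)

text \<open>For \<open>a < n\<close>, the distance from \<open>a\<close> to 0 on the cycle of length
  \<open>n\<close>.\<close>

definition tnorm :: "nat \<Rightarrow> nat \<Rightarrow> nat" where "tnorm n a = min a (n - a)"

lemma cos_tnorm:
  assumes "a < n"
  shows "cos (2 * pi * real a / real n) = cos (2 * pi * real (tnorm n a) / real n)"
proof (cases "a \<le> n - a")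
  case False
  then have t: "real (tnorm n a) = real n - real a" using assms by (simp add: tnorm_def min_def of_nat_diff)
  have "cos (2 * pi * real (tnorm n a) / real n) = cos (2 * pi - 2 * pi * real a / real n)"
    using assms unfolding t by (intro arg_cong[of _ _ cos]) (simp add: field_simps)
  then show ?thesis by (simp add: cos_diff)
qed (simp add: tnorm_def min_def)

text \<open>Jordan's inequality: sine is concave on [0, pi], so it lies above its chord from 0 to
  pi/2.\<close>

lemma jordan_sin:
  assumes "0 \<le> t" "t \<le> 1/2"
  shows "2 * t \<le> sin (pi * t)"
proof -
  have conc: "concave_on {0..pi} sin"
    by (rule f''_le0_imp_concave[where f' = cos and f'' = "\<lambda>x. - sin x"])
       (auto intro!: derivative_eq_intros sin_ge_zero)
  have "(1 - 2*t) * sin 0 + (2*t) * sin (pi/2) \<le> sin ((1 - 2*t) *\<^sub>R 0 + (2*t) *\<^sub>R (pi/2))"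
    using assms conc by (intro concave_onD) auto
  then show ?thesis by (simp add: mult.commute)
qed

text \<open>With \<open>?t\<close> as below, 2 - 2 cos (2 pi ?t) = 4 sin^2 (pi ?t) >= 16 ?t^2 by
  \<open>jordan_sin\<close>. The other coordinates add nonnegative terms, and the edge weight costs
  at most a factor 2.\<close>

lemma eigenval_ge_coord:
  assumes "n \<ge> 2" "k \<in> torus d n" "i < d"
  shows "8 * (real (tnorm n (k ! i)) / real n)\<^sup>2 \<le> eigenval n k"
proof -
  let ?t = "real (tnorm n (k ! i)) / real n"
  have ki: "k ! i < n" and len: "length k = d" using assms by (auto simp: torus_iff)
  have "2 * tnorm n (k ! i) \<le> n" by (auto simp: tnorm_def min_def)
  then have "2 * real (tnorm n (k ! i)) \<le> real n" by linarith
  then have t: "0 \<le> ?t" "?t \<le> 1/2" using assms by (auto simp: field_simps)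
  have "(2 * ?t)\<^sup>2 \<le> (sin (pi * ?t))\<^sup>2" using t jordan_sin[OF t] by (intro power_mono) auto
  then have "16 * ?t\<^sup>2 \<le> 4 * (sin (pi * ?t))\<^sup>2" by (simp only: power_mult_distrib) simp
  also have "\<dots> = 2 - 2 * cos (2 * (pi * ?t))" by (subst cos_double_sin) simp
  also have "\<dots> = 2 - 2 * cos (2 * pi * real (k ! i) / real n)"
    using cos_tnorm[OF ki] by (simp add: mult_ac)
  also have "\<dots> \<le> (\<Sum>i<length k. 2 - 2 * cos (2 * pi * real (k ! i) / real n))"
    using assms(3) len by (intro member_le_sum) auto
  finally have *: "16 * ?t\<^sup>2 \<le> (\<Sum>i<length k. 2 - 2 * cos (2 * pi * real (k ! i) / real n))" .
  have "8 * ?t\<^sup>2 \<le> edge_weight n * (16 * ?t\<^sup>2)"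
    using mult_right_mono[OF edge_weight_bounds(1)[of n], of "16 * ?t\<^sup>2"] by simp
  also have "\<dots> \<le> eigenval n k"
    unfolding eigenval_def using * edge_weight_bounds(1)[of n] by (intro mult_left_mono) auto
  finally show ?thesis .
qed

lemma eigenval_pos:
  assumes "n \<ge> 2" "k \<in> torus d n" "k \<noteq> replicate d 0"
  shows "eigenval n k > 0"
proof -
  have "\<exists>i<d. k ! i \<noteq> 0" using assms(2,3) by (auto simp: torus_iff intro!: nth_equalityI)
  then obtain i where i: "i < d" "k ! i \<noteq> 0" by blast
  then have "tnorm n (k ! i) > 0" using assms(2) by (auto simp: tnorm_def torus_iff)
  then have "0 < 8 * (real (tnorm n (k ! i)) / real n)\<^sup>2" using assms(1) by simp
  then show ?thesis using eigenval_ge_coord[OF assms(1,2) i(1)] by linarith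
qed

text \<open>The inverse of minus the Laplacian on mean-zero functions, as a Fourier expansion; the
  zero frequency is omitted because its eigenvalue is 0. The sum is real by the symmetry k -> -k, so
  \<open>Re\<close> only changes the type.\<close>

definition green :: "nat \<Rightarrow> nat \<Rightarrow> nat list \<Rightarrow> nat list \<Rightarrow> real" where
  "green d n x y = Re (\<Sum>k\<in>torus d n - {replicate d 0}.
      of_real (1 / (real n ^ d * eigenval n k)) * chr n k x * cnj (chr n k y))"

lemma green_sym: "green d n x y = green d n y x"
  unfolding green_def Re_sum by (intro sum.cong refl) (simp add: mult_ac)

lemma chr_zero: "x \<in> torus d n \<Longrightarrow> chr n (replicate d 0) x = 1"
  by (simp add: chr_def torus_iff uroot_def)

lemma replicate_torus: "n \<ge> 1 \<Longrightarrow> replicate d 0 \<in> torus d n"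
  by (simp add: torus_iff)

text \<open>The eigenvalues cancel. The sum over all frequencies would be minus the point mass at
  \<open>y\<close> (\<open>sum_chr_dual\<close>); the omitted zero frequency accounts for
  \<open>1 / n ^ d\<close>.\<close>

lemma laplacian_green:
  assumes n: "n \<ge> 2" and x: "x \<in> torus d n" and y: "y \<in> torus d n"
  shows "graph_laplacian (torus d n) (torus_adj n) (\<lambda>z. green d n z y) x
       = 1 / real n ^ d - (if x = y then 1 else 0)"
proof -
  let ?A = "torus d n - {replicate d 0}"
  let ?c = "\<lambda>k. of_real (1 / (real n ^ d * eigenval n k)) * cnj (chr n k y)"
  have "graph_laplacian (torus d n) (torus_adj n) (\<lambda>z. green d n z y) x
      = graph_laplacian (torus d n) (torus_adj n) (\<lambda>z. \<Sum>k\<in>?A. Re (?c k * chr n k z)) x"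
    unfolding green_def Re_sum by (simp only: mult_ac)
  also have "\<dots> = (\<Sum>k\<in>?A. - eigenval n k * Re (?c k * chr n k x))"
    unfolding laplacian_sum using assms by (intro sum.cong refl laplacian_Re_chr) auto
  also have "\<dots> = (\<Sum>k\<in>?A. - (1 / real n ^ d) * Re (chr n k x * cnj (chr n k y)))"
  proof (intro sum.cong refl)
    fix k assume "k \<in> ?A"
    then have "eigenval n k > 0" using eigenval_pos[OF n] by auto
    moreover have "?c k * chr n k x = of_real (1 / (real n ^ d * eigenval n k)) * (chr n k x * cnj (chr n k y))"
      by (simp add: mult_ac)
    ultimately show "- eigenval n k * Re (?c k * chr n k x) = - (1 / real n ^ d) * Re (chr n k x * cnj (chr n k y))"
      using n by (simp only: Re_complex_of_real Im_complex_of_real times_complex.simps) (simp add: divide_simps; simp add: algebra_simps)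
  qed
  also have "\<dots> = - (1 / real n ^ d) * Re (\<Sum>k\<in>?A. chr n k x * cnj (chr n k y))"
    by (simp only: Re_sum sum_distrib_left)
  also have "(\<Sum>k\<in>?A. chr n k x * cnj (chr n k y)) = (if x = y then of_nat n ^ d else 0) - 1"
    using n x y by (subst sum_diff1) (auto simp: sum_chr_dual chr_zero replicate_torus)
  also have "- (1 / real n ^ d) * Re ((if x = y then of_nat n ^ d else 0) - 1)
      = 1 / real n ^ d - (if x = y then 1 else 0)"
    using n by (auto simp: field_simps simp flip: of_nat_power)
  finally show ?thesis .
qed

text \<open>Bound |Re z| by |z|, then apply Parseval in the variable \<open>y\<close>.\<close>

lemma sum_square_green_diff_le:
  "(\<Sum>y\<in>torus d n. (green d n x y - green d n x' y)\<^sup>2)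
     \<le> (\<Sum>k\<in>torus d n - {replicate d 0}. (norm (chr n k x - chr n k x'))\<^sup>2 / (eigenval n k)\<^sup>2) / real n ^ d"
proof -
  let ?A = "torus d n - {replicate d 0}"
  define c where "c k = of_real (1 / (real n ^ d * eigenval n k)) * (chr n k x - chr n k x')" for k
  have "green d n x y - green d n x' y = Re (\<Sum>k\<in>?A. c k * cnj (chr n k y))" for y
    by (simp only: green_def c_def minus_complex.simps(1)[symmetric] sum_subtractf[symmetric] algebra_simps)
  then have "(\<Sum>y\<in>torus d n. (green d n x y - green d n x' y)\<^sup>2)
      \<le> (\<Sum>y\<in>torus d n. (norm (\<Sum>k\<in>?A. c k * cnj (chr n k y)))\<^sup>2)"
    by (intro sum_mono) (simp add: cmod_def)
  also have "\<dots> = real n ^ d * (\<Sum>k\<in>?A. (norm (c k))\<^sup>2)"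
    by (rule parseval_chr) auto
  also have "\<dots> = (\<Sum>k\<in>?A. (norm (chr n k x - chr n k x'))\<^sup>2 / (eigenval n k)\<^sup>2) / real n ^ d"
  \<comment> \<open>If \<open>n ^ d = 0\<close>, both sides are 0, the right one by division by
    zero.\<close>
  proof (cases "real n ^ d = 0")
    case False
    have "(norm (c k))\<^sup>2 = (norm (chr n k x - chr n k x'))\<^sup>2 / (eigenval n k)\<^sup>2 / (real n ^ d)\<^sup>2" for k
      unfolding c_def norm_mult norm_of_real power_mult_distrib by (simp add: power_divide power_mult_distrib)
    then have "(\<Sum>k\<in>?A. (norm (c k))\<^sup>2)
        = (\<Sum>k\<in>?A. (norm (chr n k x - chr n k x'))\<^sup>2 / (eigenval n k)\<^sup>2) / (real n ^ d)\<^sup>2"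
      by (simp only: sum_divide_distrib)
    then show ?thesis using False by (simp add: power2_eq_square)
  qed (simp only: mult_zero_left div_by_0)
  finally show ?thesis .
qed

lemma sum_square_green_le:
  "(\<Sum>y\<in>torus d n. (green d n x y)\<^sup>2)
     \<le> (\<Sum>k\<in>torus d n - {replicate d 0}. 1 / (eigenval n k)\<^sup>2) / real n ^ d"
proof -
  let ?A = "torus d n - {replicate d 0}"
  define c where "c k = of_real (1 / (real n ^ d * eigenval n k)) * chr n k x" for k
  have "(\<Sum>y\<in>torus d n. (green d n x y)\<^sup>2) \<le> (\<Sum>y\<in>torus d n. (norm (\<Sum>k\<in>?A. c k * cnj (chr n k y)))\<^sup>2)"
    by (intro sum_mono) (simp add: cmod_def green_def c_def)
  also have "\<dots> = real n ^ d * (\<Sum>k\<in>?A. (norm (c k))\<^sup>2)"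
    by (rule parseval_chr) auto
  also have "\<dots> = (\<Sum>k\<in>?A. 1 / (eigenval n k)\<^sup>2) / real n ^ d"
  proof (cases "real n ^ d = 0")
    case False
    have "(norm (c k))\<^sup>2 = 1 / (eigenval n k)\<^sup>2 / (real n ^ d)\<^sup>2" for k
      unfolding c_def norm_mult norm_of_real power_mult_distrib by (simp add: power_divide power_mult_distrib)
    then have "(\<Sum>k\<in>?A. (norm (c k))\<^sup>2) = (\<Sum>k\<in>?A. 1 / (eigenval n k)\<^sup>2) / (real n ^ d)\<^sup>2"
      by (simp only: sum_divide_distrib)
    then show ?thesis using False by (simp add: power2_eq_square)
  qed (simp only: mult_zero_left div_by_0)
  finally show ?thesis .
qed

section \<open>The odometer\<close>

definition potential :: "nat \<Rightarrow> nat \<Rightarrow> (nat list \<Rightarrow> real) \<Rightarrow> nat list \<Rightarrow> real" where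
  "potential d n \<sigma> x = (\<Sum>y\<in>torus d n. green d n x y * \<sigma> y)"

lemma laplacian_potential:
  assumes "n \<ge> 2" "x \<in> torus d n"
  shows "graph_laplacian (torus d n) (torus_adj n) (potential d n \<sigma>) x
       = (\<Sum>y\<in>torus d n. \<sigma> y) / real n ^ d - \<sigma> x"
proof -
  have "graph_laplacian (torus d n) (torus_adj n) (potential d n \<sigma>) x
      = graph_laplacian (torus d n) (torus_adj n) (\<lambda>x. \<Sum>y\<in>torus d n. \<sigma> y * green d n x y) x"
    unfolding potential_def by (simp only: mult.commute)
  also have "\<dots> = (\<Sum>y\<in>torus d n. \<sigma> y * (1 / real n ^ d - (if x = y then 1 else 0)))"
    unfolding laplacian_sum laplacian_cmult using assms by (intro sum.cong refl) (simp add: laplacian_green)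
  also have "\<dots> = (\<Sum>y\<in>torus d n. \<sigma> y / real n ^ d - (if x = y then \<sigma> y else 0))"
    by (intro sum.cong refl) (simp add: field_simps)
  also have "\<dots> = (\<Sum>y\<in>torus d n. \<sigma> y) / real n ^ d - \<sigma> x"
    using assms by (simp add: sum_subtractf sum_divide_distrib sum.delta)
  finally show ?thesis .
qed

text \<open>Green's identity with the kernel \<open>green d n x\<close>: its pairing with the
  Laplacian of \<open>w\<close> is 0, and moving the Laplacian onto the kernel turns the pairing
  into the average of \<open>w\<close> minus \<open>w x\<close>.\<close>

lemma harmonic_torus_const:
  assumes n: "n \<ge> 2" and h: "\<And>y. y \<in> torus d n \<Longrightarrow> graph_laplacian (torus d n) (torus_adj n) w y = 0"
    and x: "x \<in> torus d n"
  shows "w x = (\<Sum>y\<in>torus d n. w y) / real n ^ d"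
proof -
  have "0 = (\<Sum>y\<in>torus d n. green d n x y * graph_laplacian (torus d n) (torus_adj n) w y)"
    by (simp add: h)
  also have "\<dots> = (\<Sum>y\<in>torus d n. w y * graph_laplacian (torus d n) (torus_adj n) (\<lambda>y. green d n x y) y)"
    by (rule laplacian_selfadjoint) (auto intro: torus_adj_sym)
  also have "\<dots> = (\<Sum>y\<in>torus d n. w y * (1 / real n ^ d - (if y = x then 1 else 0)))"
  proof (intro sum.cong refl)
    fix y assume "y \<in> torus d n"
    then have "graph_laplacian (torus d n) (torus_adj n) (\<lambda>z. green d n z x) y
        = 1 / real n ^ d - (if y = x then 1 else 0)" using laplacian_green[OF n _ x] by simp
    then show "w y * graph_laplacian (torus d n) (torus_adj n) (\<lambda>y. green d n x y) y
        = w y * (1 / real n ^ d - (if y = x then 1 else 0))"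
      by (subst green_sym) simp
  qed
  also have "\<dots> = (\<Sum>y\<in>torus d n. w y / real n ^ d - (if y = x then w y else 0))"
    by (intro sum.cong refl) (simp add: field_simps)
  also have "\<dots> = (\<Sum>y\<in>torus d n. w y) / real n ^ d - w x"
    using x by (simp add: sum_subtractf sum_divide_distrib sum.delta)
  finally show ?thesis by simp
qed

text \<open>An admissible function has Laplacian at most that of the potential, and both Laplacians have
  total sum zero; hence they agree, and the two functions differ by a constant.\<close>

lemma odometer_eq:
  assumes n: "n \<ge> 2" and x: "x \<in> torus d n"
  shows "odometer (torus d n) (torus_adj n) (sandpile d n \<sigma>) x
       = ereal (potential d n \<sigma> x - Min (potential d n \<sigma> ` torus d n))"
proof -
  let ?V = "torus d n" and ?g = "potential d n \<sigma>" and ?L = "graph_laplacian (torus d n) (torus_adj n)"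
  let ?m = "Min (?g ` ?V)"
  have Lg: "sandpile d n \<sigma> y + ?L ?g y = 1" if "y \<in> ?V" for y
    using laplacian_potential[OF n that] by (simp add: sandpile_def)
  have Lgm: "?L (\<lambda>y. ?g y - ?m) y = ?L ?g y" for y
    by (simp add: graph_laplacian_def)
  have min_le: "?m \<le> ?g y" if "y \<in> ?V" for y using that by simp
  have "(\<lambda>y. ?g y - ?m) \<in> admissible ?V (torus_adj n) (sandpile d n \<sigma>)"
    unfolding admissible_def using Lg Lgm min_le by auto
  moreover have "?g x - ?m \<le> f x" if f: "f \<in> admissible ?V (torus_adj n) (sandpile d n \<sigma>)" for f
  proof -
    have le: "?L f y \<le> ?L ?g y" if "y \<in> ?V" for y
      using f that Lg[OF that] by (auto simp: admissible_def)
    have "(\<Sum>y\<in>?V. ?L ?g y - ?L f y) = 0"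
      by (simp add: sum_subtractf sum_laplacian torus_adj_sym)
    then have eq: "?L f y = ?L ?g y" if "y \<in> ?V" for y
      using le that by (subst (asm) sum_nonneg_eq_0_iff) auto
    define w where "w y = f y - ?g y" for y
    have w0: "?L w y = 0" if "y \<in> ?V" for y
      unfolding w_def[abs_def] laplacian_diff using eq[OF that] by simp
    have const: "w y = w x" if "y \<in> ?V" for y
      using harmonic_torus_const[OF n w0 that] harmonic_torus_const[OF n w0 x] by simp
    \<comment> \<open>At a minimiser \<open>z\<close> of the potential, \<open>0 <= f z\<close> says
      that the constant value of \<open>w\<close> is at least \<open>- ?m\<close>.\<close>
    have "?m \<in> ?g ` ?V" using x by (intro Min_in) auto
    then obtain z where z: "z \<in> ?V" "?m = ?g z" by auto
    have "0 \<le> f z" using f z(1) by (auto simp: admissible_def)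
    then show ?thesis using const[OF z(1)] z(2) by (simp add: w_def)
  qed
  ultimately show ?thesis
    unfolding odometer_def by (intro antisym INF_lower2[where i = "\<lambda>y. ?g y - ?m"] INF_greatest) auto
qed

section \<open>Linear functionals of a standard Gaussian vector\<close>

text \<open>Completing the square: the exponential factor shifts the mean to \<open>t * s^2\<close>
  and leaves a constant.\<close>

lemma normal_exp_moment:
  assumes s: "s > 0"
  shows "has_bochner_integral lborel (\<lambda>x. normal_density 0 s x * exp (t * x)) (exp (t\<^sup>2 * s\<^sup>2 / 2))"
proof -
  have eq: "normal_density 0 s x * exp (t * x) = exp (t\<^sup>2 * s\<^sup>2 / 2) * normal_density (t * s\<^sup>2) s x" for x
  proof -
    have "- x\<^sup>2 / (2 * s\<^sup>2) + t * x = t\<^sup>2 * s\<^sup>2 / 2 + - (x - t * s\<^sup>2)\<^sup>2 / (2 * s\<^sup>2)"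
      using s by (simp add: field_simps power2_eq_square)
    then have "exp (- x\<^sup>2 / (2 * s\<^sup>2)) * exp (t * x) = exp (t\<^sup>2 * s\<^sup>2 / 2) * exp (- (x - t * s\<^sup>2)\<^sup>2 / (2 * s\<^sup>2))"
      by (simp only: exp_add[symmetric])
    then show ?thesis by (simp add: normal_density_def)
  qed
  have "has_bochner_integral lborel (normal_density (t * s\<^sup>2) s) 1"
    using s by (simp add: has_bochner_integral_iff)
  then show ?thesis
    unfolding eq using has_bochner_integral_mult_right[of "exp (t\<^sup>2 * s\<^sup>2 / 2)"] by fastforce
qed

locale gaussian_vector =
  fixes V :: "'a set"
  assumes finite_V: "finite V" and V_nonempty: "V \<noteq> {}"
begin

abbreviation M :: "('a \<Rightarrow> real) measure" where
  "M \<equiv> PiM V (\<lambda>_. density lborel (\<lambda>t. ennreal (std_normal_density t)))"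

definition lin :: "('a \<Rightarrow> real) \<Rightarrow> ('a \<Rightarrow> real) \<Rightarrow> real" where
  "lin a \<sigma> = (\<Sum>y\<in>V. a y * \<sigma> y)"

text \<open>The variance of \<open>lin a\<close> under \<open>M\<close>. It may be 0, where there is
  no normal density; hence the case splits on \<open>sq a = 0\<close> below.\<close>

definition sq :: "('a \<Rightarrow> real) \<Rightarrow> real" where
  "sq a = (\<Sum>y\<in>V. (a y)\<^sup>2)"

lemma prob_space_std: "prob_space (density lborel (\<lambda>t. ennreal (std_normal_density t)))"
  using prob_space_normal_density[of 1 0] by simp

sublocale prob_space M
  by (intro prob_space_PiM prob_space_std)

lemma coord_measurable: "y \<in> V \<Longrightarrow> (\<lambda>\<sigma>. \<sigma> y) \<in> borel_measurable M"
proof -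
  assume y: "y \<in> V"
  have "(\<lambda>\<sigma>. \<sigma> y) \<in> measurable M (density lborel (\<lambda>t. ennreal (std_normal_density t)))"
    by (rule measurable_component_singleton[OF y])
  then show ?thesis by simp
qed

lemma lin_measurable [measurable]: "lin a \<in> borel_measurable M"
  unfolding lin_def by (intro borel_measurable_sum borel_measurable_times coord_measurable) auto

lemma coord_distr: "y \<in> V \<Longrightarrow> distr M borel (\<lambda>\<sigma>. \<sigma> y) = density lborel (\<lambda>t. ennreal (std_normal_density t))"
  using distr_PiM_component[OF prob_space_std, where I = V and i = y]
  by (metis (no_types, lifting) distr_cong sets_density sets_lborel)

lemma coord_normal: "y \<in> V \<Longrightarrow> distributed M lborel (\<lambda>\<sigma>. \<sigma> y) std_normal_density"
  unfolding distributed_def using coord_distr[of y] coord_measurable[of y]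
  by (auto cong: distr_cong)

lemma coord_indep: "indep_vars (\<lambda>_. borel) (\<lambda>y \<sigma>. \<sigma> y) V"
proof -
  have "distr M (PiM V (\<lambda>_. borel)) (\<lambda>x. \<lambda>i\<in>V. x i) = distr M M (\<lambda>x. x)"
  proof (rule distr_cong)
    show "sets (PiM V (\<lambda>_. borel)) = sets M" by (intro sets_PiM_cong) auto
    show "(\<lambda>i\<in>V. x i) = x" if "x \<in> space M" for x
      using that by (auto simp: space_PiM PiE_def extensional_restrict)
  qed simp
  also have "\<dots> = M" by (rule distr_id2) simp
  also have "\<dots> = PiM V (\<lambda>i. distr M borel (\<lambda>x. x i))"
    by (intro PiM_cong refl) (simp add: coord_distr)
  finally show ?thesis
    using V_nonempty coord_measurable by (subst indep_vars_iff_distr_eq_PiM') auto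
qed

lemma sq_nonneg: "0 \<le> sq a"
  by (simp add: sq_def sum_nonneg)

lemma lin_eq_0: "sq a = 0 \<Longrightarrow> lin a = (\<lambda>_. 0)"
  using finite_V by (simp add: sq_def lin_def fun_eq_iff sum_nonneg_eq_0_iff)

lemma lin_normal:
  assumes "sq a > 0"
  shows "distributed M lborel (lin a) (normal_density 0 (sqrt (sq a)))"
proof -
  \<comment> \<open>\<open>sum_indep_normal\<close> asks for positive standard deviations, so
    vanishing coefficients are dropped first.\<close>
  define S where "S = {y \<in> V. a y \<noteq> 0}"
  have S: "finite S" "S \<subseteq> V" using finite_V by (auto simp: S_def)
  have sqS: "sq a = (\<Sum>y\<in>S. \<bar>a y\<bar>\<^sup>2)"
    unfolding sq_def S_def using finite_V by (intro sum.mono_neutral_cong_right) auto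
  have linS: "lin a \<sigma> = (\<Sum>y\<in>S. a y * \<sigma> y)" for \<sigma>
    unfolding lin_def S_def using finite_V by (intro sum.mono_neutral_right) auto
  have "S \<noteq> {}" using assms sqS by auto
  moreover have "indep_vars (\<lambda>_. borel) (\<lambda>y \<sigma>. a y * \<sigma> y) S"
    using indep_vars_compose2[OF indep_vars_subset[OF coord_indep S(2)], of "\<lambda>y t. a y * t" "\<lambda>_. borel"] by simp
  moreover have "distributed M lborel (\<lambda>\<sigma>. a y * \<sigma> y) (normal_density 0 \<bar>a y\<bar>)" if "y \<in> S" for y
    using normal_density_affine[OF coord_normal, of y "a y" 0] that S by (auto simp: S_def)
  ultimately have "distributed M lborel (\<lambda>\<sigma>. \<Sum>y\<in>S. a y * \<sigma> y) (normal_density (\<Sum>y\<in>S. 0) (sqrt (\<Sum>y\<in>S. \<bar>a y\<bar>\<^sup>2)))"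
    using S(1) by (intro sum_indep_normal) (auto simp: S_def)
  then show ?thesis unfolding sqS by (simp add: linS[abs_def])
qed

lemma expectation_lin: "integrable M (lin a)" "expectation (lin a) = 0"
proof -
  have "integrable M (lin a) \<and> expectation (lin a) = 0"
  proof (cases "sq a = 0")
    case True
    then show ?thesis by (simp add: lin_eq_0)
  next
    case False
    then have s: "sq a > 0" using sq_nonneg[of a] by simp
    then have s': "sqrt (sq a) > 0" by simp
    show ?thesis
      using distributed_integrable[OF lin_normal[OF s], of "\<lambda>x. x"]
        distributed_integral[OF lin_normal[OF s], of "\<lambda>x. x"]
        normal_moment_nz_1[OF s', of 0] by (simp add: has_bochner_integral_iff)
  qed
  then show "integrable M (lin a)" "expectation (lin a) = 0" by auto
qed

lemma expectation_abs_lin: "expectation (\<lambda>\<sigma>. \<bar>lin a \<sigma>\<bar>) = sqrt (2 / pi) * sqrt (sq a)"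
proof (cases "sq a = 0")
  case True
  then show ?thesis by (simp add: lin_eq_0)
next
  case False
  then have s: "sq a > 0" using sq_nonneg[of a] by simp
  then have s': "sqrt (sq a) > 0" by simp
  show ?thesis
    using distributed_integral[OF lin_normal[OF s], of abs]
      normal_moment_abs_odd[OF s', of 0 0] by (simp add: has_bochner_integral_iff)
qed

lemma expectation_abs_lin_le: "expectation (\<lambda>\<sigma>. \<bar>lin a \<sigma>\<bar>) \<le> sqrt (sq a)"
proof -
  have "sqrt (2 / pi) \<le> 1" using pi_gt3 by simp
  then show ?thesis unfolding expectation_abs_lin
    using sq_nonneg[of a] by (intro mult_left_le_one_le) auto
qed

lemma lin_exp_moment:
  "has_bochner_integral M (\<lambda>\<sigma>. exp (t * lin a \<sigma>)) (exp (t\<^sup>2 * sq a / 2))"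
proof (cases "sq a = 0")
  case True
  then show ?thesis by (simp add: lin_eq_0 has_bochner_integral_iff prob_space)
next
  case False
  then have s: "sq a > 0" using sq_nonneg[of a] by simp
  then have s': "sqrt (sq a) > 0" by simp
  show ?thesis
    using distributed_integrable[OF lin_normal[OF s], of "\<lambda>x. exp (t * x)"]
      distributed_integral[OF lin_normal[OF s], of "\<lambda>x. exp (t * x)"]
      normal_exp_moment[OF s', of t] s by (simp add: has_bochner_integral_iff)
qed

lemma integrable_Max_lin:
  assumes "finite I" "I \<noteq> {}"
  shows "integrable M (\<lambda>\<sigma>. Max ((\<lambda>i. lin (a i) \<sigma>) ` I))"
  using assms by (intro integrable_MAX expectation_lin) auto

text \<open>Instead of Jensen's inequality for the logarithm, its tangent at the expected value is used.\<close>

lemma expectation_Max_lin_le: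
  assumes I: "finite I" "I \<noteq> {}" and N: "real (card I) \<le> N" "N \<ge> 2" and s: "s > 0"
    and sq_le: "\<And>i. i \<in> I \<Longrightarrow> sq (a i) \<le> s\<^sup>2"
  shows "expectation (\<lambda>\<sigma>. Max ((\<lambda>i. lin (a i) \<sigma>) ` I)) \<le> 2 * s * sqrt (ln N)"
proof -
  \<comment> \<open>This \<open>t\<close> makes the two terms of the bound
    \<open>ln N / t + t * s^2 / 2\<close> comparable. The number \<open>c\<close> bounds the mean of
    the exponential sum \<open>S\<close>, and the tangent of the logarithm is taken at
    \<open>c\<close>.\<close>
  define t where "t = sqrt (ln N) / s"
  define c where "c = N * exp (t\<^sup>2 * s\<^sup>2 / 2)"
  have lnN: "ln N > 0" using N by simp
  then have t: "t > 0" using s by (simp add: t_def)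
  have c: "c > 0" using N by (simp add: c_def)
  define S where "S \<sigma> = (\<Sum>i\<in>I. exp (t * lin (a i) \<sigma>))" for \<sigma>
  have S: "has_bochner_integral M S (\<Sum>i\<in>I. exp (t\<^sup>2 * sq (a i) / 2))"
    unfolding S_def by (intro has_bochner_integral_sum lin_exp_moment)
  have "(\<Sum>i\<in>I. exp (t\<^sup>2 * sq (a i) / 2)) \<le> (\<Sum>i\<in>I. exp (t\<^sup>2 * s\<^sup>2 / 2))"
    using sq_le by (intro sum_mono) (auto intro!: mult_left_mono)
  also have "\<dots> \<le> c" using N by (simp add: c_def)
  finally have ES: "expectation S \<le> c" using S by (simp add: has_bochner_integral_iff)
  have pw: "t * Max ((\<lambda>i. lin (a i) \<sigma>) ` I) \<le> S \<sigma> / c + ln c - 1" for \<sigma>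
  proof -
    have "Max ((\<lambda>i. lin (a i) \<sigma>) ` I) \<in> (\<lambda>i. lin (a i) \<sigma>) ` I" using I by (intro Max_in) auto
    then obtain i where i: "i \<in> I" "Max ((\<lambda>i. lin (a i) \<sigma>) ` I) = lin (a i) \<sigma>" by auto
    have "exp (t * lin (a i) \<sigma>) \<le> S \<sigma>"
      unfolding S_def using I i by (intro member_le_sum) auto
    moreover have "t * lin (a i) \<sigma> - ln c + 1 \<le> exp (t * lin (a i) \<sigma> - ln c)"
      using exp_ge_add_one_self[of "t * lin (a i) \<sigma> - ln c"] by linarith
    moreover have "exp (t * lin (a i) \<sigma> - ln c) = exp (t * lin (a i) \<sigma>) / c"
      using c by (simp add: exp_diff)
    ultimately show ?thesis using i(2) divide_right_mono[of "exp (t * lin (a i) \<sigma>)" "S \<sigma>" c] c by simp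
  qed
  have "t * expectation (\<lambda>\<sigma>. Max ((\<lambda>i. lin (a i) \<sigma>) ` I)) = expectation (\<lambda>\<sigma>. t * Max ((\<lambda>i. lin (a i) \<sigma>) ` I))"
    by simp
  also have "\<dots> \<le> expectation (\<lambda>\<sigma>. S \<sigma> / c + (ln c - 1))"
    using pw S integrable_Max_lin[OF I, of a]
    by (intro integral_mono) (auto simp: has_bochner_integral_iff add_diff_eq)
  also have "\<dots> = expectation S / c + (ln c - 1)"
    using S by (subst Bochner_Integration.integral_add) (auto simp: has_bochner_integral_iff prob_space)
  also have "\<dots> \<le> ln c" using ES c by (simp add: divide_le_eq_1)
  also have "\<dots> = ln N + t\<^sup>2 * s\<^sup>2 / 2" using N by (simp add: c_def ln_mult)
  also have "t\<^sup>2 * s\<^sup>2 = ln N" using s lnN by (simp add: t_def power_divide)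
  finally have "t * expectation (\<lambda>\<sigma>. Max ((\<lambda>i. lin (a i) \<sigma>) ` I)) \<le> 2 * ln N" using lnN by simp
  then have "expectation (\<lambda>\<sigma>. Max ((\<lambda>i. lin (a i) \<sigma>) ` I)) \<le> 2 * ln N / t"
    using t by (simp add: field_simps)
  also have "\<dots> = 2 * s * (ln N / sqrt (ln N))" by (simp add: t_def)
  also have "\<dots> = 2 * s * sqrt (ln N)" using lnN by (simp add: real_div_sqrt)
  finally show ?thesis .
qed

text \<open>On \<open>{t..t + 1}\<close> the density is at least its value at the right end. At the
  level \<open>t = sqrt (ln N)\<close> used later this crude bound loses only a factor subpolynomial
  in \<open>N\<close>.\<close>

lemma lin_tail_ge:
  assumes "sq a = 1" "t \<ge> 0"
  shows "std_normal_density (t + 1) \<le> prob {\<sigma> \<in> space M. t \<le> lin a \<sigma>}"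
proof -
  have "ennreal (std_normal_density (t + 1)) = (\<integral>\<^sup>+x. ennreal (std_normal_density (t + 1)) * indicator {t..t + 1} x \<partial>lborel)"
    by (simp add: nn_integral_cmult)
  also have "\<dots> \<le> (\<integral>\<^sup>+x. ennreal (std_normal_density x) * indicator {t..} x \<partial>lborel)"
  proof (intro nn_integral_mono)
    fix x :: real
    have "std_normal_density (t + 1) \<le> std_normal_density x" if "t \<le> x" "x \<le> t + 1"
    proof -
      have "x\<^sup>2 \<le> (t + 1)\<^sup>2" using that assms by (intro power_mono) auto
      then show ?thesis by (simp add: std_normal_density_def divide_right_mono)
    qed
    then show "ennreal (std_normal_density (t + 1)) * indicator {t..t + 1} x \<le> ennreal (std_normal_density x) * indicator {t..} x"
      by (auto simp: indicator_def intro!: ennreal_leI)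
  qed
  also have "\<dots> = emeasure M (lin a -` {t..} \<inter> space M)"
    using lin_normal[of a] assms(1) by (subst distributed_emeasure[of _ lborel]) auto
  also have "lin a -` {t..} \<inter> space M = {\<sigma> \<in> space M. t \<le> lin a \<sigma>}" by auto
  finally show ?thesis by (simp add: emeasure_eq_measure)
qed

text \<open>Disjoint supports make the functionals independent, so the probability that none reaches
  \<open>t\<close> is a product, at most (1 - p)^(card I) <= exp(- p card I) with p the bound of
  \<open>lin_tail_ge\<close>.\<close>

lemma prob_lin_exceeds_ge:
  assumes I: "finite I" "I \<noteq> {}" and unit: "\<And>i. i \<in> I \<Longrightarrow> sq (f i) = 1" and t: "t \<ge> 0"
    and disj: "\<And>i j y. i \<in> I \<Longrightarrow> j \<in> I \<Longrightarrow> i \<noteq> j \<Longrightarrow> y \<in> V \<Longrightarrow> f i y = 0 \<or> f j y = 0"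
  shows "1 - exp (- real (card I) * std_normal_density (t + 1))
    \<le> prob {\<sigma> \<in> space M. \<exists>i\<in>I. t \<le> lin (f i) \<sigma>}"
proof -
  define K where "K i = {y \<in> V. f i y \<noteq> 0}" for i
  \<comment> \<open>Each functional is written through the restriction of the noise to its support,
    the form in which independence over disjoint blocks is available.\<close>
  have linK: "lin (f i) \<sigma> = (\<Sum>y\<in>K i. f i y * restrict (\<lambda>y. \<sigma> y) (K i) y)" for i \<sigma>
  proof -
    have "lin (f i) \<sigma> = (\<Sum>y\<in>K i. f i y * \<sigma> y)"
      unfolding lin_def K_def using finite_V by (intro sum.mono_neutral_right) auto
    then show ?thesis by simp
  qed
  have "indep_vars (\<lambda>j. PiM (K j) (\<lambda>_. borel)) (\<lambda>j \<sigma>. restrict (\<lambda>y. \<sigma> y) (K j)) I"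
  proof (rule indep_vars_restrict[OF coord_indep])
    show "disjoint_family_on K I"
      unfolding disjoint_family_on_def using disj by (fastforce simp: K_def)
  qed (auto simp: K_def)
  then have "indep_vars (\<lambda>_. borel) (\<lambda>i \<sigma>. \<Sum>y\<in>K i. f i y * restrict (\<lambda>y. \<sigma> y) (K i) y) I"
    by (rule indep_vars_compose2[where Y = "\<lambda>i \<sigma>. \<Sum>y\<in>K i. f i y * \<sigma> y"]) measurable
  then have ind: "indep_vars (\<lambda>_. borel) (\<lambda>i. lin (f i)) I"
    by (simp only: linK[abs_def])
  have one: "prob (lin (f i) -` {..<t} \<inter> space M) \<le> exp (- std_normal_density (t + 1))" if "i \<in> I" for i
  proof -
    have "lin (f i) -` {..<t} \<inter> space M = space M - {\<sigma> \<in> space M. t \<le> lin (f i) \<sigma>}" by auto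
    then have "prob (lin (f i) -` {..<t} \<inter> space M) = 1 - prob {\<sigma> \<in> space M. t \<le> lin (f i) \<sigma>}"
      by (simp add: prob_compl)
    also have "\<dots> \<le> 1 - std_normal_density (t + 1)"
      using lin_tail_ge[OF unit[OF that] t] by simp
    also have "\<dots> \<le> exp (- std_normal_density (t + 1))"
      using exp_ge_add_one_self[of "- std_normal_density (t + 1)"] by simp
    finally show ?thesis .
  qed
  have "prob (\<Inter>i\<in>I. lin (f i) -` {..<t} \<inter> space M) = (\<Prod>i\<in>I. prob (lin (f i) -` {..<t} \<inter> space M))"
    using I by (intro indep_varsD_finite[OF ind]) auto
  also have "\<dots> \<le> (\<Prod>i\<in>I. exp (- std_normal_density (t + 1)))"
    using one by (intro prod_mono) auto
  also have "\<dots> = exp (- real (card I) * std_normal_density (t + 1))"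
    by (simp add: exp_of_nat_mult[symmetric])
  finally have le: "prob (\<Inter>i\<in>I. lin (f i) -` {..<t} \<inter> space M) \<le> exp (- real (card I) * std_normal_density (t + 1))" .
  have "{\<sigma> \<in> space M. \<exists>i\<in>I. t \<le> lin (f i) \<sigma>} = space M - (\<Inter>i\<in>I. lin (f i) -` {..<t} \<inter> space M)"
    using I(2) by (auto simp: not_less)
  moreover have "(\<Inter>i\<in>I. lin (f i) -` {..<t} \<inter> space M) \<in> sets M"
    using I by (intro sets.finite_INT measurable_sets[OF lin_measurable]) auto
  ultimately show ?thesis using le by (simp add: prob_compl)
qed

text \<open>The standard normal law is even. Points of \<open>space M\<close> are
  \<open>undefined\<close> outside \<open>V\<close>, so the reflection that maps \<open>M\<close> to
  itself is \<open>compose V uminus\<close>; the hypothesis \<open>ext\<close> identifies it with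
  pointwise negation under \<open>F\<close>.\<close>

lemma expectation_uminus:
  assumes [measurable]: "F \<in> borel_measurable M"
    and ext: "\<And>\<sigma> \<tau>. (\<And>y. y \<in> V \<Longrightarrow> \<sigma> y = \<tau> y) \<Longrightarrow> F \<sigma> = (F \<tau> :: real)"
  shows "expectation (\<lambda>\<sigma>. F (\<lambda>y. - \<sigma> y)) = expectation F"
proof -
  let ?S = "density lborel (\<lambda>t. ennreal (std_normal_density t))"
  interpret S: prob_space ?S by (rule prob_space_std)
  have "distributed ?S lborel (\<lambda>x. x) std_normal_density"
    by (auto simp: distributed_def intro!: distr_id2)
  from S.normal_density_affine[OF this, of "-1" 0]
  have "distributed ?S lborel (\<lambda>x. - x) std_normal_density" by simp
  then have "distr ?S lborel uminus = ?S" by (simp add: distributed_def)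
  moreover have "distr ?S ?S uminus = distr ?S lborel uminus" by (intro distr_cong) auto
  ultimately have "distr ?S ?S uminus = ?S" by simp
  moreover have "distr M M (compose V uminus) = PiM V (\<lambda>_. distr ?S ?S uminus)"
    by (rule distr_PiM_finite_prob_space'[OF finite_V prob_space_std prob_space_std]) auto
  ultimately have *: "distr M M (compose V uminus) = M" by simp
  have meas: "compose V uminus \<in> measurable M M"
    unfolding compose_def
    by (intro measurable_restrict) (auto intro: coord_measurable)
  have "expectation F = integral\<^sup>L (distr M M (compose V uminus)) F" by (simp add: *)
  also have "\<dots> = expectation (\<lambda>\<sigma>. F (compose V uminus \<sigma>))"
    by (rule integral_distr[OF meas]) simp
  also have "\<dots> = expectation (\<lambda>\<sigma>. F (\<lambda>y. - \<sigma> y))"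
    by (intro Bochner_Integration.integral_cong refl ext) (auto simp: compose_def)
  finally show ?thesis ..
qed

end

text \<open>The right side is of order \<open>sqrt N * exp (- sqrt (ln N))\<close> and tends to
  infinity. The threshold \<open>ln 2\<close> makes the failure probability in
  \<open>prob_lin_exceeds_ge\<close> at most 1/2.\<close>

lemma gaussian_exceedance_asymp:
  "\<forall>\<^sub>F N :: nat in at_top. ln 2 \<le> real N * std_normal_density (sqrt (ln (real N)) + 1)"
proof -
  have "filterlim (\<lambda>N::nat. real N * ((1 / sqrt (2 * pi)) * exp (- (sqrt (ln (real N)) + 1)\<^sup>2 / 2))) at_top at_top"
    by real_asymp
  then show ?thesis unfolding std_normal_density_def filterlim_at_top by blast
qed

section \<open>The expected odometer\<close>

lemma gaussian_vector_torus: "n \<ge> 2 \<Longrightarrow> gaussian_vector (torus d n)"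
  by unfold_locales (auto simp: torus_nonempty)

text \<open>No vertex appears: this is the mean of the odometer at every vertex, see
  \<open>expectation_odometer\<close>.\<close>

definition mean_odometer :: "nat \<Rightarrow> nat \<Rightarrow> real" where
  "mean_odometer d n = (\<integral>\<sigma>. Max ((\<lambda>x. - potential d n \<sigma> x) ` torus d n) \<partial>gauss_field d n)"

text \<open>The last part is the symmetry of the noise: reversing its sign exchanges the maximum of
  the potential with the maximum of its negative. It is what makes the mean oscillation twice the
  mean odometer.\<close>

lemma potential_integrals:
  assumes n: "n \<ge> 2"
  shows "integrable (gauss_field d n) (\<lambda>\<sigma>. potential d n \<sigma> x)"
    and "(\<integral>\<sigma>. potential d n \<sigma> x \<partial>gauss_field d n) = 0"
    and "integrable (gauss_field d n) (\<lambda>\<sigma>. Max ((\<lambda>x. - potential d n \<sigma> x) ` torus d n))"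
    and "integrable (gauss_field d n) (\<lambda>\<sigma>. Max (potential d n \<sigma> ` torus d n))"
    and "(\<integral>\<sigma>. Max (potential d n \<sigma> ` torus d n) \<partial>gauss_field d n) = mean_odometer d n"
proof -
  interpret gaussian_vector "torus d n" using n by (rule gaussian_vector_torus)
  have pot: "potential d n \<sigma> x = lin (green d n x) \<sigma>" for \<sigma> x
    by (simp add: potential_def lin_def)
  have npot: "- potential d n \<sigma> x = lin (\<lambda>y. - green d n x y) \<sigma>" for \<sigma> x
    by (simp add: potential_def lin_def sum_negf)
  show 1: "integrable (gauss_field d n) (\<lambda>\<sigma>. potential d n \<sigma> x)" "(\<integral>\<sigma>. potential d n \<sigma> x \<partial>gauss_field d n) = 0"
    unfolding gauss_field_def pot using expectation_lin[of "green d n x"] by auto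
  show 2: "integrable (gauss_field d n) (\<lambda>\<sigma>. Max ((\<lambda>x. - potential d n \<sigma> x) ` torus d n))"
    unfolding gauss_field_def npot using n by (intro integrable_Max_lin) (auto simp: torus_nonempty)
  show "integrable (gauss_field d n) (\<lambda>\<sigma>. Max (potential d n \<sigma> ` torus d n))"
    unfolding gauss_field_def pot using n by (intro integrable_Max_lin) (auto simp: torus_nonempty)
  let ?F = "\<lambda>\<sigma>. Max ((\<lambda>x. - potential d n \<sigma> x) ` torus d n)"
  have neg: "potential d n (\<lambda>y. - \<sigma> y) x = - potential d n \<sigma> x" for \<sigma> x
    by (simp add: potential_def sum_negf)
  have "expectation (\<lambda>\<sigma>. ?F (\<lambda>y. - \<sigma> y)) = expectation ?F"
  proof (rule expectation_uminus)
    show "?F \<in> borel_measurable M" using 2 unfolding gauss_field_def by (rule borel_measurable_integrable)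
    show "?F \<sigma> = ?F \<tau>" if "\<And>y. y \<in> torus d n \<Longrightarrow> \<sigma> y = \<tau> y" for \<sigma> \<tau>
      using that by (simp add: potential_def)
  qed
  then show "(\<integral>\<sigma>. Max (potential d n \<sigma> ` torus d n) \<partial>gauss_field d n) = mean_odometer d n"
    unfolding mean_odometer_def gauss_field_def neg by simp
qed

lemma minus_Min_potential:
  "n \<ge> 2 \<Longrightarrow> - Min (potential d n \<sigma> ` torus d n) = Max ((\<lambda>x. - potential d n \<sigma> x) ` torus d n)"
  by (subst minus_Min_eq_Max) (auto simp: torus_nonempty image_image)

text \<open>The potential at \<open>x\<close> is centred, so only the maximum of the negated
  potential survives, and the dependence on \<open>x\<close> disappears.\<close>

lemma expectation_odometer:
  assumes n: "n \<ge> 2" and x: "x \<in> torus d n"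
  shows "integrable (gauss_field d n) (\<lambda>\<sigma>. real_of_ereal (odometer (torus d n) (torus_adj n) (sandpile d n \<sigma>) x))"
    and "(\<integral>\<sigma>. real_of_ereal (odometer (torus d n) (torus_adj n) (sandpile d n \<sigma>) x) \<partial>gauss_field d n) = mean_odometer d n"
proof -
  have *: "real_of_ereal (odometer (torus d n) (torus_adj n) (sandpile d n \<sigma>) x)
      = potential d n \<sigma> x + Max ((\<lambda>x. - potential d n \<sigma> x) ` torus d n)" for \<sigma>
    using minus_Min_potential[OF n, of d \<sigma>] by (simp add: odometer_eq[OF n x])
  show "integrable (gauss_field d n) (\<lambda>\<sigma>. real_of_ereal (odometer (torus d n) (torus_adj n) (sandpile d n \<sigma>) x))"
    unfolding * using potential_integrals[OF n] by (intro Bochner_Integration.integrable_add)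
  show "(\<integral>\<sigma>. real_of_ereal (odometer (torus d n) (torus_adj n) (sandpile d n \<sigma>) x) \<partial>gauss_field d n) = mean_odometer d n"
    unfolding * mean_odometer_def using potential_integrals[OF n]
    by (subst Bochner_Integration.integral_add) auto
qed

section \<open>Summation over shells\<close>

lemma card_torus_box:
  "card {x \<in> torus d n. \<forall>i<d. P i (x ! i)} = (\<Prod>i<d. card {a. a < n \<and> P i a})"
proof -
  have "card {x \<in> torus d n. \<forall>i<d. P i (x ! i)} = (\<Sum>x\<in>torus d n. of_bool (\<forall>i<d. P i (x ! i)))"
    by (subst sum_of_bool_eq) (auto intro!: arg_cong[of _ _ card])
  also have "\<dots> = (\<Sum>x\<in>torus d n. \<Prod>i<d. of_bool (P i (x ! i)))"
  proof (intro sum.cong refl)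
    fix x
    show "(of_bool (\<forall>i<d. P i (x ! i)) :: nat) = (\<Prod>i<d. of_bool (P i (x ! i)))"
      by (induction d) (auto simp: less_Suc_eq of_bool_def)
  qed
  also have "\<dots> = (\<Prod>i<d. \<Sum>a<n. of_bool (P i a))"
    by (rule sum_torus_prod)
  also have "\<dots> = (\<Prod>i<d. card {a. a < n \<and> P i a})"
    by (intro prod.cong refl, subst sum_of_bool_eq) (auto intro!: arg_cong[of _ _ card])
  finally show ?thesis .
qed

text \<open>A sup norm with one size function per coordinate. It has two instances, the size of a
  frequency (\<open>freq\<close>) and the distance to a fixed centre, which share the shell counting
  below. On the empty list the maximum is unspecified.\<close>

definition radius :: "(nat \<Rightarrow> nat \<Rightarrow> nat) \<Rightarrow> nat list \<Rightarrow> nat" where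
  "radius \<rho> x = Max ((\<lambda>i. \<rho> i (x ! i)) ` {..<length x})"

lemma radius_coord: "i < length x \<Longrightarrow> \<rho> i (x ! i) \<le> radius \<rho> x"
  unfolding radius_def by (intro Max_ge) auto

lemma radius_attained: "x \<noteq> [] \<Longrightarrow> \<exists>i<length x. radius \<rho> x = \<rho> i (x ! i)"
proof -
  assume "x \<noteq> []"
  then have "radius \<rho> x \<in> (\<lambda>i. \<rho> i (x ! i)) ` {..<length x}"
    unfolding radius_def by (intro Max_in) auto
  then show ?thesis by auto
qed

text \<open>Some coordinate has size exactly \<open>k\<close>, with at most 2 values; every other
  one has size at most \<open>k\<close>, with at most \<open>2 * (k + 1) <= 4 * k\<close> values.
  The distinguished coordinate can be chosen in \<open>d\<close> ways.\<close>

lemma card_shell_le: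
  assumes two: "\<And>i k. i < d \<Longrightarrow> card {a. a < n \<and> \<rho> i a = k} \<le> 2" and d: "d \<ge> 1" and k: "k \<ge> 1"
  shows "card {x \<in> torus d n. radius \<rho> x = k} \<le> 2 * d * (4 * k) ^ (d - 1)"
proof -
  define P where "P i j a \<longleftrightarrow> (if j = i then \<rho> j a = k else \<rho> j a \<le> k)" for i j a
  have le: "card {a. a < n \<and> \<rho> i a \<le> k} \<le> 4 * k" if "i < d" for i
  proof -
    have "{a. a < n \<and> \<rho> i a \<le> k} = (\<Union>m\<in>{..k}. {a. a < n \<and> \<rho> i a = m})" by auto
    then have "card {a. a < n \<and> \<rho> i a \<le> k} \<le> (\<Sum>m\<le>k. card {a. a < n \<and> \<rho> i a = m})"
      by (simp add: card_UN_le)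
    also have "\<dots> \<le> (\<Sum>m\<le>k. 2)" using two[OF that] by (intro sum_mono)
    also have "\<dots> \<le> 4 * k" using k by simp
    finally show ?thesis .
  qed
  have one: "card {x \<in> torus d n. \<forall>j<d. P i j (x ! j)} \<le> 2 * (4 * k) ^ (d - 1)" if i: "i < d" for i
  proof -
    have "(\<Prod>j<d. card {a. a < n \<and> P i j a}) = card {a. a < n \<and> P i i a} * (\<Prod>j\<in>{..<d} - {i}. card {a. a < n \<and> P i j a})"
      using i by (intro prod.remove) auto
    also have "\<dots> \<le> 2 * (\<Prod>j\<in>{..<d} - {i}. 4 * k)"
      using two[OF i] le by (intro mult_mono prod_mono) (auto simp: P_def)
    finally show ?thesis using i by (simp add: card_torus_box)
  qed
  have "{x \<in> torus d n. radius \<rho> x = k} \<subseteq> (\<Union>i<d. {x \<in> torus d n. \<forall>j<d. P i j (x ! j)})"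
  proof
    fix x assume x: "x \<in> {x \<in> torus d n. radius \<rho> x = k}"
    then have len: "length x = d" by (simp add: torus_iff)
    moreover have "x \<noteq> []" using len d by auto
    ultimately obtain i where "i < d" "radius \<rho> x = \<rho> i (x ! i)" using radius_attained[of x \<rho>] by auto
    then show "x \<in> (\<Union>i<d. {x \<in> torus d n. \<forall>j<d. P i j (x ! j)})"
      using x len radius_coord[of _ x \<rho>] by (auto simp: P_def intro!: bexI[of _ i])
  qed
  then have "card {x \<in> torus d n. radius \<rho> x = k} \<le> card (\<Union>i<d. {x \<in> torus d n. \<forall>j<d. P i j (x ! j)})"
    by (intro card_mono) auto
  also have "\<dots> \<le> (\<Sum>i<d. card {x \<in> torus d n. \<forall>j<d. P i j (x ! j)})" by (intro card_UN_le) simp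
  also have "\<dots> \<le> (\<Sum>i<d. 2 * (4 * k) ^ (d - 1))" using one by (intro sum_mono) auto
  finally show ?thesis by (simp add: mult_ac)
qed

text \<open>Sorting points by radius turns a lattice sum into a one-dimensional sum with surface
  weight \<open>k ^ (d - 1)\<close>.\<close>

lemma sum_shells_le:
  assumes two: "\<And>i k. i < d \<Longrightarrow> card {a. a < n \<and> \<rho> i a = k} \<le> 2" and d: "d \<ge> 1"
    and bd: "\<And>i a. i < d \<Longrightarrow> a < n \<Longrightarrow> \<rho> i a \<le> n" and F: "\<And>k. F k \<ge> (0::real)"
  shows "(\<Sum>x\<in>{x \<in> torus d n. radius \<rho> x \<ge> 1}. F (radius \<rho> x))
    \<le> 2 * real d * 4 ^ (d - 1) * (\<Sum>k=1..n. real k ^ (d - 1) * F k)"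
proof -
  let ?A = "{x \<in> torus d n. radius \<rho> x \<ge> 1}"
  have img: "radius \<rho> ` ?A \<subseteq> {1..n}"
  proof
    fix k assume "k \<in> radius \<rho> ` ?A"
    then obtain x where x: "x \<in> torus d n" "radius \<rho> x \<ge> 1" "k = radius \<rho> x" by auto
    then have "x \<noteq> []" using d by (auto simp: torus_iff)
    then obtain i where "i < d" "k = \<rho> i (x ! i)" using radius_attained[of x \<rho>] x by (auto simp: torus_iff)
    then show "k \<in> {1..n}" using x bd[of i "x ! i"] by (auto simp: torus_iff)
  qed
  have "(\<Sum>x\<in>?A. F (radius \<rho> x)) = (\<Sum>k=1..n. \<Sum>x\<in>{x \<in> ?A. radius \<rho> x = k}. F (radius \<rho> x))"
    using img by (intro sum.group[symmetric]) auto
  also have "\<dots> \<le> (\<Sum>k=1..n. (2 * real d * 4 ^ (d - 1)) * (real k ^ (d - 1) * F k))"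
  proof (intro sum_mono)
    fix k assume k: "k \<in> {1..n}"
    have "(\<Sum>x\<in>{x \<in> ?A. radius \<rho> x = k}. F (radius \<rho> x)) = (\<Sum>x\<in>{x \<in> ?A. radius \<rho> x = k}. F k)"
      by (intro sum.cong) auto
    also have "\<dots> = real (card {x \<in> ?A. radius \<rho> x = k}) * F k" by simp
    also have A_eq: "{x \<in> ?A. radius \<rho> x = k} = {x \<in> torus d n. radius \<rho> x = k}" using k by auto
    also have "real (card {x \<in> torus d n. radius \<rho> x = k}) * F k \<le> real (2 * d * (4 * k) ^ (d - 1)) * F k"
      using card_shell_le[OF two d, where k = k] k F by (intro mult_right_mono of_nat_mono) auto
    also have "\<dots> = (2 * real d * 4 ^ (d - 1)) * (real k ^ (d - 1) * F k)"
      by (simp add: power_mult_distrib)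
    finally show "(\<Sum>x\<in>{x \<in> ?A. radius \<rho> x = k}. F (radius \<rho> x)) \<le> (2 * real d * 4 ^ (d - 1)) * (real k ^ (d - 1) * F k)"
      by (simp only: A_eq)
  qed
  finally show ?thesis by (simp add: sum_distrib_left)
qed

abbreviation freq :: "nat \<Rightarrow> nat list \<Rightarrow> nat" where
  "freq n \<equiv> radius (\<lambda>_. tnorm n)"

lemma eigenval_ge:
  assumes "n \<ge> 2" "k \<in> torus d n" "d \<ge> 1"
  shows "8 * (real (freq n k) / real n)\<^sup>2 \<le> eigenval n k"
proof -
  have "k \<noteq> []" "length k = d" using assms by (auto simp: torus_iff)
  then obtain i where "i < d" "freq n k = tnorm n (k ! i)" using radius_attained[of k "\<lambda>_. tnorm n"] by auto
  then show ?thesis using eigenval_ge_coord[OF assms(1,2)] by simp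
qed

lemma freq_pos:
  assumes "k \<in> torus d n" "k \<noteq> replicate d 0"
  shows "freq n k \<ge> 1"
proof -
  have "\<exists>i<d. k ! i \<noteq> 0" using assms by (auto simp: torus_iff intro!: nth_equalityI)
  then obtain i where i: "i < d" "k ! i \<noteq> 0" by blast
  then have "tnorm n (k ! i) \<ge> 1" using assms(1) by (auto simp: tnorm_def torus_iff)
  then show ?thesis using radius_coord[of i k "\<lambda>_. tnorm n"] i assms(1) by (simp add: torus_iff)
qed

lemma sum_freq_le:
  assumes d: "d \<ge> 1" and F: "\<And>k. F k \<ge> (0::real)"
  shows "(\<Sum>k\<in>torus d n - {replicate d 0}. F (freq n k))
    \<le> 2 * real d * 4 ^ (d - 1) * (\<Sum>k=1..n. real k ^ (d - 1) * F k)"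
proof -
  have "card {a. a < n \<and> tnorm n a = k} \<le> 2" for k
  proof -
    have "{a. a < n \<and> tnorm n a = k} \<subseteq> {k, n - k}" by (auto simp: tnorm_def min_def)
    then have "card {a. a < n \<and> tnorm n a = k} \<le> card {k, n - k}" by (intro card_mono) auto
    also have "\<dots> \<le> 2" by (simp add: card_insert_if)
    finally show ?thesis .
  qed
  then have "(\<Sum>x\<in>{x \<in> torus d n. freq n x \<ge> 1}. F (freq n x))
    \<le> 2 * real d * 4 ^ (d - 1) * (\<Sum>k=1..n. real k ^ (d - 1) * F k)"
    using F d by (intro sum_shells_le) (auto simp: tnorm_def)
  moreover have "(\<Sum>k\<in>torus d n - {replicate d 0}. F (freq n k)) \<le> (\<Sum>x\<in>{x \<in> torus d n. freq n x \<ge> 1}. F (freq n x))"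
    using F freq_pos by (intro sum_mono2) auto
  ultimately show ?thesis by linarith
qed

lemma inverse_eigenval_sq_le:
  assumes "n \<ge> 2" "d \<ge> 1" "k \<in> torus d n - {replicate d 0}"
  shows "1 / (eigenval n k)\<^sup>2 \<le> real n ^ 4 / real (freq n k) ^ 4"
proof -
  let ?q = "(real (freq n k) / real n)\<^sup>2"
  have q: "?q > 0" using freq_pos[of k d n] assms by auto
  have "8 * ?q \<le> eigenval n k" using eigenval_ge[of n k d] assms by blast
  then have "?q \<le> eigenval n k" using q by linarith
  then have "?q\<^sup>2 \<le> (eigenval n k)\<^sup>2" using q by (intro power_mono) auto
  then have "1 / (eigenval n k)\<^sup>2 \<le> 1 / ?q\<^sup>2" using q less_le_trans[OF zero_less_power[OF q]]
    by (intro divide_left_mono mult_pos_pos) auto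
  also have "\<dots> = real n ^ 4 / real (freq n k) ^ 4" by (simp add: power_divide flip: power_mult)
  finally show ?thesis .
qed

section \<open>Upper bounds\<close>

lemma mean_odometer_le_union:
  assumes n: "n \<ge> 2" and d: "d \<ge> 1" and s: "s > 0"
    and var: "\<And>x. x \<in> torus d n \<Longrightarrow> (\<Sum>y\<in>torus d n. (green d n x y)\<^sup>2) \<le> s\<^sup>2"
  shows "mean_odometer d n \<le> 2 * s * sqrt (real d * ln (real n))"
proof -
  interpret gaussian_vector "torus d n" using n by (rule gaussian_vector_torus)
  have npot: "- potential d n \<sigma> x = lin (\<lambda>y. - green d n x y) \<sigma>" for \<sigma> x
    by (simp add: potential_def lin_def sum_negf)
  have "real n ^ 1 \<le> real n ^ d" using n d by (intro power_increasing) auto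
  then have "real n ^ d \<ge> 2" using n by (simp del: of_nat_le_iff flip: of_nat_power)
  then have "mean_odometer d n \<le> 2 * s * sqrt (ln (real n ^ d))"
    unfolding mean_odometer_def gauss_field_def npot
    using n s var by (intro expectation_Max_lin_le) (auto simp: torus_nonempty card_torus sq_def)
  then show ?thesis using n by (simp add: ln_realpow)
qed

text \<open>Parseval, then the eigenvalue bound, then shells. The remaining sum of
  \<open>k^(d-5)\<close> is logarithmic for \<open>d = 4\<close> and at most \<open>n^(d-4)\<close>
  for \<open>d >= 5\<close>, where it cancels against the prefactor.\<close>

lemma green_variance_le:
  assumes n: "n \<ge> 2" and d: "d \<ge> 1"
  shows "(\<Sum>y\<in>torus d n. (green d n x y)\<^sup>2)
    \<le> 2 * real d * 4 ^ (d - 1) * (real n ^ 4 / real n ^ d * (\<Sum>k=1..n. real k ^ (d - 1) / real k ^ 4))"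
proof -
  have "(\<Sum>k\<in>torus d n - {replicate d 0}. 1 / (eigenval n k)\<^sup>2)
      \<le> (\<Sum>k\<in>torus d n - {replicate d 0}. real n ^ 4 / real (freq n k) ^ 4)"
    using inverse_eigenval_sq_le[OF n d] by (intro sum_mono)
  also have "\<dots> \<le> 2 * real d * 4 ^ (d - 1) * (\<Sum>k=1..n. real k ^ (d - 1) * (real n ^ 4 / real k ^ 4))"
    by (rule sum_freq_le[OF d]) simp
  also have "\<dots> = 2 * real d * 4 ^ (d - 1) * (real n ^ 4 * (\<Sum>k=1..n. real k ^ (d - 1) / real k ^ 4))"
    by (simp add: sum_distrib_left mult_ac)
  finally have "(\<Sum>k\<in>torus d n - {replicate d 0}. 1 / (eigenval n k)\<^sup>2) / real n ^ d
      \<le> 2 * real d * 4 ^ (d - 1) * (real n ^ 4 * (\<Sum>k=1..n. real k ^ (d - 1) / real k ^ 4)) / real n ^ d"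
    by (rule divide_right_mono) simp
  then show ?thesis using sum_square_green_le[of d n x] by simp
qed

lemma harmonic_sum_le:
  assumes "n \<ge> 1"
  shows "(\<Sum>k=1..n. 1 / real k) \<le> 1 + ln (real n)"
  using assms
proof (induction n rule: dec_induct)
  case (step n)
  have "ln (real n / real (Suc n)) \<le> real n / real (Suc n) - 1"
    using step by (intro ln_le_minus_one) auto
  also have "\<dots> = - (1 / real (Suc n))" by (simp add: field_simps)
  finally have "1 / real (Suc n) \<le> ln (real (Suc n)) - ln (real n)"
    using step by (simp add: ln_div)
  then show ?case using step by (simp add: sum.atLeast_Suc_atMost)
qed simp

lemma upper_bound_ge5:
  assumes d: "d \<ge> 5"
  shows "\<exists>C>0. \<forall>n\<ge>2. mean_odometer d n \<le> C * sqrt (ln (real n))"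
proof -
  define s where "s = sqrt (2 * real d * 4 ^ (d - 1))"
  have s: "s > 0" and s2: "s\<^sup>2 = 2 * real d * 4 ^ (d - 1)" using d by (auto simp: s_def)
  have "mean_odometer d n \<le> 2 * s * sqrt (real d) * sqrt (ln (real n))" if n: "n \<ge> 2" for n
  proof -
    have "real k ^ (d - 1) / real k ^ 4 \<le> real n ^ (d - 5)" if "k \<in> {1..n}" for k
    proof -
      have "real k ^ (d - 1) / real k ^ 4 = real k ^ (d - 1 - 4)"
        using d that by (subst power_diff) auto
      also have "\<dots> \<le> real n ^ (d - 1 - 4)" using that by (intro power_mono) auto
      finally show ?thesis by simp
    qed
    then have "(\<Sum>k=1..n. real k ^ (d - 1) / real k ^ 4) \<le> (\<Sum>k=1..n. real n ^ (d - 5))"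
      by (intro sum_mono)
    also have "\<dots> = real n ^ Suc (d - 5)" by simp
    finally have "real n ^ 4 / real n ^ d * (\<Sum>k=1..n. real k ^ (d - 1) / real k ^ 4) \<le> real n ^ 4 / real n ^ d * real n ^ Suc (d - 5)"
      by (rule mult_left_mono) simp
    also have "\<dots> = 1"
    proof -
      have "4 + Suc (d - 5) = d" using d by simp
      then have "real n ^ 4 * real n ^ Suc (d - 5) = real n ^ d" by (simp only: power_add[symmetric])
      then show ?thesis using n by (simp del: power_Suc)
    qed
    finally have "2 * real d * 4 ^ (d - 1) * (real n ^ 4 / real n ^ d * (\<Sum>k=1..n. real k ^ (d - 1) / real k ^ 4)) \<le> s\<^sup>2"
      unfolding s2 by (intro mult_left_le) auto
    then have "mean_odometer d n \<le> 2 * s * sqrt (real d * ln (real n))"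
      using n d s order_trans[OF green_variance_le] by (intro mean_odometer_le_union) auto
    then show ?thesis by (simp add: real_sqrt_mult mult_ac)
  qed
  then show ?thesis using s d by (intro exI[of _ "2 * s * sqrt (real d)"]) auto
qed

lemma upper_bound_4: "\<exists>C>0. \<forall>n\<ge>2. mean_odometer 4 n \<le> C * ln (real n)"
proof -
  have "mean_odometer 4 n \<le> 160 * ln (real n)" if n: "n \<ge> 2" for n
  proof -
    have "ln 2 \<le> ln (real n)" using n by simp
    then have ln2: "ln (real n) \<ge> 1/2" using ln2_ge_two_thirds by linarith
    \<comment> \<open>1536 = 3 * 512: the shell constant is \<open>2 * 4 * 4 ^ 3 = 512\<close>, and
      \<open>1 + ln n <= 3 * ln n\<close> because \<open>ln n >= 1/2\<close>. This gives one factor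
      \<open>sqrt (ln n)\<close>; the number of vertices gives the other.\<close>
    define s where "s = sqrt (1536 * ln (real n))"
    have s: "s > 0" and s2: "s\<^sup>2 = 1536 * ln (real n)" using ln2 by (auto simp: s_def)
    have "(\<Sum>k=1..n. real k ^ (4 - 1) / real k ^ 4) = (\<Sum>k=1..n. 1 / real k)"
      by (intro sum.cong refl) (auto simp: power_numeral_reduce divide_simps)
    also have "\<dots> \<le> 3 * ln (real n)" using harmonic_sum_le[of n] n ln2 by simp
    finally have "2 * real 4 * 4 ^ (4 - 1) * (real n ^ 4 / real n ^ 4 * (\<Sum>k=1..n. real k ^ (4 - 1) / real k ^ 4)) \<le> s\<^sup>2"
      using n unfolding s2 by simp
    then have "mean_odometer 4 n \<le> 2 * s * sqrt (real 4 * ln (real n))"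
      using n s order_trans[OF green_variance_le] by (intro mean_odometer_le_union) auto
    also have "\<dots> = 2 * sqrt 1536 * sqrt 4 * ln (real n)"
      using ln2 by (simp add: s_def real_sqrt_mult)
    also have "\<dots> \<le> 2 * 40 * 2 * ln (real n)"
      using ln2 by (intro mult_right_mono mult_mono) (auto intro: real_le_lsqrt)
    finally show ?thesis by simp
  qed
  then show ?thesis by (intro exI[of _ 160]) auto
qed

section \<open>Hoelder increments of the Green function\<close>

lemma norm_uroot_minus_1_le:
  assumes "k < n"
  shows "norm (uroot n k - 1) \<le> 2 * pi * real (tnorm n k) / real n"
proof -
  let ?t = "2 * pi * real (tnorm n k) / real n"
  have four_half_sq: "4 * (t / 2)\<^sup>2 = t\<^sup>2" for t :: real by (simp add: power_divide)
  have "(norm (uroot n k - 1))\<^sup>2 = 2 - 2 * cos (2 * pi * real k / real n)"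
    unfolding uroot_def cmod_power2 by (simp add: power2_diff algebra_simps)
  also have "\<dots> = 2 - 2 * cos ?t" by (simp only: cos_tnorm[OF assms])
  also have "\<dots> = 2 - 2 * cos (2 * (?t / 2))" by (simp add: mult.assoc)
  also have "\<dots> = 4 * (sin (?t / 2))\<^sup>2" by (subst cos_double_sin) simp
  also have "\<dots> \<le> 4 * (?t / 2)\<^sup>2"
    using abs_sin_x_le_abs_x[of "?t / 2"] by (simp only: abs_le_square_iff)
  also have "\<dots> = ?t\<^sup>2" using four_half_sq[of ?t] .
  finally show ?thesis by (rule power2_le_imp_le) simp
qed

lemma norm_uroot_power_diff_le:
  assumes "k < n"
  shows "norm (uroot n k ^ a - uroot n k ^ b) \<le> 2 * pi * real (tnorm n k) / real n * \<bar>real a - real b\<bar>"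
proof -
  have *: "norm (uroot n k ^ a - uroot n k ^ b) \<le> 2 * pi * real (tnorm n k) / real n * \<bar>real a - real b\<bar>"
    if "b \<le> a" for a b
  proof -
    have "uroot n k ^ a - uroot n k ^ b = uroot n k ^ b * (uroot n k ^ (a - b) - 1 ^ (a - b))"
      using that by (simp add: algebra_simps flip: power_add)
    then have "norm (uroot n k ^ a - uroot n k ^ b) = norm (uroot n k ^ (a - b) - 1 ^ (a - b))"
      by (simp only: norm_mult norm_power norm_uroot) simp
    also have "\<dots> \<le> real (a - b) * norm (uroot n k - 1)" by (rule norm_power_diff) auto
    also have "\<dots> \<le> real (a - b) * (2 * pi * real (tnorm n k) / real n)"
      using norm_uroot_minus_1_le[OF assms] by (intro mult_left_mono) auto
    finally show ?thesis using that by (simp add: of_nat_diff mult.commute)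
  qed
  show ?thesis
    using *[of b a] *[of a b] by (cases "b \<le> a") (auto simp: norm_minus_commute abs_minus_commute)
qed

text \<open>A difference of products of unit complex numbers is at most the sum of the differences
  of the factors, and each factor is Lipschitz with constant proportional to the frequency.\<close>

lemma norm_chr_diff_le:
  assumes "x \<in> torus d n" "x' \<in> torus d n" "k \<in> torus d n"
    and close: "\<And>i. i < d \<Longrightarrow> \<bar>real (x ! i) - real (x' ! i)\<bar> \<le> \<delta>"
  shows "norm (chr n k x - chr n k x') \<le> 2 * pi * real d * (real (freq n k) * (\<delta> / real n))"
proof -
  have len: "length x = d" "length x' = d" "length k = d" using assms by (auto simp: torus_iff)
  have "norm (chr n k x - chr n k x') \<le> (\<Sum>i<d. norm (uroot n (k ! i) ^ (x ! i) - uroot n (k ! i) ^ (x' ! i)))"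
    unfolding chr_def len by (rule norm_prod_diff) (auto simp: norm_power)
  also have "\<dots> \<le> (\<Sum>i<d. 2 * pi * real (freq n k) / real n * \<delta>)"
  proof (intro sum_mono)
    fix i assume "i \<in> {..<d}"
    then have i: "i < d" by simp
    then have ki: "k ! i < n" using assms(3) by (simp add: torus_iff)
    have "tnorm n (k ! i) \<le> freq n k" using radius_coord[of i k "\<lambda>_. tnorm n"] i len by simp
    then have "2 * pi * real (tnorm n (k ! i)) / real n * \<bar>real (x ! i) - real (x' ! i)\<bar>
        \<le> 2 * pi * real (freq n k) / real n * \<delta>"
      using close[OF i] by (intro mult_mono divide_right_mono) auto
    then show "norm (uroot n (k ! i) ^ (x ! i) - uroot n (k ! i) ^ (x' ! i)) \<le> 2 * pi * real (freq n k) / real n * \<delta>"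
      using norm_uroot_power_diff_le[OF ki, of "x ! i" "x' ! i"] by linarith
  qed
  also have "\<dots> = 2 * pi * real d * (real (freq n k) * (\<delta> / real n))" by simp
  finally show ?thesis .
qed

text \<open>Used for the distance \<open>z\<close> of two character values, which is at most 2 and
  Lipschitz in the displacement. Keeping only \<open>sqrt z\<close> costs half a power of the
  frequency instead of two, so that the frequency sum still converges in dimension 3.\<close>

lemma square_le_sqrt:
  assumes "0 \<le> z" "z \<le> (2::real)"
  shows "z\<^sup>2 \<le> 4 * sqrt z"
proof -
  have "z = sqrt z * sqrt z" using assms by simp
  moreover have "sqrt z \<le> 2" using assms by (intro real_le_lsqrt) auto
  ultimately have "z \<le> 2 * sqrt z" using assms by (metis mult_right_mono real_sqrt_ge_zero)
  moreover have "z * z \<le> 2 * z" using assms by (intro mult_right_mono) auto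
  ultimately show ?thesis by (simp add: power2_eq_square)
qed

lemma sum_powr_three_halves_le: "(\<Sum>k=1..n. real k powr (- 3/2)) \<le> (\<Sum>k. real k powr (- 3/2))"
  by (intro sum_le_suminf) (auto simp: summable_real_powr_iff)

text \<open>Frequency \<open>k\<close> contributes at most a constant times
  \<open>sqrt (k * \<delta> / n)\<close> over the squared eigenvalue, and
  \<open>k^(d-1) * sqrt k / k^4 <= k^(-3/2)\<close> is summable for \<open>d <= 3\<close>. The
  standard deviation of an increment thus has Hoelder exponent 1/4.\<close>

lemma green_increment_le:
  assumes d: "1 \<le> d" "d \<le> 3"
  shows "\<exists>C>0. \<forall>n\<ge>2. \<forall>x\<in>torus d n. \<forall>x'\<in>torus d n. \<forall>\<delta>\<ge>0.
    (\<forall>i<d. \<bar>real (x ! i) - real (x' ! i)\<bar> \<le> \<delta>) \<longrightarrow>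
      (\<Sum>y\<in>torus d n. (green d n x y - green d n x' y)\<^sup>2) \<le> C * (real n ^ 4 / real n ^ d) * sqrt (\<delta> / real n)"
proof -
  define S where "S = (\<Sum>k. real k powr (- 3/2))"
  have S: "S > 0"
  proof -
    have "real 1 powr (- 3/2) \<le> S" using sum_powr_three_halves_le[of 1] by (simp add: S_def)
    then show ?thesis by simp
  qed
  define c where "c = sqrt (2 * pi * real d)"
  have c: "c > 0" using d by (simp add: c_def)
  define B where "B = 2 * real d * 4 ^ (d - 1)"
  have B: "B > 0" using d by (simp add: B_def)
  show ?thesis
  proof (intro exI[of _ "4 * c * B * S"] conjI allI impI ballI)
    show "4 * c * B * S > 0" using S c B by simp
  next
    fix n x x' and \<delta> :: real
    assume n: "n \<ge> 2" and x: "x \<in> torus d n" and x': "x' \<in> torus d n" and \<delta>: "\<delta> \<ge> 0"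
      and "\<forall>i<d. \<bar>real (x ! i) - real (x' ! i)\<bar> \<le> \<delta>"
    then have close: "\<And>i. i < d \<Longrightarrow> \<bar>real (x ! i) - real (x' ! i)\<bar> \<le> \<delta>" by blast
    let ?A = "torus d n - {replicate d 0}" and ?q = "sqrt (\<delta> / real n)"
    have mode_le: "(norm (chr n k x - chr n k x'))\<^sup>2 / (eigenval n k)\<^sup>2
        \<le> 4 * c * ?q * real n ^ 4 * (sqrt (real (freq n k)) / real (freq n k) ^ 4)" if k: "k \<in> ?A" for k
    proof -
      let ?z = "norm (chr n k x - chr n k x')"
      have "?z \<le> norm (chr n k x) + norm (chr n k x')" by (rule norm_triangle_ineq4)
      then have "?z \<le> 2" by simp
      then have "?z\<^sup>2 \<le> 4 * sqrt ?z" by (intro square_le_sqrt) auto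
      also have "sqrt ?z \<le> sqrt (2 * pi * real d * (real (freq n k) * (\<delta> / real n)))"
        using norm_chr_diff_le[OF x x' _ close] k by simp
      also have "\<dots> = c * (sqrt (real (freq n k)) * ?q)" by (simp only: c_def real_sqrt_mult)
      finally have z: "?z\<^sup>2 \<le> 4 * (c * (sqrt (real (freq n k)) * ?q))" by simp
      have "?z\<^sup>2 / (eigenval n k)\<^sup>2 = ?z\<^sup>2 * (1 / (eigenval n k)\<^sup>2)" by simp
      also have "\<dots> \<le> 4 * (c * (sqrt (real (freq n k)) * ?q)) * (real n ^ 4 / real (freq n k) ^ 4)"
        using z inverse_eigenval_sq_le[OF n d(1) k] c by (intro mult_mono) (auto simp: \<delta>)
      finally show ?thesis by (simp add: mult_ac)
    qed
    have "(\<Sum>k\<in>?A. (norm (chr n k x - chr n k x'))\<^sup>2 / (eigenval n k)\<^sup>2)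
        \<le> (\<Sum>k\<in>?A. 4 * c * ?q * real n ^ 4 * (sqrt (real (freq n k)) / real (freq n k) ^ 4))"
      using mode_le by (intro sum_mono)
    also have "\<dots> \<le> B * (\<Sum>k=1..n. real k ^ (d - 1) * (4 * c * ?q * real n ^ 4 * (sqrt (real k) / real k ^ 4)))"
      unfolding B_def using c \<delta> by (intro sum_freq_le[OF d(1)]) auto
    also have "\<dots> = 4 * c * ?q * real n ^ 4 * B * (\<Sum>k=1..n. real k ^ (d - 1) * (sqrt (real k) / real k ^ 4))"
      by (simp add: sum_distrib_left mult_ac)
    also have "\<dots> \<le> 4 * c * ?q * real n ^ 4 * B * S"
    proof (rule mult_left_mono)
      have "real k ^ (d - 1) * (sqrt (real k) / real k ^ 4) \<le> real k powr (- 3/2)" if "k \<in> {1..n}" for k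
      proof -
        have k: "real k \<ge> 1" using that by simp
        have "real k ^ (d - 1) \<le> real k ^ 2" using d k by (intro power_increasing) auto
        then have "real k ^ (d - 1) * (sqrt (real k) / real k ^ 4) \<le> real k ^ 2 * (sqrt (real k) / real k ^ 4)"
          by (rule mult_right_mono) simp
        also have "\<dots> = real k powr 2 * (real k powr (1/2) / real k powr 4)"
          using k by (simp add: powr_half_sqrt powr_numeral)
        also have "\<dots> = real k powr (2 + (1/2 - 4))" using k by (simp only: powr_add powr_diff)
        finally show ?thesis by simp
      qed
      then have "(\<Sum>k=1..n. real k ^ (d - 1) * (sqrt (real k) / real k ^ 4)) \<le> (\<Sum>k=1..n. real k powr (- 3/2))"
        by (intro sum_mono)
      then show "(\<Sum>k=1..n. real k ^ (d - 1) * (sqrt (real k) / real k ^ 4)) \<le> S"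
        unfolding S_def using sum_powr_three_halves_le[of n] by linarith
    qed (use c B \<delta> in auto)
    finally have "(\<Sum>k\<in>?A. (norm (chr n k x - chr n k x'))\<^sup>2 / (eigenval n k)\<^sup>2) / real n ^ d
        \<le> 4 * c * ?q * real n ^ 4 * B * S / real n ^ d"
      by (rule divide_right_mono) simp
    then show "(\<Sum>y\<in>torus d n. (green d n x y - green d n x' y)\<^sup>2) \<le> 4 * c * B * S * (real n ^ 4 / real n ^ d) * ?q"
      using sum_square_green_diff_le[of d n x x'] by (simp add: mult_ac)
  qed
qed

section \<open>Dyadic nets and chaining\<close>

definition round_down :: "nat \<Rightarrow> nat list \<Rightarrow> nat list" where
  "round_down k x = map (\<lambda>a. 2 ^ k * (a div 2 ^ k)) x"

lemma round_down_torus: "x \<in> torus d n \<Longrightarrow> round_down k x \<in> torus d n"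
  unfolding torus_iff round_down_def
  by (simp del: times_div_less_eq_dividend)
     (meson le_less_trans times_div_less_eq_dividend)

lemma div_power2_Suc: "(a::nat) div 2 ^ Suc k = a div 2 ^ k div 2"
  by (simp only: power_Suc2 div_mult2_eq)

text \<open>The nets are nested, so the link from level \<open>k\<close> to level
  \<open>k + 1\<close> depends only on the point of level \<open>k\<close>: there are no more links
  than points of that net.\<close>

lemma round_down_Suc: "round_down (Suc k) (round_down k x) = round_down (Suc k) x"
proof -
  have "2 ^ k * (a div 2 ^ k) div 2 ^ Suc k = a div 2 ^ Suc k" for a :: nat
    unfolding div_power2_Suc by (subst nonzero_mult_div_cancel_left) auto
  then show ?thesis by (simp only: round_down_def map_map o_def)
qed

lemma round_down_close:
  assumes "i < length x"
  shows "\<bar>real (round_down (Suc k) x ! i) - real (round_down k x ! i)\<bar> \<le> 2 ^ k"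
proof -
  define b where "b = x ! i div 2 ^ k"
  have "x ! i div 2 ^ Suc k = b div 2" by (simp only: b_def div_power2_Suc)
  then have "round_down (Suc k) x ! i = 2 ^ k * (2 * (b div 2))"
    using assms by (simp add: round_down_def)
  moreover have "real (2 * (b div 2)) = real b - real (b mod 2)"
    by (simp add: minus_mod_eq_mult_div flip: of_nat_diff)
  ultimately have "real (round_down (Suc k) x ! i) = 2 ^ k * (real b - real (b mod 2))"
    by (metis of_nat_mult of_nat_numeral of_nat_power)
  moreover have "real (round_down k x ! i) = 2 ^ k * real b"
    using assms by (simp add: round_down_def b_def)
  ultimately have "real (round_down (Suc k) x ! i) - real (round_down k x ! i) = - (2 ^ k * real (b mod 2))"
    by (simp add: algebra_simps)
  moreover have "real (b mod 2) \<le> 1" by simp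
  ultimately show ?thesis by (simp add: mult_left_le)
qed

lemma card_round_down:
  assumes "2 ^ k \<le> n"
  shows "real (card (round_down k ` torus d n)) \<le> (2 * (real n / 2 ^ k)) ^ d"
proof -
  define m where "m = (n - 1) div 2 ^ k + 1"
  have n: "n \<ge> 1" using assms by (metis le_trans one_le_numeral one_le_power)
  have "round_down k ` torus d n \<subseteq> map (\<lambda>b. 2 ^ k * b) ` torus d m"
  proof
    fix y assume "y \<in> round_down k ` torus d n"
    then obtain x where x: "x \<in> torus d n" "y = round_down k x" by auto
    have "map (\<lambda>a. a div 2 ^ k) x \<in> torus d m"
      using x(1) n by (auto simp: torus_iff m_def less_Suc_eq_le intro!: div_le_mono)
    moreover have "y = map (\<lambda>b. 2 ^ k * b) (map (\<lambda>a. a div 2 ^ k) x)"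
      by (simp add: x(2) round_down_def)
    ultimately show "y \<in> map (\<lambda>b. 2 ^ k * b) ` torus d m" by blast
  qed
  then have "card (round_down k ` torus d n) \<le> card (map (\<lambda>b. 2 ^ k * b) ` torus d m)"
    by (intro card_mono) auto
  also have "\<dots> \<le> m ^ d" using card_image_le[of "torus d m"] by (simp add: card_torus)
  finally have "real (card (round_down k ` torus d n)) \<le> real m ^ d" by (simp flip: of_nat_power)
  moreover have "real m \<le> 2 * (real n / 2 ^ k)"
  proof -
    have "real (2 ^ k * ((n - 1) div 2 ^ k)) \<le> real (n - 1)"
      by (intro of_nat_mono times_div_less_eq_dividend)
    then have "real ((n - 1) div 2 ^ k) \<le> real (n - 1) / real (2 ^ k)" by (simp add: field_simps)
    also have "\<dots> \<le> real n / 2 ^ k" by (simp add: divide_right_mono)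
    finally have "real m \<le> real n / 2 ^ k + 1" by (simp add: m_def)
    moreover have "2 ^ k \<le> real n" using assms by (metis of_nat_le_iff of_nat_numeral of_nat_power)
    then have "1 \<le> real n / 2 ^ k" by (simp add: field_simps)
    ultimately show ?thesis by linarith
  qed
  ultimately show ?thesis by (meson order_trans power_mono of_nat_0_le_iff)
qed

text \<open>Chaining along the dyadic nets \<open>round_down k ` torus d n\<close>.\<close>

lemma upper_bound_le3:
  assumes d: "1 \<le> d" "d \<le> 3"
  shows "\<exists>C>0. \<forall>n\<ge>2. mean_odometer d n \<le> C * sqrt (real n ^ 4 / real n ^ d)"
proof -
  obtain C where C: "C > 0" and inc: "\<forall>n\<ge>2. \<forall>x\<in>torus d n. \<forall>x'\<in>torus d n. \<forall>\<delta>\<ge>0.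
    (\<forall>i<d. \<bar>real (x ! i) - real (x' ! i)\<bar> \<le> \<delta>) \<longrightarrow>
      (\<Sum>y\<in>torus d n. (green d n x y - green d n x' y)\<^sup>2) \<le> C * (real n ^ 4 / real n ^ d) * sqrt (\<delta> / real n)"
    using green_increment_le[OF d] by (elim exE conjE) (rule that)
  \<comment> \<open>With \<open>r = n / 2^k\<close>, level \<open>k\<close> costs
    \<open>r powr (-1/4)\<close> for the increments times \<open>r powr (1/8)\<close> for the
    logarithm of the net size. The resulting exponent -1/8 makes the levels a geometric series of
    ratio \<open>w\<close>.\<close>
  define w :: real where "w = 2 powr (1/8)"
  have w: "w > 1" by (simp add: w_def)
  have "mean_odometer d n \<le> 10 * sqrt C * (w / (w - 1)) * sqrt (real n ^ 4 / real n ^ d)" if n: "n \<ge> 2" for n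
  proof -
    interpret gaussian_vector "torus d n" using n by (rule gaussian_vector_torus)
    let ?D = "sqrt (real n ^ 4 / real n ^ d)"
    have D: "?D > 0" using n by simp
    \<comment> \<open>The first level at which all points are rounded to the origin; by minimality
      \<open>2^k < n\<close> at every earlier level.\<close>
    define K where "K = (LEAST K. n \<le> 2 ^ K)"
    have K: "n \<le> 2 ^ K" unfolding K_def by (rule LeastI[of _ n]) simp
    have lt: "2 ^ k < n" if "k < K" for k
      using not_less_Least[of k "\<lambda>K. n \<le> 2 ^ K"] that by (simp add: K_def)
    have "K \<noteq> 0" using K n by (intro notI) simp
    define b where "b k y z = green d n (round_down (Suc k) y) z - green d n y z" for k y z
    define Mx where "Mx k \<sigma> = Max ((\<lambda>y. lin (b k y) \<sigma>) ` round_down k ` torus d n)" for k \<sigma>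
    have ne: "round_down k ` torus d n \<noteq> {}" for k using n by (simp add: torus_nonempty)
    \<comment> \<open>Telescoping from \<open>x\<close>, its own approximation at level 0, to the
      origin at level \<open>K\<close>.\<close>
    have pw: "- potential d n \<sigma> x \<le> - potential d n \<sigma> (replicate d 0) + (\<Sum>k<K. Mx k \<sigma>)" if x: "x \<in> torus d n" for \<sigma> x
    proof -
      let ?g = "\<lambda>k. potential d n \<sigma> (round_down k x)"
      have "?g 0 = potential d n \<sigma> x" by (simp add: round_down_def)
      moreover have "round_down K x = replicate d 0"
        using x K by (auto simp: torus_iff round_down_def list_eq_iff_nth_eq)
      moreover have "(\<Sum>k<K. ?g (Suc k) - ?g k) = ?g K - ?g 0" by (rule sum_lessThan_telescope)
      moreover have "(\<Sum>k<K. ?g (Suc k) - ?g k) \<le> (\<Sum>k<K. Mx k \<sigma>)"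
      proof (rule sum_mono)
        fix k
        have "?g (Suc k) - ?g k = lin (b k (round_down k x)) \<sigma>"
          by (simp add: potential_def lin_def b_def round_down_Suc sum_subtractf left_diff_distrib)
        also have "\<dots> \<le> Mx k \<sigma>" unfolding Mx_def using x by (intro Max_ge) auto
        finally show "?g (Suc k) - ?g k \<le> Mx k \<sigma>" .
      qed
      ultimately show ?thesis by simp
    qed
    have int: "integrable M (Mx k)" for k
      unfolding Mx_def using ne by (intro integrable_Max_lin) auto
    have "mean_odometer d n \<le> expectation (\<lambda>\<sigma>. - potential d n \<sigma> (replicate d 0) + (\<Sum>k<K. Mx k \<sigma>))"
      unfolding mean_odometer_def gauss_field_def[symmetric]
    proof (rule integral_mono)
      show "integrable (gauss_field d n) (\<lambda>\<sigma>. - potential d n \<sigma> (replicate d 0) + (\<Sum>k<K. Mx k \<sigma>))"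
        using int potential_integrals(1)[OF n] unfolding gauss_field_def
        by (intro Bochner_Integration.integrable_add integrable_minus Bochner_Integration.integrable_sum) auto
      show "Max ((\<lambda>x. - potential d n \<sigma> x) ` torus d n) \<le> - potential d n \<sigma> (replicate d 0) + (\<Sum>k<K. Mx k \<sigma>)" for \<sigma>
        using pw n by (subst Max_le_iff) (auto simp: torus_nonempty)
    qed (rule potential_integrals(3)[OF n])
    also have "\<dots> = (\<Sum>k<K. expectation (Mx k))"
      using int potential_integrals(1,2)[OF n, of d "replicate d 0"] unfolding gauss_field_def
      by (subst Bochner_Integration.integral_add) (auto simp: Bochner_Integration.integral_sum)
    also have "\<dots> \<le> (\<Sum>k<K. 10 * sqrt C * ?D * (w ^ k / w ^ (K - 1)))"
    proof (rule sum_mono)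
      fix k assume "k \<in> {..<K}"
      then have kK: "k < K" by simp
      define r where "r = real n / 2 ^ k"
      have "2 ^ k < real n" using lt[OF kK] by (metis of_nat_less_iff of_nat_numeral of_nat_power)
      then have r: "r > 1" by (simp add: r_def field_simps)
      define s where "s = sqrt C * ?D * r powr (- 1/4)"
      have s: "s > 0" using C D r by (simp add: s_def)
      have "sqrt (2 ^ k / real n) = r powr (- 1/2)"
        using r by (simp add: r_def powr_minus powr_half_sqrt real_sqrt_divide field_simps)
      also have "\<dots> = (r powr (- 1/4))\<^sup>2" using r by (simp add: powr_power)
      finally have s2: "s\<^sup>2 = C * (real n ^ 4 / real n ^ d) * sqrt (2 ^ k / real n)"
        using C by (simp add: s_def power_mult_distrib)
      have sqb: "sq (b k y) \<le> s\<^sup>2" if y: "y \<in> round_down k ` torus d n" for y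
      proof -
        obtain x where x: "x \<in> torus d n" "y = round_down k x" using y by auto
        then have "(\<Sum>z\<in>torus d n. (green d n (round_down (Suc k) x) z - green d n (round_down k x) z)\<^sup>2)
          \<le> C * (real n ^ 4 / real n ^ d) * sqrt (2 ^ k / real n)"
          by (intro inc[rule_format, OF n] round_down_torus round_down_close) (auto simp: torus_iff)
        then show ?thesis unfolding s2 sq_def b_def x(2) round_down_Suc .
      qed
      define N where "N = (2 * r) ^ d"
      have "(2 * r) ^ 1 \<le> N" unfolding N_def using r d by (intro power_increasing) auto
      then have N2: "N \<ge> 2" using r by simp
      have "expectation (Mx k) \<le> 2 * s * sqrt (ln N)"
        unfolding Mx_def
        using ne sqb s N2 card_round_down[of k n d] lt[OF kK]
        by (intro expectation_Max_lin_le) (auto simp: N_def r_def)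
      also have "\<dots> \<le> 2 * s * (5 * r powr (1/8))"
      proof (intro mult_left_mono real_le_lsqrt)
        \<comment> \<open>A small power of \<open>r\<close> absorbs the logarithm of the net size.
          The constant 3 * 8 = 24 is rounded up to the square 25.\<close>
        have "ln (2 * r) \<le> (2 * r) powr (1/4) / (1/4)" using r by (intro ln_powr_bound) auto
        also have "(2 * r) powr (1/4) = 2 powr (1/4) * r powr (1/4)" using r by (intro powr_mult)
        also have "2 powr (1/4) \<le> (2::real)" using powr_mono[of "1/4" 1 2] by simp
        finally have "ln (2 * r) \<le> 8 * r powr (1/4)" using r by simp
        moreover have "ln N = real d * ln (2 * r)" unfolding N_def by (rule ln_realpow)
        moreover have "real d * ln (2 * r) \<le> 3 * ln (2 * r)" using d r by (intro mult_right_mono) auto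
        ultimately have "ln N \<le> 25 * r powr (1/4)" using powr_ge_zero[of r "1/4"] by linarith
        also have "\<dots> = (5 * r powr (1/8))\<^sup>2" using r by (simp add: power_mult_distrib powr_power)
        finally show "ln N \<le> (5 * r powr (1/8))\<^sup>2" .
      qed (use s in auto)
      also have "\<dots> = 10 * sqrt C * ?D * (r powr (- 1/4) * r powr (1/8))" by (simp add: s_def)
      also have "r powr (- 1/4) * r powr (1/8) = r powr (- 1/8)" using r by (simp flip: powr_add)
      also have "\<dots> \<le> (2 ^ (K - 1) / 2 ^ k) powr (- 1/8)"
      proof (rule powr_mono2')
        have "2 ^ (K - 1) < real n" using lt[of "K - 1"] \<open>K \<noteq> 0\<close>
          by (metis diff_less of_nat_less_iff of_nat_numeral of_nat_power zero_less_iff_neq_zero zero_less_one)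
        then show "2 ^ (K - 1) / 2 ^ k \<le> r" by (simp add: r_def divide_right_mono)
      qed auto
      also have "\<dots> = w ^ k / w ^ (K - 1)"
      proof -
        have pw8: "((2::real) ^ j) powr (1/8) = w ^ j" for j
          by (simp add: w_def powr_powr mult.commute flip: powr_realpow)
        show ?thesis by (simp add: powr_minus powr_divide pw8 field_simps)
      qed
      finally show "expectation (Mx k) \<le> 10 * sqrt C * ?D * (w ^ k / w ^ (K - 1))"
        using C D by simp
    qed
    also have "\<dots> = 10 * sqrt C * ?D * ((\<Sum>k<K. w ^ k) / w ^ (K - 1))"
      by (simp only: sum_distrib_left sum_divide_distrib)
    also have "\<dots> \<le> 10 * sqrt C * ?D * (w / (w - 1))"
    proof (rule mult_left_mono)
      have "(\<Sum>k<K. w ^ k) = (w ^ K - 1) / (w - 1)" using w by (simp add: geometric_sum)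
      also have "\<dots> \<le> w ^ K / (w - 1)" using w by (intro divide_right_mono) auto
      also have "w ^ K = w * w ^ (K - 1)" using \<open>K \<noteq> 0\<close> by (cases K) auto
      finally have "(\<Sum>k<K. w ^ k) / w ^ (K - 1) \<le> w * w ^ (K - 1) / (w - 1) / w ^ (K - 1)"
        using w by (intro divide_right_mono) auto
      then show "(\<Sum>k<K. w ^ k) / w ^ (K - 1) \<le> w / (w - 1)" using w by simp
    qed (use C D in auto)
    finally show ?thesis by (simp add: mult_ac)
  qed
  then show ?thesis using C w by (intro exI[of _ "10 * sqrt C * (w / (w - 1))"]) auto
qed

section \<open>Lower bounds from test functions\<close>

text \<open>The Laplacian sums to zero, so its positive and negative parts have equal mass; later
  only the negative part has to be bounded.\<close>

lemma sum_abs_laplacian: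
  assumes "finite V" and "\<And>x y. E x y \<Longrightarrow> E y x"
  shows "(\<Sum>x\<in>V. \<bar>graph_laplacian V E f x\<bar>) = 2 * (\<Sum>x\<in>V. max 0 (- graph_laplacian V E f x))"
proof -
  have "(\<Sum>x\<in>V. \<bar>graph_laplacian V E f x\<bar>)
      = (\<Sum>x\<in>V. graph_laplacian V E f x + 2 * max 0 (- graph_laplacian V E f x))"
    by (intro sum.cong refl) (simp add: max_def)
  then show ?thesis using sum_laplacian[OF assms] by (simp add: sum.distrib sum_distrib_left)
qed

text \<open>Self-adjointness moves the Laplacian from the potential to \<open>f\<close>. Since the
  Laplacian of \<open>f\<close> sums to zero, the potential may be recentred at its midrange
  \<open>(a - b) / 2\<close>, where it is bounded by half its oscillation
  \<open>a + b\<close>.\<close>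

lemma pairing_le_oscillation:
  assumes n: "n \<ge> 2"
  shows "(\<Sum>y\<in>torus d n. f y * \<sigma> y) - (\<Sum>y\<in>torus d n. \<sigma> y) / real n ^ d * (\<Sum>y\<in>torus d n. f y)
    \<le> (\<Sum>y\<in>torus d n. \<bar>graph_laplacian (torus d n) (torus_adj n) f y\<bar>) / 2
       * (Max (potential d n \<sigma> ` torus d n) + Max ((\<lambda>x. - potential d n \<sigma> x) ` torus d n))"
proof -
  let ?V = "torus d n" and ?g = "potential d n \<sigma>" and ?L = "graph_laplacian (torus d n) (torus_adj n)"
  let ?mean = "(\<Sum>y\<in>torus d n. \<sigma> y) / real n ^ d"
  define a where "a = Max (?g ` ?V)"
  define b where "b = Max ((\<lambda>x. - ?g x) ` ?V)"
  have ab: "?g y \<le> a" "- ?g y \<le> b" if "y \<in> ?V" for y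
    using that by (auto simp: a_def b_def)
  have "(\<Sum>y\<in>?V. f y * \<sigma> y) - ?mean * (\<Sum>y\<in>?V. f y) = - (\<Sum>y\<in>?V. f y * ?L ?g y)"
  proof -
    have "(\<Sum>y\<in>?V. f y * ?L ?g y) = (\<Sum>y\<in>?V. ?mean * f y - f y * \<sigma> y)"
      by (intro sum.cong refl) (simp only: laplacian_potential[OF n] right_diff_distrib mult.commute)
    then show ?thesis by (simp only: sum_subtractf sum_distrib_left minus_diff_eq)
  qed
  also have "\<dots> = - (\<Sum>y\<in>?V. ?g y * ?L f y)"
    by (subst laplacian_selfadjoint) (auto intro: torus_adj_sym)
  also have "\<dots> = (\<Sum>y\<in>?V. - (?L f y * (?g y - (a - b) / 2)))"
  proof -
    have "(\<Sum>y\<in>?V. ?L f y * ((a - b) / 2)) = 0"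
      by (simp only: sum_distrib_right[symmetric] sum_laplacian[OF finite_torus torus_adj_sym] mult_zero_left)
    then show ?thesis by (simp add: right_diff_distrib sum_subtractf sum_negf mult.commute)
  qed
  also have "\<dots> \<le> (\<Sum>y\<in>?V. \<bar>?L f y\<bar> * ((a + b) / 2))"
  proof (rule sum_mono)
    fix y assume "y \<in> ?V"
    then have "\<bar>?g y - (a - b) / 2\<bar> \<le> (a + b) / 2" using ab[of y] by (simp add: abs_le_iff field_simps)
    then have "\<bar>?L f y\<bar> * \<bar>?g y - (a - b) / 2\<bar> \<le> \<bar>?L f y\<bar> * ((a + b) / 2)" by (intro mult_left_mono) auto
    then show "- (?L f y * (?g y - (a - b) / 2)) \<le> \<bar>?L f y\<bar> * ((a + b) / 2)"
      unfolding abs_mult[symmetric] by linarith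
  qed
  also have "\<dots> = (\<Sum>y\<in>?V. \<bar>?L f y\<bar>) / 2 * (a + b)" by (simp add: sum_distrib_right)
  finally show ?thesis unfolding a_def b_def .
qed

lemma expectation_oscillation:
  assumes n: "n \<ge> 2"
  shows "integrable (gauss_field d n) (\<lambda>\<sigma>. Max (potential d n \<sigma> ` torus d n) + Max ((\<lambda>x. - potential d n \<sigma> x) ` torus d n))"
    and "(\<integral>\<sigma>. Max (potential d n \<sigma> ` torus d n) + Max ((\<lambda>x. - potential d n \<sigma> x) ` torus d n) \<partial>gauss_field d n)
       = 2 * mean_odometer d n"
proof -
  note p = potential_integrals[OF n, of d]
  show "integrable (gauss_field d n) (\<lambda>\<sigma>. Max (potential d n \<sigma> ` torus d n) + Max ((\<lambda>x. - potential d n \<sigma> x) ` torus d n))"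
    using p(3,4) by (rule Bochner_Integration.integrable_add[rotated])
  show "(\<integral>\<sigma>. Max (potential d n \<sigma> ` torus d n) + Max ((\<lambda>x. - potential d n \<sigma> x) ` torus d n) \<partial>gauss_field d n)
       = 2 * mean_odometer d n"
    using p(3,4,5) by (subst Bochner_Integration.integral_add) (auto simp: mean_odometer_def)
qed

lemma oscillation_nonneg:
  "n \<ge> 2 \<Longrightarrow> 0 \<le> Max (potential d n \<sigma> ` torus d n) + Max ((\<lambda>x. - potential d n \<sigma> x) ` torus d n)"
proof -
  assume "n \<ge> 2"
  then obtain x where "x \<in> torus d n" using torus_nonempty[of n d] by fastforce
  then have "potential d n \<sigma> x \<le> Max (potential d n \<sigma> ` torus d n)"
    "- potential d n \<sigma> x \<le> Max ((\<lambda>x. - potential d n \<sigma> x) ` torus d n)" by auto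
  then show ?thesis by linarith
qed

text \<open>Total mass zero removes the mean of the noise. The pairing bound for \<open>f\<close>
  and for \<open>- f\<close> controls |lin f|, and the mean absolute value of a Gaussian is
  explicit.\<close>

lemma mean_odometer_ge_single:
  assumes n: "n \<ge> 2" and zero: "(\<Sum>y\<in>torus d n. f y) = 0"
    and L: "(\<Sum>y\<in>torus d n. \<bar>graph_laplacian (torus d n) (torus_adj n) f y\<bar>) \<le> A"
  shows "sqrt (2 / pi) * sqrt (\<Sum>y\<in>torus d n. (f y)\<^sup>2) \<le> A * mean_odometer d n"
proof -
  interpret gaussian_vector "torus d n" using n by (rule gaussian_vector_torus)
  let ?osc = "\<lambda>\<sigma>. Max (potential d n \<sigma> ` torus d n) + Max ((\<lambda>x. - potential d n \<sigma> x) ` torus d n)"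
  have "\<bar>lin f \<sigma>\<bar> \<le> A / 2 * ?osc \<sigma>" for \<sigma>
  proof -
    have L': "(\<Sum>y\<in>torus d n. \<bar>graph_laplacian (torus d n) (torus_adj n) (\<lambda>y. -1 * f y) y\<bar>) \<le> A"
      unfolding laplacian_cmult using L by simp
    have step: "(\<Sum>y\<in>torus d n. \<bar>graph_laplacian (torus d n) (torus_adj n) h y\<bar>) / 2 * ?osc \<sigma> \<le> A / 2 * ?osc \<sigma>"
      if "(\<Sum>y\<in>torus d n. \<bar>graph_laplacian (torus d n) (torus_adj n) h y\<bar>) \<le> A" for h
      using that oscillation_nonneg[OF n, of d \<sigma>] by (intro mult_right_mono divide_right_mono) auto
    have "lin f \<sigma> \<le> A / 2 * ?osc \<sigma>"
      using pairing_le_oscillation[OF n, where f = f and \<sigma> = \<sigma> and d = d] step[OF L] zero by (simp add: lin_def)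
    moreover have "- lin f \<sigma> \<le> A / 2 * ?osc \<sigma>"
      using pairing_le_oscillation[OF n, where f = "\<lambda>y. -1 * f y" and \<sigma> = \<sigma> and d = d] step[OF L'] zero
      by (simp add: lin_def sum_negf)
    ultimately show ?thesis by (simp add: abs_le_iff)
  qed
  then have "expectation (\<lambda>\<sigma>. \<bar>lin f \<sigma>\<bar>) \<le> expectation (\<lambda>\<sigma>. A / 2 * ?osc \<sigma>)"
    using expectation_oscillation(1)[OF n, of d] expectation_lin(1)[of f] unfolding gauss_field_def
    by (intro integral_mono integrable_mult_right) auto
  also have "\<dots> = A * mean_odometer d n"
    using expectation_oscillation(2)[OF n, of d] unfolding gauss_field_def by simp
  finally show ?thesis unfolding expectation_abs_lin sq_def .
qed

text \<open>Only the mean of the noise, which the test functions see through their total mass, prevents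
  the pairings from being independent; by Cauchy-Schwarz it contributes at most one unit.\<close>

lemma mean_odometer_ge_family:
  assumes n: "n \<ge> 2" and I: "finite I" and v: "v > 0"
    and norm_ge: "\<And>i. i \<in> I \<Longrightarrow> v\<^sup>2 \<le> (\<Sum>y\<in>torus d n. (f i y)\<^sup>2)"
    and disj: "\<And>i j y. i \<in> I \<Longrightarrow> j \<in> I \<Longrightarrow> i \<noteq> j \<Longrightarrow> y \<in> torus d n \<Longrightarrow> f i y = 0 \<or> f j y = 0"
    and L: "\<And>i. i \<in> I \<Longrightarrow> (\<Sum>y\<in>torus d n. \<bar>graph_laplacian (torus d n) (torus_adj n) (f i) y\<bar>) \<le> A"
    and N1: "ln 2 \<le> real (card I) * std_normal_density (sqrt (ln (real (card I))) + 1)"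
    and N2: "16 \<le> ln (real (card I))"
  shows "v * sqrt (ln (real (card I))) / 4 \<le> A * mean_odometer d n"
proof -
  interpret gaussian_vector "torus d n" using n by (rule gaussian_vector_torus)
  let ?osc = "\<lambda>\<sigma>. Max (potential d n \<sigma> ` torus d n) + Max ((\<lambda>x. - potential d n \<sigma> x) ` torus d n)"
  let ?L = "graph_laplacian (torus d n) (torus_adj n)"
  define t where "t = sqrt (ln (real (card I)))"
  \<comment> \<open>The closing estimate \<open>t / 2 - 1 >= t / 4\<close> requires
    \<open>t >= 4\<close>, which is the purpose of the 16 in \<open>N2\<close>.\<close>
  have t: "t \<ge> 4" unfolding t_def using N2 by (intro real_le_rsqrt) auto
  have "I \<noteq> {}" using N2 by auto
  define h where "h i y = f i y / sqrt (sq (f i))" for i y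
  have sq_pos: "sq (f i) > 0" if "i \<in> I" for i
    unfolding sq_def using less_le_trans[OF zero_less_power[OF v] norm_ge[OF that]] .
  have unit: "sq (h i) = 1" if "i \<in> I" for i
    using sq_pos[OF that]
    by (simp add: h_def[abs_def] sq_def power_divide flip: sum_divide_distrib)
  have Lh: "(\<Sum>y\<in>torus d n. \<bar>?L (h i) y\<bar>) \<le> A / v" if i: "i \<in> I" for i
  proof -
    have "v \<le> sqrt (sq (f i))" using norm_ge[OF i] v by (intro real_le_rsqrt) (simp add: sq_def)
    have "h i = (\<lambda>y. 1 / sqrt (sq (f i)) * f i y)" by (simp add: h_def[abs_def])
    then have "(\<Sum>y\<in>torus d n. \<bar>?L (h i) y\<bar>) = (\<Sum>y\<in>torus d n. \<bar>?L (f i) y\<bar>) / sqrt (sq (f i))"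
      using sq_nonneg[of "f i"] by (simp only: laplacian_cmult) (simp add: abs_mult sum_divide_distrib)
    also have "\<dots> \<le> A / v"
      using L[OF i] \<open>v \<le> sqrt (sq (f i))\<close> v order_trans[OF sum_nonneg L[OF i]]
      by (intro frac_le) (auto intro: sum_nonneg)
    finally show ?thesis .
  qed
  define B where "B = {\<sigma> \<in> space M. \<exists>i\<in>I. t \<le> lin (h i) \<sigma>}"
  have B: "B \<in> sets M" unfolding B_def using I by measurable
  have "1 - exp (- real (card I) * std_normal_density (t + 1)) \<le> prob B"
    unfolding B_def using I \<open>I \<noteq> {}\<close> unit t disj
    by (intro prob_lin_exceeds_ge) (auto simp: h_def)
  moreover have "exp (- real (card I) * std_normal_density (t + 1)) \<le> exp (- ln 2)"
    using N1 by (simp add: t_def)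
  moreover have "exp (- ln 2) = (1/2 :: real)" by (simp add: exp_minus)
  ultimately have pB: "1/2 \<le> prob B" by linarith
  \<comment> \<open>\<open>lin u\<close> is the normalised sum of the noise, a standard Gaussian. It
    bounds the mean term simultaneously for all \<open>i\<close>, and its mean absolute value is at
    most 1.\<close>
  define u where "u y = 1 / sqrt (real n ^ d)" for y :: "nat list"
  have nd: "real n ^ d > 0" using n by simp
  have squ: "sq u = 1" using nd by (simp add: sq_def u_def power_divide card_torus)
  have pw: "t * indicator B \<sigma> - \<bar>lin u \<sigma>\<bar> \<le> A / v / 2 * ?osc \<sigma>" if "\<sigma> \<in> space M" for \<sigma>
  proof (cases "\<sigma> \<in> B")
    case True
    then obtain i where i: "i \<in> I" "t \<le> lin (h i) \<sigma>" by (auto simp: B_def)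
    have "(\<Sum>y\<in>torus d n. h i y * 1)\<^sup>2 \<le> (\<Sum>y\<in>torus d n. (h i y)\<^sup>2) * (\<Sum>y\<in>torus d n. 1\<^sup>2)"
      by (rule Cauchy_Schwarz_ineq_sum)
    also have "\<dots> = real n ^ d" using unit[OF i(1)] by (simp add: sq_def card_torus)
    finally have "\<bar>\<Sum>y\<in>torus d n. h i y\<bar> \<le> sqrt (real n ^ d)"
      by (intro real_le_rsqrt) simp
    then have "\<bar>\<Sum>y\<in>torus d n. \<sigma> y\<bar> / real n ^ d * \<bar>\<Sum>y\<in>torus d n. h i y\<bar>
        \<le> \<bar>\<Sum>y\<in>torus d n. \<sigma> y\<bar> / real n ^ d * sqrt (real n ^ d)" by (intro mult_left_mono) auto
    also have "\<dots> = \<bar>\<Sum>y\<in>torus d n. \<sigma> y\<bar> / sqrt (real n ^ d)"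
      using nd by (simp add: divide_simps)
    also have "\<dots> = \<bar>lin u \<sigma>\<bar>"
      using nd by (simp add: lin_def u_def abs_mult flip: sum_divide_distrib)
    finally have "\<bar>(\<Sum>y\<in>torus d n. \<sigma> y) / real n ^ d * (\<Sum>y\<in>torus d n. h i y)\<bar> \<le> \<bar>lin u \<sigma>\<bar>"
      using nd by (simp add: abs_mult)
    moreover have "(\<Sum>y\<in>torus d n. \<bar>?L (h i) y\<bar>) / 2 * ?osc \<sigma> \<le> A / v / 2 * ?osc \<sigma>"
      using Lh[OF i(1)] oscillation_nonneg[OF n, of d \<sigma>] by (intro mult_right_mono divide_right_mono) auto
    moreover have "t * indicator B \<sigma> = t" using True by simp
    moreover have "t - (\<Sum>y\<in>torus d n. \<sigma> y) / real n ^ d * (\<Sum>y\<in>torus d n. h i y)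
        \<le> (\<Sum>y\<in>torus d n. \<bar>?L (h i) y\<bar>) / 2 * ?osc \<sigma>"
      using pairing_le_oscillation[OF n, where f = "h i" and \<sigma> = \<sigma> and d = d] i(2) unfolding lin_def by linarith
    ultimately show ?thesis by linarith
  next
    case False
    obtain i where "i \<in> I" using \<open>I \<noteq> {}\<close> by auto
    then have "0 \<le> A / v" using order_trans[OF sum_nonneg Lh] by auto
    then have "0 \<le> A / v / 2 * ?osc \<sigma>" using oscillation_nonneg[OF n, of d \<sigma>] by (intro mult_nonneg_nonneg) auto
    then show ?thesis using False by simp
  qed
  have int: "integrable M (\<lambda>\<sigma>. t * indicator B \<sigma>)" "integrable M (\<lambda>\<sigma>. \<bar>lin u \<sigma>\<bar>)"
    using B expectation_lin(1)[of u] by (auto simp: emeasure_eq_measure)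
  have "t * prob B - expectation (\<lambda>\<sigma>. \<bar>lin u \<sigma>\<bar>) = expectation (\<lambda>\<sigma>. t * indicator B \<sigma> - \<bar>lin u \<sigma>\<bar>)"
    using int B sets.sets_into_space[OF B] by (subst Bochner_Integration.integral_diff) (auto simp: Int_absorb2)
  also have "\<dots> \<le> expectation (\<lambda>\<sigma>. A / v / 2 * ?osc \<sigma>)"
  proof (rule integral_mono)
    show "integrable M (\<lambda>\<sigma>. t * indicator B \<sigma> - \<bar>lin u \<sigma>\<bar>)"
      using int by (rule Bochner_Integration.integrable_diff)
    show "integrable M (\<lambda>\<sigma>. A / v / 2 * ?osc \<sigma>)"
      using expectation_oscillation(1)[OF n, of d] unfolding gauss_field_def by (rule integrable_mult_right)
  qed (rule pw)
  also have "\<dots> = A / v * mean_odometer d n"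
    using expectation_oscillation(2)[OF n, of d] unfolding gauss_field_def by simp
  finally have "t * prob B - expectation (\<lambda>\<sigma>. \<bar>lin u \<sigma>\<bar>) \<le> A / v * mean_odometer d n" .
  moreover have "expectation (\<lambda>\<sigma>. \<bar>lin u \<sigma>\<bar>) \<le> 1" using expectation_abs_lin_le[of u] squ by simp
  moreover have "t * (1/2) \<le> t * prob B" using pB t by (intro mult_left_mono) auto
  ultimately have "t / 4 \<le> A / v * mean_odometer d n" using t by linarith
  then have "v * (t / 4) \<le> v * (A / v * mean_odometer d n)" using v by (intro mult_left_mono) auto
  then show ?thesis using v by (simp add: t_def)
qed

section \<open>The lowest frequency\<close>

text \<open>The lowest mode has squared L2 norm of order n^d, and its Laplacian has L1 norm at most
  of order n^d / n^2; the quotient of the two norms is n^(2 - d/2).\<close>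

lemma lower_bound_frequency:
  assumes d: "d \<ge> 1"
  shows "\<exists>c>0. \<forall>n\<ge>2. c * sqrt (real n ^ 4 / real n ^ d) \<le> mean_odometer d n"
proof -
  have "1 / (4 * pi\<^sup>2 * sqrt pi) * sqrt (real n ^ 4 / real n ^ d) \<le> mean_odometer d n" if n: "n \<ge> 2" for n
  proof -
    let ?V = "torus d n"
    define e where "e = 1 # replicate (d - 1) (0::nat)"
    have e: "e \<in> ?V" using n d by (auto simp: e_def torus_def)
    have e0: "e \<noteq> replicate d 0" using d by (cases d) (auto simp: e_def)
    have nd: "real n ^ d > 0" using n by simp
    have sum0: "(\<Sum>x\<in>?V. chr n e x) = 0"
      using sum_chr_orthogonal[OF e replicate_torus] n e0 by (simp add: chr_zero cong: sum.cong)
    have eig: "eigenval n e \<le> 4 * pi\<^sup>2 / (real n)\<^sup>2"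
    proof -
      have "(\<Sum>i<length e. 2 - 2 * cos (2 * pi * real (e ! i) / real n)) = 2 - 2 * cos (2 * pi / real n)"
        using d by (cases d) (simp_all add: e_def sum.lessThan_Suc_shift del: sum.lessThan_Suc)
      also have "\<dots> = 2 - 2 * cos (2 * (pi / real n))" by simp
      also have "\<dots> = 4 * (sin (pi / real n))\<^sup>2" by (subst cos_double_sin) simp
      also have "\<dots> \<le> 4 * (pi / real n)\<^sup>2"
        using abs_sin_x_le_abs_x[of "pi / real n"] by (simp only: abs_le_square_iff)
      finally have *: "(\<Sum>i<length e. 2 - 2 * cos (2 * pi * real (e ! i) / real n)) \<le> 4 * pi\<^sup>2 / (real n)\<^sup>2"
        by (simp add: power_divide)
      have "eigenval n e \<le> 1 * (4 * pi\<^sup>2 / (real n)\<^sup>2)"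
        unfolding eigenval_def using * edge_weight_bounds[of n]
        by (intro mult_mono) (auto intro!: sum_nonneg)
      then show ?thesis by simp
    qed
    \<comment> \<open>Real and imaginary parts share the mass \<open>n ^ d\<close>, so one of them
      carries at least half. Which one is left open: for \<open>n = 2\<close> the imaginary part
      vanishes.\<close>
    have "(\<Sum>x\<in>?V. (Re (chr n e x))\<^sup>2) + (\<Sum>x\<in>?V. (Im (chr n e x))\<^sup>2) = real n ^ d"
      using norm_chr[of n e] by (simp add: card_torus flip: sum.distrib cmod_power2)
    moreover have "(\<Sum>x\<in>?V. (Re (chr n e x))\<^sup>2) = (\<Sum>x\<in>?V. (Re (1 * chr n e x))\<^sup>2)"
      "(\<Sum>x\<in>?V. (Im (chr n e x))\<^sup>2) = (\<Sum>x\<in>?V. (Re (- \<i> * chr n e x))\<^sup>2)" by simp_all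
    ultimately have "real n ^ d / 2 \<le> (\<Sum>x\<in>?V. (Re (1 * chr n e x))\<^sup>2)
        \<or> real n ^ d / 2 \<le> (\<Sum>x\<in>?V. (Re (- \<i> * chr n e x))\<^sup>2)"
      by linarith
    moreover have "norm (1::complex) = 1" "norm (- \<i>) = 1" by simp_all
    ultimately obtain c :: complex where c: "norm c = 1" "real n ^ d / 2 \<le> (\<Sum>x\<in>?V. (Re (c * chr n e x))\<^sup>2)"
      by blast
    define f where "f x = Re (c * chr n e x)" for x
    have "(\<Sum>x\<in>?V. f x) = Re (c * (\<Sum>x\<in>?V. chr n e x))"
      by (simp only: f_def Re_sum sum_distrib_left)
    then have f0: "(\<Sum>x\<in>?V. f x) = 0" by (simp add: sum0)
    have f1: "\<bar>f x\<bar> \<le> 1" for x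
      using abs_Re_le_cmod[of "c * chr n e x"] c(1) by (simp only: f_def norm_mult norm_chr)
    have "(\<Sum>x\<in>?V. \<bar>graph_laplacian ?V (torus_adj n) f x\<bar>) = (\<Sum>x\<in>?V. eigenval n e * \<bar>f x\<bar>)"
    proof (rule sum.cong[OF refl])
      fix x assume "x \<in> ?V"
      then have "graph_laplacian ?V (torus_adj n) f x = - eigenval n e * f x"
        unfolding f_def by (rule laplacian_Re_chr[OF n _ e])
      then show "\<bar>graph_laplacian ?V (torus_adj n) f x\<bar> = eigenval n e * \<bar>f x\<bar>"
        using eigenval_pos[OF n e e0] by (simp add: abs_mult)
    qed
    also have "\<dots> \<le> (\<Sum>x\<in>?V. eigenval n e * 1)"
      using f1 eigenval_pos[OF n e e0] by (intro sum_mono mult_left_mono) auto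
    also have "\<dots> \<le> real n ^ d * (4 * pi\<^sup>2 / (real n)\<^sup>2)"
    proof -
      have "(\<Sum>x\<in>?V. eigenval n e * 1) = real n ^ d * eigenval n e" by (simp add: card_torus)
      then show ?thesis using mult_left_mono[OF eig, of "real n ^ d"] nd by linarith
    qed
    finally have "sqrt (2 / pi) * sqrt (\<Sum>y\<in>?V. (f y)\<^sup>2) \<le> real n ^ d * (4 * pi\<^sup>2 / (real n)\<^sup>2) * mean_odometer d n"
      by (rule mean_odometer_ge_single[OF n f0])
    moreover have "sqrt (real n ^ d / 2) \<le> sqrt (\<Sum>y\<in>?V. (f y)\<^sup>2)" using c(2) by (simp add: f_def)
    then have "sqrt (2 / pi) * sqrt (real n ^ d / 2) \<le> sqrt (2 / pi) * sqrt (\<Sum>y\<in>?V. (f y)\<^sup>2)"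
      by (intro mult_left_mono) auto
    ultimately have "sqrt (2 / pi) * sqrt (real n ^ d / 2) \<le> real n ^ d * (4 * pi\<^sup>2 / (real n)\<^sup>2) * mean_odometer d n"
      by linarith
    moreover have "sqrt (2 / pi) * sqrt (real n ^ d / 2) = sqrt (real n ^ d) / sqrt pi"
      by (simp add: real_sqrt_divide)
    ultimately have main: "sqrt (real n ^ d) / sqrt pi \<le> real n ^ d * (4 * pi\<^sup>2 / (real n)\<^sup>2) * mean_odometer d n" by simp
    define q where "q = sqrt (real n ^ d)"
    have q: "q > 0" "real n ^ d = q * q" using nd by (auto simp: q_def)
    have "sqrt (real n ^ 4) = (real n)\<^sup>2" by (rule real_sqrt_unique) (auto simp flip: power_mult)
    then have "sqrt (real n ^ 4 / real n ^ d) = (real n)\<^sup>2 / q" by (simp add: real_sqrt_divide q_def)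
    moreover define P where "P = q * q * (4 * pi\<^sup>2 / (real n)\<^sup>2)"
    have P: "P > 0" using q n by (simp add: P_def)
    have "q / sqrt pi \<le> P * mean_odometer d n" using main by (simp only: P_def q(2)[symmetric] q_def[symmetric])
    then have "q / sqrt pi / P \<le> mean_odometer d n" using P by (simp add: pos_divide_le_eq mult_ac)
    moreover have "q / sqrt pi / P = 1 / (4 * pi\<^sup>2 * sqrt pi) * ((real n)\<^sup>2 / q)"
      using q n by (simp add: P_def divide_simps)
    ultimately show ?thesis by (simp only:)
  qed
  then show ?thesis by (intro exI[of _ "1 / (4 * pi\<^sup>2 * sqrt pi)"]) auto
qed

text \<open>The finitely many small \<open>n\<close> are paid for by the sum of their ratios
  \<open>b n / a n\<close>, which makes sense because \<open>a\<close> is positive there. In the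
  applications \<open>a\<close> is the mean odometer.\<close>

lemma eventual_domination:
  fixes a b :: "nat \<Rightarrow> real"
  assumes a: "\<And>n. n \<ge> 2 \<Longrightarrow> a n > 0" and b: "\<And>n. n \<ge> 2 \<Longrightarrow> b n \<ge> 0"
    and ev: "\<And>n. n \<ge> m \<Longrightarrow> n \<ge> 2 \<Longrightarrow> b n \<le> C * a n" and C: "C > 0"
  shows "\<exists>C>0. \<forall>n\<ge>2. b n \<le> C * a n"
proof -
  define D where "D = C + (\<Sum>n\<in>{2..m}. b n / a n)"
  have nn: "b n / a n \<ge> 0" if "n \<in> {2..m}" for n using a[of n] b[of n] that by auto
  have D: "D \<ge> C" unfolding D_def using sum_nonneg[of "{2..m}" "\<lambda>n. b n / a n"] nn by simp
  have "b n \<le> D * a n" if n: "n \<ge> 2" for n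
  proof (cases "n \<ge> m")
    case True
    then have "b n \<le> C * a n" using ev n by blast
    also have "\<dots> \<le> D * a n" using D a[OF n] by (intro mult_right_mono) auto
    finally show ?thesis .
  next
    case False
    have "b n / a n \<le> (\<Sum>n\<in>{2..m}. b n / a n)" using False n nn by (intro member_le_sum) auto
    then have "b n / a n \<le> D" using C by (simp add: D_def)
    then show ?thesis using a[OF n] by (simp add: field_simps)
  qed
  then show ?thesis using D C by (intro exI[of _ D]) auto
qed

lemma mean_odometer_pos:
  assumes "d \<ge> 1" "n \<ge> 2"
  shows "mean_odometer d n > 0"
proof -
  obtain c where "c > 0" "c * sqrt (real n ^ 4 / real n ^ d) \<le> mean_odometer d n"
    using lower_bound_frequency[OF assms(1)] assms(2) by blast
  moreover have "0 < c * sqrt (real n ^ 4 / real n ^ d)" using \<open>c > 0\<close> assms(2) by simp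
  ultimately show ?thesis by linarith
qed

section \<open>Point masses as test functions\<close>

lemma gaussian_exceedance_threshold:
  obtains N0 where "\<And>N. N \<ge> N0 \<Longrightarrow> ln 2 \<le> real N * std_normal_density (sqrt (ln (real N)) + 1) \<and> 16 \<le> ln (real N)"
proof -
  have "filterlim (\<lambda>N::nat. ln (real N)) at_top at_top" by real_asymp
  then have "\<forall>\<^sub>F N :: nat in at_top. 16 \<le> ln (real N)" unfolding filterlim_at_top by blast
  with gaussian_exceedance_asymp have "\<forall>\<^sub>F N :: nat in at_top. ln 2 \<le> real N * std_normal_density (sqrt (ln (real N)) + 1) \<and> 16 \<le> ln (real N)"
    by eventually_elim blast
  then show ?thesis using that unfolding eventually_at_top_linorder by blast
qed

text \<open>The point masses at the \<open>n ^ d\<close> vertices have L2 norm 1 and disjoint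
  supports. The Laplacian of one is negative only at the mass itself, where it is at least
  \<open>- 2 * d\<close>, so its L1 norm is at most \<open>4 * d\<close>.\<close>

lemma lower_bound_sqrt_ln:
  assumes d: "d \<ge> 1"
  shows "\<exists>C>0. \<forall>n\<ge>2. sqrt (ln (real n)) \<le> C * mean_odometer d n"
proof -
  obtain N0 where N0: "\<And>N. N \<ge> N0 \<Longrightarrow> ln 2 \<le> real N * std_normal_density (sqrt (ln (real N)) + 1) \<and> 16 \<le> ln (real N)"
    using gaussian_exceedance_threshold by blast
  show ?thesis
  proof (rule eventual_domination[where m = N0 and C = "16 * real d"])
    fix n assume nN: "n \<ge> N0" and n: "n \<ge> 2"
    let ?V = "torus d n"
    define f where "f x y = (if y = x then 1 else 0 :: real)" for x y :: "nat list"
    have "n ^ 1 \<le> n ^ d" using n d by (intro power_increasing) auto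
    then have nd: "n \<le> n ^ d" by simp
    have L: "(\<Sum>y\<in>?V. \<bar>graph_laplacian ?V (torus_adj n) (f x) y\<bar>) \<le> 4 * real d" if x: "x \<in> ?V" for x
    proof -
      have "max 0 (- graph_laplacian ?V (torus_adj n) (f x) y) \<le> (if y = x then 2 * real d else 0)" if y: "y \<in> ?V" for y
      proof (cases "y = x")
        case True
        have "- graph_laplacian ?V (torus_adj n) (f x) x
            = edge_weight n * (\<Sum>i<d. 2 - f x (x[i := fwd n (x ! i)]) - f x (x[i := bwd n (x ! i)]))"
          unfolding laplacian_torus[OF n x] mult_minus_right[symmetric] sum_negf[symmetric]
          by (intro arg_cong2[of _ _ _ _ "(*)"] sum.cong refl) (simp add: f_def)
        also have "\<dots> \<le> 1 * (\<Sum>i<d. 2)"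
          using edge_weight_bounds[of n] by (intro mult_mono sum_mono) (auto simp: f_def intro!: sum_nonneg)
        finally show ?thesis using True by (simp add: mult.commute)
      next
        case False
        have "graph_laplacian ?V (torus_adj n) (f x) y \<ge> 0"
          unfolding graph_laplacian_def using False by (intro sum_nonneg) (auto simp: f_def)
        then show ?thesis using False by simp
      qed
      then have "(\<Sum>y\<in>?V. max 0 (- graph_laplacian ?V (torus_adj n) (f x) y)) \<le> (\<Sum>y\<in>?V. if y = x then 2 * real d else 0)"
        by (intro sum_mono)
      also have "\<dots> = 2 * real d" using x by simp
      finally show ?thesis using sum_abs_laplacian[of ?V "torus_adj n" "f x"] by (simp add: torus_adj_sym)
    qed
    have "(f x y)\<^sup>2 = f x y" for x y by (simp add: f_def)
    then have unit: "(\<Sum>y\<in>?V. (f x y)\<^sup>2) = 1" if "x \<in> ?V" for x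
      using that by (simp add: f_def)
    have N: "ln 2 \<le> real (card ?V) * std_normal_density (sqrt (ln (real (card ?V))) + 1)" "16 \<le> ln (real (card ?V))"
      using N0[of "card ?V"] nd nN by (auto simp: card_torus)
    have "1 * sqrt (ln (real (card ?V))) / 4 \<le> 4 * real d * mean_odometer d n"
      by (rule mean_odometer_ge_family[where f = f, OF n finite_torus _ _ _ L N])
         (use unit in \<open>auto simp: f_def\<close>)
    moreover have "sqrt (ln (real n)) \<le> sqrt (ln (real (card ?V)))"
      using nd n by (simp add: card_torus flip: of_nat_power)
    ultimately show "sqrt (ln (real n)) \<le> 16 * real d * mean_odometer d n" by linarith
  qed (use d mean_odometer_pos in auto)
qed

section \<open>Dimension four\<close>

text \<open>In dimension four \<open>1 / |x|\<^sup>2\<close> is the Green function up to a constant. Cutting it off at height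
  \<open>1 / (m\<^sup>2 + 2)\<close> only adds positive mass to its Laplacian, so the Laplacian of the result stays bounded in
  \<open>L\<^sup>1\<close> whereas its \<open>L\<^sup>2\<close> norm squared grows like \<open>log m\<close>.\<close>

definition sqdist :: "nat list \<Rightarrow> nat list \<Rightarrow> real" where
  "sqdist c x = (\<Sum>i<4. (real (x ! i) - real (c ! i))\<^sup>2)"

definition truncated_green :: "nat \<Rightarrow> nat list \<Rightarrow> nat list \<Rightarrow> real" where
  "truncated_green m c x = max 0 (1 / (sqdist c x + 2) - 1 / ((real m)\<^sup>2 + 2))"

lemma sqdist_nonneg: "0 \<le> sqdist c x"
  by (simp add: sqdist_def sum_nonneg)

lemma sqdist_coord: "i < 4 \<Longrightarrow> (real (x ! i) - real (c ! i))\<^sup>2 \<le> sqdist c x"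
  unfolding sqdist_def by (intro member_le_sum) auto

lemma truncated_green_pos:
  assumes "truncated_green m c x \<noteq> 0"
  shows "sqdist c x < (real m)\<^sup>2"
proof (rule ccontr)
  assume "\<not> sqdist c x < (real m)\<^sup>2"
  then have "1 / (sqdist c x + 2) \<le> 1 / ((real m)\<^sup>2 + 2)"
    using sqdist_nonneg[of c x] by (intro divide_left_mono mult_pos_pos) (auto intro: add_nonneg_pos)
  then show False using assms by (simp add: truncated_green_def)
qed

lemma sqdist_less_coord:
  assumes "sqdist c x < (real m)\<^sup>2" "i < 4"
  shows "\<bar>real (x ! i) - real (c ! i)\<bar> < real m"
proof -
  have "\<bar>real (x ! i) - real (c ! i)\<bar>\<^sup>2 < (real m)\<^sup>2"
    using sqdist_coord[OF assms(2), of x c] assms(1) by simp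
  then show ?thesis by (rule power_less_imp_less_base) simp
qed

text \<open>With t = s + 3 the right side is 2t / (t^2 - 4y^2). Its geometric expansion may be cut
  after two terms because (t^2 - 4y^2)(t^2 + 4y^2) <= t^4. In the denominators, 1 comes from the
  unit step and 2 from the shift in \<open>truncated_green\<close>.\<close>

lemma reciprocal_second_difference:
  fixes s y :: real
  assumes "y\<^sup>2 \<le> s"
  shows "2 / (s + 3) + 8 * y\<^sup>2 / (s + 3) ^ 3 \<le> 1 / (s + 2 * y + 1 + 2) + 1 / (s - 2 * y + 1 + 2)"
proof -
  define t where "t = s + 3"
  have s: "s \<ge> 0" using assms zero_le_power2[of y] by linarith
  have "2 * \<bar>y\<bar> \<le> y\<^sup>2 + 1" using sum_squares_bound[of "\<bar>y\<bar>" 1] by simp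
  then have ty: "t - 2 * y > 0" "t + 2 * y > 0" and t: "t > 0" using assms s by (auto simp: t_def)
  define p where "p = (t - 2 * y) * (t + 2 * y)"
  have "p > 0" unfolding p_def using ty by (rule mult_pos_pos)
  moreover have "p = t\<^sup>2 - 4 * y\<^sup>2" by (simp add: p_def algebra_simps power2_eq_square)
  ultimately have p: "p > 0" "p = t\<^sup>2 - 4 * y\<^sup>2" by auto
  have "p * (t\<^sup>2 + 4 * y\<^sup>2) = t ^ 4 - 16 * y ^ 4"
    unfolding p(2) by (simp add: algebra_simps power2_eq_square power4_eq_xxxx)
  then have "p * (t\<^sup>2 + 4 * y\<^sup>2) \<le> t ^ 4" by simp
  then have "(t\<^sup>2 + 4 * y\<^sup>2) / t ^ 4 \<le> 1 / p" using p(1) t by (simp add: divide_simps mult.commute)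
  then have "2 * t * ((t\<^sup>2 + 4 * y\<^sup>2) / t ^ 4) \<le> 2 * t * (1 / p)" using t by (intro mult_left_mono) auto
  also have "2 * t * (1 / p) = 1 / (t + 2 * y) + 1 / (t - 2 * y)"
    using ty unfolding p_def by (simp add: divide_simps)
  also have "2 * t * ((t\<^sup>2 + 4 * y\<^sup>2) / t ^ 4) = 2 / t + 8 * y\<^sup>2 / t ^ 3"
    using t by (simp add: field_simps power_numeral_reduce)
  finally have "2 / t + 8 * y\<^sup>2 / t ^ 3 \<le> 1 / (t + 2 * y) + 1 / (t - 2 * y)" .
  moreover have "s + 2 * y + 1 + 2 = t + 2 * y" "s - 2 * y + 1 + 2 = t - 2 * y" by (simp_all add: t_def)
  ultimately show ?thesis unfolding t_def by (simp only:)
qed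

lemma sqdist_update:
  assumes "length x = 4" "i < 4"
  shows "sqdist c (x[i := a]) = sqdist c x - (real (x ! i) - real (c ! i))\<^sup>2 + (real a - real (c ! i))\<^sup>2"
proof -
  have "sqdist c (x[i := a]) = (real a - real (c ! i))\<^sup>2 + (\<Sum>j\<in>{..<4} - {i}. (real (x ! j) - real (c ! j))\<^sup>2)"
    using assms unfolding sqdist_def by (subst sum.remove[of _ i]) auto
  moreover have "sqdist c x = (real (x ! i) - real (c ! i))\<^sup>2 + (\<Sum>j\<in>{..<4} - {i}. (real (x ! j) - real (c ! j))\<^sup>2)"
    using assms unfolding sqdist_def by (subst sum.remove[of _ i]) auto
  ultimately show ?thesis by simp
qed

text \<open>At a zero of the nonnegative function the Laplacian is nonnegative. Elsewhere truncation
  only raises the neighbours, so the second differences of \<open>1 / (s + 2)\<close> bound it from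
  below. Their terms of order s^(-2) cancel precisely in dimension 4, where the squares
  \<open>(y i)^2\<close> sum to \<open>s\<close>; an error of order s^(-3) remains.\<close>

lemma laplacian_truncated_green_ge:
  assumes n: "n \<ge> 3" and x: "x \<in> torus 4 n"
    and c: "\<And>i. i < 4 \<Longrightarrow> m < c ! i \<and> c ! i + m < n"
  shows "- 32 / (1 + sqdist c x) ^ 3 \<le> graph_laplacian (torus 4 n) (torus_adj n) (truncated_green m c) x"
proof (cases "truncated_green m c x = 0")
  case True
  have "0 \<le> graph_laplacian (torus 4 n) (torus_adj n) (truncated_green m c) x"
    unfolding graph_laplacian_def True by (intro sum_nonneg) (auto simp: truncated_green_def)
  moreover have "- 32 / (1 + sqdist c x) ^ 3 \<le> 0" using sqdist_nonneg[of c x] by simp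
  ultimately show ?thesis by linarith
next
  case False
  define s where "s = sqdist c x"
  define y where "y i = real (x ! i) - real (c ! i)" for i
  define k where "k = 1 / ((real m)\<^sup>2 + 2)"
  have s0: "s \<ge> 0" by (simp add: s_def sqdist_nonneg)
  have len: "length x = 4" using x by (simp add: torus_iff)
  have sm: "sqdist c x < (real m)\<^sup>2" using truncated_green_pos[OF False] .
  have ge: "1 / (sqdist c z + 2) - k \<le> truncated_green m c z" for z
    by (simp add: truncated_green_def k_def)
  have fx: "truncated_green m c x = 1 / (s + 2) - k"
    using False by (simp add: truncated_green_def k_def s_def max_def split: if_splits)
  have coord: "2 / (s + 3) + 8 * (y i)\<^sup>2 / (s + 3) ^ 3 - 2 / (s + 2)
      \<le> truncated_green m c (x[i := fwd n (x ! i)]) + truncated_green m c (x[i := bwd n (x ! i)]) - 2 * truncated_green m c x"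
    if i: "i < 4" for i
  proof -
    \<comment> \<open>\<open>sqdist\<close> does not wrap around. Inside the support the margins of
      \<open>c\<close> keep both neighbours away from the seam of the torus, so \<open>fwd\<close>
      and \<open>bwd\<close> are ordinary unit shifts.\<close>
    have "\<bar>y i\<bar> < real m" unfolding y_def by (rule sqdist_less_coord[OF sm i])
    then have "1 \<le> x ! i" "x ! i + 1 < n" using c[OF i] by (auto simp: y_def)
    then have "fwd n (x ! i) = x ! i + 1" "bwd n (x ! i) = x ! i - 1" and "real (x ! i - 1) = real (x ! i) - 1"
      by (auto simp: fwd_eq bwd_eq)
    then have "sqdist c (x[i := fwd n (x ! i)]) = s + 2 * y i + 1" "sqdist c (x[i := bwd n (x ! i)]) = s - 2 * y i + 1"
      using i len by (simp_all add: sqdist_update s_def y_def algebra_simps power2_eq_square)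
    then have "1 / (s + 2 * y i + 1 + 2) - k \<le> truncated_green m c (x[i := fwd n (x ! i)])"
      "1 / (s - 2 * y i + 1 + 2) - k \<le> truncated_green m c (x[i := bwd n (x ! i)])"
      using ge by metis+
    moreover have "2 / (s + 3) + 8 * (y i)\<^sup>2 / (s + 3) ^ 3 \<le> 1 / (s + 2 * y i + 1 + 2) + 1 / (s - 2 * y i + 1 + 2)"
      unfolding s_def y_def using i by (intro reciprocal_second_difference sqdist_coord)
    ultimately show ?thesis unfolding fx by (simp add: algebra_simps)
  qed
  have "- 32 / (1 + s) ^ 3 \<le> - 32 / ((s + 3)\<^sup>2 * (s + 2))"
  proof -
    have "(1 + s) ^ 3 \<le> (s + 3)\<^sup>2 * (s + 2)"
      unfolding power3_eq_cube power2_eq_square using s0 by (intro mult_mono) auto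
    then show ?thesis using s0 by (simp add: divide_left_mono)
  qed
  also have "\<dots> \<le> 8 / (s + 3) + 8 * s / (s + 3) ^ 3 - 8 / (s + 2)"
  proof -
    have "8 / (s + 3) + 8 * s / (s + 3) ^ 3 - 8 / (s + 2) - (- 32 / ((s + 3)\<^sup>2 * (s + 2))) = 24 / ((s + 3) ^ 3 * (s + 2))"
      using s0 by (simp add: divide_simps) (simp add: algebra_simps power2_eq_square power3_eq_cube)
    moreover have "24 / ((s + 3) ^ 3 * (s + 2)) \<ge> 0" using s0 by simp
    ultimately show ?thesis by linarith
  qed
  also have "\<dots> = (\<Sum>i<4. 2 / (s + 3) + 8 * (y i)\<^sup>2 / (s + 3) ^ 3 - 2 / (s + 2))"
    by (simp add: sum.distrib sum_subtractf s_def sqdist_def y_def flip: sum_divide_distrib sum_distrib_left)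
  also have "\<dots> \<le> (\<Sum>i<4. truncated_green m c (x[i := fwd n (x ! i)]) + truncated_green m c (x[i := bwd n (x ! i)]) - 2 * truncated_green m c x)"
    using coord by (intro sum_mono) auto
  also have "\<dots> = graph_laplacian (torus 4 n) (torus_adj n) (truncated_green m c) x"
    using n by (simp add: laplacian_torus[OF _ x] edge_weight_def)
  finally show ?thesis unfolding s_def .
qed

text \<open>By \<open>sum_abs_laplacian\<close> only the negative part counts. It decays like |x -
  c|^(-6) while shells grow like k^3, so the bound is uniform in \<open>n\<close>, \<open>m\<close>
  and \<open>c\<close>.\<close>

lemma laplacian_truncated_green_L1:
  "\<exists>A>0. \<forall>n m c. n \<ge> 3 \<longrightarrow> length c = 4 \<longrightarrow> (\<forall>i<4. m < c ! i \<and> c ! i + m < n) \<longrightarrow>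
    (\<Sum>x\<in>torus 4 n. \<bar>graph_laplacian (torus 4 n) (torus_adj n) (truncated_green m c) x\<bar>) \<le> A"
proof -
  define S where "S = (\<Sum>k. real k powr (- 3/2))"
  have S: "S \<ge> 0" unfolding S_def by (intro suminf_nonneg) (auto simp: summable_real_powr_iff)
  have "(\<Sum>x\<in>torus 4 n. \<bar>graph_laplacian (torus 4 n) (torus_adj n) (truncated_green m c) x\<bar>) \<le> 2 * (32 + 512 * (32 * S))"
    if n: "n \<ge> 3" and len: "length c = 4" and c: "\<And>i. i < 4 \<Longrightarrow> m < c ! i \<and> c ! i + m < n" for n m c
  proof -
    let ?V = "torus 4 n" and ?L = "graph_laplacian (torus 4 n) (torus_adj n) (truncated_green m c)"
    define \<rho> where "\<rho> i a = (if a \<le> c ! i then c ! i - a else a - c ! i)" for i a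
    define F where "F k = 32 / (1 + (real k)\<^sup>2) ^ 3" for k
    have real_rho: "real (\<rho> i a) = \<bar>real a - real (c ! i)\<bar>" for i a by (simp add: \<rho>_def)
    have F0: "F k \<ge> 0" for k by (simp add: F_def)
    have neg: "max 0 (- ?L x) \<le> F (radius \<rho> x)" if x: "x \<in> ?V" for x
    proof -
      have lx: "length x = 4" "x \<noteq> []" using x by (auto simp: torus_iff)
      then obtain i where i: "i < 4" "radius \<rho> x = \<rho> i (x ! i)" using radius_attained[of x \<rho>] by auto
      have "(real (radius \<rho> x))\<^sup>2 \<le> sqdist c x" using sqdist_coord[OF i(1), of x c] by (simp add: i(2) real_rho)
      then have "32 / (1 + sqdist c x) ^ 3 \<le> F (radius \<rho> x)"
        unfolding F_def using sqdist_nonneg[of c x]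
        by (intro divide_left_mono power_mono mult_pos_pos zero_less_power) (auto intro: add_pos_nonneg)
      then show ?thesis using laplacian_truncated_green_ge[OF n x c] F0[of "radius \<rho> x"] by simp
    qed
    have "(\<Sum>x\<in>?V. max 0 (- ?L x)) \<le> (\<Sum>x\<in>?V. F (radius \<rho> x))" using neg by (intro sum_mono)
    \<comment> \<open>The centre has radius 0 and lies in none of the shells, so it is split
      off.\<close>
    also have "\<dots> \<le> (\<Sum>x\<in>insert c {x \<in> ?V. radius \<rho> x \<ge> 1}. F (radius \<rho> x))"
    proof (rule sum_mono2)
      show "?V \<subseteq> insert c {x \<in> ?V. radius \<rho> x \<ge> 1}"
      proof
        fix x assume x: "x \<in> ?V"
        show "x \<in> insert c {x \<in> ?V. radius \<rho> x \<ge> 1}"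
        proof (cases "radius \<rho> x \<ge> 1")
          case False
          have "x ! i = c ! i" if "i < 4" for i
            using radius_coord[of i x \<rho>] x False that by (auto simp: torus_iff \<rho>_def split: if_splits)
          then have "x = c" using x len by (intro nth_equalityI) (auto simp: torus_iff)
          then show ?thesis by simp
        qed (use x in auto)
      qed
    qed (auto simp: F0)
    also have "\<dots> \<le> F (radius \<rho> c) + (\<Sum>x\<in>{x \<in> ?V. radius \<rho> x \<ge> 1}. F (radius \<rho> x))"
      using F0 by (simp add: sum.insert_if)
    also have "(\<Sum>x\<in>{x \<in> ?V. radius \<rho> x \<ge> 1}. F (radius \<rho> x)) \<le> 2 * real 4 * 4 ^ (4 - 1) * (\<Sum>k=1..n. real k ^ (4 - 1) * F k)"
    proof (rule sum_shells_le)
      show "card {a. a < n \<and> \<rho> i a = k} \<le> 2" for i k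
      proof -
        have "{a. a < n \<and> \<rho> i a = k} \<subseteq> {c ! i - k, c ! i + k}" by (auto simp: \<rho>_def)
        then have "card {a. a < n \<and> \<rho> i a = k} \<le> card {c ! i - k, c ! i + k}" by (intro card_mono) auto
        also have "\<dots> \<le> 2" by (simp add: card_insert_if)
        finally show ?thesis .
      qed
      show "\<rho> i a \<le> n" if "i < 4" "a < n" for i a using c[OF that(1)] that(2) by (auto simp: \<rho>_def)
    qed (auto simp: F0)
    also have "(\<Sum>k=1..n. real k ^ (4 - 1) * F k) \<le> (\<Sum>k=1..n. 32 * real k powr (- 3/2))"
    proof (rule sum_mono)
      fix k assume "k \<in> {1..n}"
      then have k: "real k \<ge> 1" by simp
      have "(real k) ^ 6 = ((real k)\<^sup>2) ^ 3" by (simp flip: power_mult)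
      also have "\<dots> \<le> (1 + (real k)\<^sup>2) ^ 3" by (intro power_mono) auto
      finally have "32 / (1 + (real k)\<^sup>2) ^ 3 \<le> 32 / real k ^ 6" using k by (intro divide_left_mono mult_pos_pos) (auto intro: add_pos_nonneg)
      then have "real k ^ 3 * F k \<le> real k ^ 3 * (32 / real k ^ 6)"
        unfolding F_def by (intro mult_left_mono) auto
      also have "\<dots> = 32 * real k powr (- 3)"
        using k by (simp add: powr_minus powr_numeral divide_simps flip: power_add)
      also have "\<dots> \<le> 32 * real k powr (- 3/2)" using k by (intro mult_left_mono powr_mono) auto
      finally show "real k ^ (4 - 1) * F k \<le> 32 * real k powr (- 3/2)" by simp
    qed
    also have "\<dots> \<le> 32 * S" using sum_powr_three_halves_le[of n] by (simp add: S_def flip: sum_distrib_left)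
    finally have "(\<Sum>x\<in>?V. max 0 (- ?L x)) \<le> F (radius \<rho> c) + 512 * (32 * S)" by simp
    moreover have "F (radius \<rho> c) \<le> 32"
    proof -
      have "1 \<le> (1 + (real (radius \<rho> c))\<^sup>2) ^ 3" by (rule one_le_power) simp
      then have "32 / (1 + (real (radius \<rho> c))\<^sup>2) ^ 3 \<le> 32 / 1" by (intro divide_left_mono) (auto intro: add_pos_nonneg)
      then show ?thesis by (simp add: F_def)
    qed
    ultimately have "(\<Sum>x\<in>?V. max 0 (- ?L x)) \<le> 32 + 512 * (32 * S)" by linarith
    then show ?thesis using sum_abs_laplacian[of ?V "torus_adj n" "truncated_green m c"] by (simp add: torus_adj_sym)
  qed
  then show ?thesis using S by (intro exI[of _ "2 * (32 + 512 * (32 * S))"]) auto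
qed

text \<open>Each of the dyadic cubes \<open>c + [2\<^sup>k, 2\<^sup>k\<^sup>+\<^sup>1)\<^sup>4\<close> with \<open>k \<le> K\<close> contributes a constant.\<close>

lemma truncated_green_L2:
  assumes m: "m = 2 ^ (K + 3)" and c: "\<And>i. i < 4 \<Longrightarrow> c ! i + m < n"
  shows "real (K + 1) / 1296 \<le> (\<Sum>x\<in>torus 4 n. (truncated_green m c x)\<^sup>2)"
proof -
  define Q where "Q k = {x \<in> torus 4 n. \<forall>i<4. c ! i + 2 ^ k \<le> x ! i \<and> x ! i < c ! i + 2 ^ Suc k}" for k
  have four: "(4::real) ^ k = (2 ^ k)\<^sup>2" and sixteen: "(16::real) ^ k = (4 ^ k)\<^sup>2" for k
    by (simp_all add: power2_eq_square flip: power_mult_distrib)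
  have card_Q: "card (Q k) = 16 ^ k" if k: "k \<le> K" for k
  proof -
    have "card {a. a < n \<and> c ! i + 2 ^ k \<le> a \<and> a < c ! i + 2 ^ Suc k} = 2 ^ k" if "i < 4" for i
    proof -
      have "(2::nat) ^ Suc k \<le> 2 ^ (K + 3)" using k by (intro power_increasing) auto
      then have "{a. a < n \<and> c ! i + 2 ^ k \<le> a \<and> a < c ! i + 2 ^ Suc k} = {c ! i + 2 ^ k..<c ! i + 2 ^ Suc k}"
        using c[OF that] m by auto
      then show ?thesis by simp
    qed
    then have "card (Q k) = (\<Prod>i<4::nat. 2 ^ k)"
      unfolding Q_def card_torus_box[where P = "\<lambda>i a. c ! i + 2 ^ k \<le> a \<and> a < c ! i + 2 ^ Suc k"]
      by (intro prod.cong refl) (simp only: lessThan_iff)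
    also have "\<dots> = (2 ^ 4) ^ k" by (simp only: prod_constant card_lessThan power_mult[symmetric] mult.commute)
    finally show ?thesis by simp
  qed
  have val: "1 / (1296 * 16 ^ k) \<le> (truncated_green m c x)\<^sup>2" if k: "k \<le> K" and x: "x \<in> Q k" for k x
  proof -
    have "(real (x ! i) - real (c ! i))\<^sup>2 \<le> 4 * 4 ^ k" if i: "i < 4" for i
    proof -
      have b: "c ! i + 2 ^ k \<le> x ! i" "x ! i < c ! i + 2 ^ Suc k" using x i by (auto simp: Q_def)
      have "real (x ! i) < real (c ! i + 2 ^ Suc k)" using b(2) by (rule of_nat_less_iff[THEN iffD2])
      then have "real (x ! i) - real (c ! i) \<le> 2 * 2 ^ k" by simp
      moreover have "0 \<le> real (x ! i) - real (c ! i)" using b(1) by simp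
      ultimately have "(real (x ! i) - real (c ! i))\<^sup>2 \<le> (2 * 2 ^ k)\<^sup>2" by (intro power_mono)
      also have "(2 * 2 ^ k)\<^sup>2 = 4 * (4::real) ^ k" by (simp add: power_mult_distrib four)
      finally show ?thesis .
    qed
    then have "sqdist c x \<le> (\<Sum>i<4::nat. 4 * 4 ^ k)" unfolding sqdist_def by (intro sum_mono) auto
    then have "sqdist c x \<le> 16 * 4 ^ k" by simp
    moreover have "(1::real) \<le> 4 ^ k" by (rule one_le_power) simp
    ultimately have s: "sqdist c x + 2 \<le> 18 * 4 ^ k" by linarith
    \<comment> \<open>The choice \<open>m = 8 * 2 ^ K\<close> keeps the cutoff below half of
      \<open>1 / (18 * 4 ^ k)\<close>, so \<open>1 / (36 * 4 ^ k)\<close> survives. Squaring gives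
      1296 = 36^2 and a factor \<open>16 ^ k\<close> that the number of points in the cube
      compensates.\<close>
    have "1 / (18 * 4 ^ k) \<le> 1 / (sqdist c x + 2)"
      using s sqdist_nonneg[of c x] by (intro divide_left_mono mult_pos_pos) auto
    moreover have "1 / ((real m)\<^sup>2 + 2) \<le> 1 / (36 * 4 ^ k)"
    proof -
      have "(real m)\<^sup>2 = 64 * 4 ^ K" unfolding m
        by (simp add: power_add power_mult_distrib four)
      moreover have "(4::real) ^ k \<le> 4 ^ K" using k by (intro power_increasing) auto
      moreover have "(0::real) < 4 ^ k" by simp
      ultimately have "36 * 4 ^ k \<le> (real m)\<^sup>2 + 2" by linarith
      then show ?thesis by (intro divide_left_mono mult_pos_pos) (auto intro: add_nonneg_pos)
    qed
    moreover have "1 / (18 * 4 ^ k) = 1 / (36 * 4 ^ k) + 1 / (36 * (4::real) ^ k)" by (simp add: divide_simps)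
    ultimately have "1 / (36 * 4 ^ k) \<le> truncated_green m c x" unfolding truncated_green_def by linarith
    then have "(1 / (36 * 4 ^ k))\<^sup>2 \<le> (truncated_green m c x)\<^sup>2" by (intro power_mono) auto
    moreover have "(1 / (36 * 4 ^ k))\<^sup>2 = 1 / (1296 * (16::real) ^ k)"
      by (simp add: power_divide power_mult_distrib sixteen)
    ultimately show ?thesis by simp
  qed
  have disj: "Q k \<inter> Q l = {}" if "k < l" for k l
  proof -
    have "(2::nat) ^ Suc k \<le> 2 ^ l" using that by (intro power_increasing) auto
    then have False if "x \<in> Q k" "x \<in> Q l" for x
    proof -
      have "x ! 0 < c ! 0 + 2 ^ Suc k" "c ! 0 + 2 ^ l \<le> x ! 0" using that by (auto simp: Q_def)
      then show False using \<open>2 ^ Suc k \<le> 2 ^ l\<close> by linarith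
    qed
    then show ?thesis by blast
  qed
  have "real (K + 1) / 1296 = (\<Sum>k\<le>K. 1 / 1296)" by simp
  also have "\<dots> = (\<Sum>k\<le>K. \<Sum>x\<in>Q k. 1 / (1296 * 16 ^ k))"
    using card_Q by (intro sum.cong refl) simp
  also have "\<dots> \<le> (\<Sum>k\<le>K. \<Sum>x\<in>Q k. (truncated_green m c x)\<^sup>2)"
    using val by (intro sum_mono) auto
  also have "\<dots> = (\<Sum>x\<in>(\<Union>k\<le>K. Q k). (truncated_green m c x)\<^sup>2)"
  proof (rule sum.UNION_disjoint[symmetric])
    show "\<forall>k\<in>{..K}. \<forall>l\<in>{..K}. k \<noteq> l \<longrightarrow> Q k \<inter> Q l = {}"
      using disj by (metis Int_commute linorder_neqE_nat)
  qed (auto simp: Q_def)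
  also have "\<dots> \<le> (\<Sum>x\<in>torus 4 n. (truncated_green m c x)\<^sup>2)"
    by (intro sum_mono2) (auto simp: Q_def)
  finally show ?thesis .
qed

text \<open>The supports have radius \<open>m\<close> of order sqrt n, so the L2 norm
  \<open>v\<close> is of order \<open>sqrt (ln n)\<close>. There is still room for
  \<open>2 ^ K\<close> disjoint ones, again of order sqrt n, so the maximum over them gives a second
  factor \<open>sqrt (ln n)\<close>.\<close>

lemma lower_bound_4: "\<exists>C>0. \<forall>n\<ge>2. ln (real n) \<le> C * mean_odometer 4 n"
proof -
  obtain A where A: "A > 0" and L1: "\<forall>n m c. n \<ge> 3 \<longrightarrow> length c = 4 \<longrightarrow> (\<forall>i<4. m < c ! i \<and> c ! i + m < n) \<longrightarrow>
    (\<Sum>x\<in>torus 4 n. \<bar>graph_laplacian (torus 4 n) (torus_adj n) (truncated_green m c) x\<bar>) \<le> A"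
    using laplacian_truncated_green_L1 by (elim exE conjE) (rule that)
  obtain N where N: "\<And>l. l \<ge> N \<Longrightarrow> ln 2 \<le> real l * std_normal_density (sqrt (ln (real l)) + 1) \<and> 16 \<le> ln (real l)"
    using gaussian_exceedance_threshold by blast
  have pos4: "mean_odometer 4 n > 0" if "n \<ge> 2" for n using mean_odometer_pos[of 4 n] that by simp
  show ?thesis
  proof (rule eventual_domination[where m = "4 ^ (N + 5)" and C = "10 * 288 * A"])
    fix n :: nat assume nN: "n \<ge> 4 ^ (N + 5)" and n: "n \<ge> 2"
    obtain j where j: "4 ^ j \<le> n" "n < 4 ^ (j + 1)"
      using ex_power_ivl1[of 4 n] n by auto
    have "(4::nat) ^ (N + 5) < 4 ^ (j + 1)" using nN j(2) by linarith
    then have "N + 5 \<le> j" by (subst (asm) power_strict_increasing_iff) auto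
    define K where "K = j - 3"
    have K: "j = K + 3" "K \<ge> N" "K \<ge> 1" using \<open>N + 5 \<le> j\<close> by (auto simp: K_def)
    define m where "m = (2::nat) ^ (K + 3)"
    \<comment> \<open>Centres lie along the first axis at spacing \<open>2 * m + 3\<close>, more
      than twice the radius of a support. They fit because
      \<open>(2 * m + 3) * 2 ^ K <= 19 * 4 ^ K\<close>, whereas
      \<open>n >= 4 ^ j = 64 * 4 ^ K\<close>.\<close>
    define ctr where "ctr i = [m + 1 + (2 * m + 3) * i, m + 1, m + 1, m + 1]" for i
    have room: "(2 * m + 3) * 2 ^ K \<le> n"
    proof -
      have "(2 * m + 3) * 2 ^ K = 16 * 4 ^ K + 3 * 2 ^ K"
        by (simp add: m_def power_add add_mult_distrib flip: power_mult_distrib)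
      also have "(2::nat) ^ K \<le> 4 ^ K" by (intro power_mono) auto
      finally have "(2 * m + 3) * 2 ^ K \<le> 64 * 4 ^ K" by simp
      also have "64 * 4 ^ K = (4::nat) ^ (K + 3)" by (simp add: power_add)
      finally show ?thesis using j(1) K(1) by simp
    qed
    have ctr: "m < ctr i ! l \<and> ctr i ! l + m < n" if "i < 2 ^ K" "l < 4" for i l
    proof -
      have "(2 * m + 3) * (i + 1) \<le> (2 * m + 3) * 2 ^ K" using that(1) by (intro mult_left_mono) auto
      then have "m + 1 + (2 * m + 3) * i + m < n" using room by (simp add: algebra_simps)
      moreover have "l = 0 \<or> l = 1 \<or> l = 2 \<or> l = 3" using that(2) by linarith
      ultimately show ?thesis by (auto simp: ctr_def)
    qed
    have "3 * 1 \<le> (2 * m + 3) * 2 ^ K" by (intro mult_mono) auto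
    then have n3: "n \<ge> 3" using room by linarith
    define v where "v = sqrt (real (K + 1)) / 36"
    have v: "v > 0" "v\<^sup>2 = real (K + 1) / 1296" by (auto simp: v_def power_divide)
    have "K < 2 ^ K" by (rule less_exp)
    then have "N \<le> 2 ^ K" using K(2) by linarith
    have "v * sqrt (ln (real (card {..<(2::nat) ^ K}))) / 4 \<le> A * mean_odometer 4 n"
    proof (rule mean_odometer_ge_family[OF n finite_lessThan v(1)])
      fix i assume i: "i \<in> {..<(2::nat) ^ K}"
      show "v\<^sup>2 \<le> (\<Sum>y\<in>torus 4 n. (truncated_green m (ctr i) y)\<^sup>2)"
        unfolding v(2) using ctr i by (intro truncated_green_L2[OF m_def]) auto
      show "(\<Sum>y\<in>torus 4 n. \<bar>graph_laplacian (torus 4 n) (torus_adj n) (truncated_green m (ctr i)) y\<bar>) \<le> A"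
      proof (rule L1[rule_format, OF n3])
        show "length (ctr i) = 4" by (simp add: ctr_def)
      qed (use ctr i in auto)
    next
      fix i l y assume il: "i \<in> {..<(2::nat) ^ K}" "l \<in> {..<(2::nat) ^ K}" "i \<noteq> l" and y: "y \<in> torus 4 n"
      have apart: False if "i < l" "truncated_green m (ctr i) y \<noteq> 0" "truncated_green m (ctr l) y \<noteq> 0" for i l
      proof -
        have "\<bar>real (y ! 0) - real (ctr i ! 0)\<bar> < real m" "\<bar>real (y ! 0) - real (ctr l ! 0)\<bar> < real m"
          using that truncated_green_pos sqdist_less_coord by auto
        then have "real (ctr l ! 0) < real (ctr i ! 0) + 2 * real m" by linarith
        then have "ctr l ! 0 < ctr i ! 0 + 2 * m" by linarith
        moreover have "(2 * m + 3) * (i + 1) \<le> (2 * m + 3) * l" using that(1) by (intro mult_left_mono) auto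
        ultimately show False by (simp add: ctr_def algebra_simps)
      qed
      show "truncated_green m (ctr i) y = 0 \<or> truncated_green m (ctr l) y = 0"
        using apart[of i l] apart[of l i] il(3) by (meson linorder_neqE_nat)
    qed (use N[of "2 ^ K"] \<open>N \<le> 2 ^ K\<close> in auto)
    then have main: "v * sqrt (real K * ln 2) / 4 \<le> A * mean_odometer 4 n"
      by (simp add: ln_realpow)
    \<comment> \<open>144 = 36 * 4, from \<open>v\<close> and from the quarter in
      \<open>mean_odometer_ge_family\<close>; the factor 1/2 is a lower bound for
      \<open>sqrt (ln 2)\<close>.\<close>
    have "real K / 144 * (1/2) \<le> v * sqrt (real K * ln 2) / 4"
    proof -
      have "real K * (1/2) = sqrt (real K) * (sqrt (real K) * sqrt (1/4))"
        by (simp add: real_sqrt_divide)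
      also have "\<dots> \<le> sqrt (real (K + 1)) * (sqrt (real K) * sqrt (ln 2))"
        using ln2_ge_two_thirds by (intro mult_mono) auto
      finally show ?thesis by (simp add: v_def real_sqrt_mult)
    qed
    then have KA: "real K \<le> 288 * (A * mean_odometer 4 n)" using main by linarith
    have "ln (real n) \<le> ln (real (4 ^ (K + 4)))"
      using j(2) n K(1) by (subst ln_le_cancel_iff) (auto simp del: of_nat_power simp: add.commute)
    also have "\<dots> = real (K + 4) * ln 4" by (simp add: ln_realpow del: of_nat_add)
    also have "\<dots> \<le> (5 * real K) * 2"
    proof (rule mult_mono)
      have "ln (4::real) = 2 * ln 2" using ln_realpow[of 2 2] by simp
      then show "ln (4::real) \<le> 2" using ln_2_less_1 by simp
    qed (use K(3) in auto)
    finally have "ln (real n) \<le> 10 * real K" by simp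
    then show "ln (real n) \<le> 10 * 288 * A * mean_odometer 4 n" using KA by simp
  qed (use A pos4 in auto)
qed

section \<open>All dimensions combined\<close>

lemma sqrt_power_ratio:
  assumes "n \<ge> 2"
  shows "sqrt (real n ^ 4 / real n ^ 1) = real n powr (3/2)"
    and "sqrt (real n ^ 4 / real n ^ 2) = real n"
    and "sqrt (real n ^ 4 / real n ^ 3) = sqrt (real n)"
proof -
  have "real n ^ 4 / real n ^ 1 = real n powr 3"
    using assms by (simp add: power_numeral_reduce)
  then show "sqrt (real n ^ 4 / real n ^ 1) = real n powr (3/2)"
    using assms by (simp only: powr_half_sqrt[symmetric] powr_ge_zero powr_powr) simp
qed (use assms in \<open>simp_all add: power_numeral_reduce\<close>)

lemma mean_odometer_bounds:
  assumes d: "d \<ge> 1"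
  obtains c C where "c > 0" "C > 0" "\<And>n. n \<ge> 2 \<Longrightarrow> phi d n \<le> c * mean_odometer d n"
    "\<And>n. n \<ge> 2 \<Longrightarrow> mean_odometer d n \<le> C * phi d n"
proof (cases "d \<le> 3")
  case True
  have phi_eq: "phi d n = sqrt (real n ^ 4 / real n ^ d)" if "n \<ge> 2" for n
  proof -
    have "d = 1 \<or> d = 2 \<or> d = 3" using d True by linarith
    then show ?thesis using sqrt_power_ratio[OF that] by (auto simp: phi_def)
  qed
  obtain c where c: "c > 0" "\<forall>n\<ge>2. c * sqrt (real n ^ 4 / real n ^ d) \<le> mean_odometer d n"
    using lower_bound_frequency[OF d] by blast
  obtain C where C: "C > 0" "\<forall>n\<ge>2. mean_odometer d n \<le> C * sqrt (real n ^ 4 / real n ^ d)"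
    using upper_bound_le3[OF d True] by blast
  show ?thesis
  proof (rule that[of "1 / c" C])
    show "phi d n \<le> 1 / c * mean_odometer d n" if "n \<ge> 2" for n
      using c that phi_eq[OF that] by (simp add: field_simps)
  qed (use c C phi_eq in auto)
next
  case False
  show ?thesis
  proof (cases "d = 4")
    case True
    obtain c where "c > 0" "\<forall>n\<ge>2. ln (real n) \<le> c * mean_odometer 4 n" using lower_bound_4 by blast
    moreover obtain C where "C > 0" "\<forall>n\<ge>2. mean_odometer 4 n \<le> C * ln (real n)" using upper_bound_4 by blast
    ultimately show ?thesis using True by (intro that[of c C]) (auto simp: phi_def)
  next
    case False
    then have d5: "d \<ge> 5" using \<open>\<not> d \<le> 3\<close> by simp
    obtain c where "c > 0" "\<forall>n\<ge>2. sqrt (ln (real n)) \<le> c * mean_odometer d n"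
      using lower_bound_sqrt_ln[OF d] by blast
    moreover obtain C where "C > 0" "\<forall>n\<ge>2. mean_odometer d n \<le> C * sqrt (ln (real n))"
      using upper_bound_ge5[OF d5] by blast
    ultimately show ?thesis using d5 by (intro that[of c C]) (auto simp: phi_def)
  qed
qed

theorem theorem1p2:
  fixes d :: nat
  assumes "d \<ge> 1"
  shows "(\<forall>n\<ge>2. \<forall>\<sigma> :: nat list \<Rightarrow> real.
            (\<forall>x\<in>torus d n. odometer (torus d n) (torus_adj n) (sandpile d n \<sigma>) x < \<infinity>) \<and>
            (\<forall>x\<in>torus d n. sandpile d n \<sigma> x
               + graph_laplacian (torus d n) (torus_adj n)
                   (\<lambda>y. real_of_ereal (odometer (torus d n) (torus_adj n) (sandpile d n \<sigma>) y)) x = 1))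
       \<and> (\<exists>C>0. \<forall>n\<ge>2. \<forall>x\<in>torus d n.
            integrable (gauss_field d n)
              (\<lambda>\<sigma>. real_of_ereal (odometer (torus d n) (torus_adj n) (sandpile d n \<sigma>) x)) \<and>
            phi d n / C \<le> (\<integral>\<sigma>. real_of_ereal (odometer (torus d n) (torus_adj n) (sandpile d n \<sigma>) x) \<partial>gauss_field d n) \<and>
            (\<integral>\<sigma>. real_of_ereal (odometer (torus d n) (torus_adj n) (sandpile d n \<sigma>) x) \<partial>gauss_field d n) \<le> C * phi d n)"
proof (intro conjI allI impI)
  fix n :: nat and \<sigma> :: "nat list \<Rightarrow> real"
  assume n: "n \<ge> 2"
  let ?V = "torus d n" and ?g = "potential d n \<sigma>"
  show "\<forall>x\<in>?V. odometer ?V (torus_adj n) (sandpile d n \<sigma>) x < \<infinity>"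
    by (simp add: odometer_eq[OF n])
  show "\<forall>x\<in>?V. sandpile d n \<sigma> x + graph_laplacian ?V (torus_adj n)
      (\<lambda>y. real_of_ereal (odometer ?V (torus_adj n) (sandpile d n \<sigma>) y)) x = 1"
  proof
    fix x assume x: "x \<in> ?V"
    \<comment> \<open>On the torus the odometer and the potential differ by a constant, which the
      Laplacian does not see.\<close>
    have "graph_laplacian ?V (torus_adj n) (\<lambda>y. real_of_ereal (odometer ?V (torus_adj n) (sandpile d n \<sigma>) y)) x
        = graph_laplacian ?V (torus_adj n) ?g x"
      unfolding graph_laplacian_def using x by (intro sum.cong refl) (simp add: odometer_eq[OF n])
    then show "sandpile d n \<sigma> x + graph_laplacian ?V (torus_adj n)
        (\<lambda>y. real_of_ereal (odometer ?V (torus_adj n) (sandpile d n \<sigma>) y)) x = 1"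
      using laplacian_potential[OF n x, of \<sigma>] by (simp add: sandpile_def)
  qed
next
  obtain c C where cC: "c > 0" "C > 0" and lower: "\<And>n. n \<ge> 2 \<Longrightarrow> phi d n \<le> c * mean_odometer d n"
    and upper: "\<And>n. n \<ge> 2 \<Longrightarrow> mean_odometer d n \<le> C * phi d n"
    using mean_odometer_bounds[OF assms] by metis
  let ?C = "max c C"
  have phi0: "phi d n \<ge> 0" if "n \<ge> 2" for n using that by (simp add: phi_def)
  have "phi d n / ?C \<le> mean_odometer d n" "mean_odometer d n \<le> ?C * phi d n" if n: "n \<ge> 2" for n
  proof -
    have "phi d n \<le> ?C * mean_odometer d n"
      using mean_odometer_pos[OF assms n] by (intro order_trans[OF lower[OF n] mult_right_mono]) auto
    then show "phi d n / ?C \<le> mean_odometer d n" using cC by (simp add: divide_le_eq mult.commute)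
    show "mean_odometer d n \<le> ?C * phi d n"
      using phi0[OF n] by (intro order_trans[OF upper[OF n] mult_right_mono]) auto
  qed
  then show "\<exists>C>0. \<forall>n\<ge>2. \<forall>x\<in>torus d n.
      integrable (gauss_field d n)
        (\<lambda>\<sigma>. real_of_ereal (odometer (torus d n) (torus_adj n) (sandpile d n \<sigma>) x)) \<and>
      phi d n / C \<le> (\<integral>\<sigma>. real_of_ereal (odometer (torus d n) (torus_adj n) (sandpile d n \<sigma>) x) \<partial>gauss_field d n) \<and>
      (\<integral>\<sigma>. real_of_ereal (odometer (torus d n) (torus_adj n) (sandpile d n \<sigma>) x) \<partial>gauss_field d n) \<le> C * phi d n"
    using cC by (intro exI[of _ ?C]) (simp add: expectation_odometer)
qed

end
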